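(* Fix $\epsilon>0$ and $D>0$. Let $\mathcal{H}_{\epsilon,D}$ be the set of hypergraphs with minimum edge size at least $3$ in which each vertex lies in at most $\Delta_i\le D$ edges of size $i$, for each $i$, such that $\sum_{i\ge 3}\Delta_i 2^{-i/2}\le\frac{1-\epsilon}{6\sqrt{2}}$. For every $\beta\in(0,1]$ and $c>0$ there exists an $(n^{\beta},O(m),\log^{-c}n)$-local computation algorithm for $2$-coloring hypergraphs in $\mathcal{H}_{\epsilon,D}$ that answers up to $\log^{c}(n)$ queries.
   Context: Here $n$ is the number of vertices and $m$ the number of edges of the hypergraph; a $2$-coloring is an assignment of two colors to vertices with no monochromatic edge. A $(t,s,\delta)$-local computation algorithm answering up to $q$ queries is a randomized algorithm that receives, one by one, up to $q$ queries (vertices) and for each outputs a color, such that with probability at least $1-\delta$ there exists a proper $2$-coloring agreeing with all outputs; it has RAM access to the input, a random tape and persistent local memory, runs in time at most $t$ per query and uses local memory at most $s$. "There exists" such an algorithm means there are $n_0$ and an algorithm with these guarantees for all hypergraphs in the class with $n\ge n_0$ vertices.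
   Formalization: RAM access to the input is taken to list the edges at each vertex in order of size: vertex degrees are not bounded, and with arbitrarily ordered lists the claim fails for small β. Local memory is counted in words of O(log(n+m)) bits. *)

theory Defs
  imports "HOL-Probability.Probability" "HOL-Library.Log_Nat"
begin

section \<open>Hypergraphs and 2-colorings\<close>

definition hypergraph :: "'a set \<Rightarrow> 'a set set \<Rightarrow> bool" where
  "hypergraph V E \<longleftrightarrow> finite V \<and> (\<forall>e\<in>E. e \<subseteq> V)"

definition monochromatic :: "('a \<Rightarrow> bool) \<Rightarrow> 'a set \<Rightarrow> bool" where
  "monochromatic f e \<longleftrightarrow> (\<exists>b. \<forall>v\<in>e. f v = b)"

definition two_coloring :: "'a set set \<Rightarrow> ('a \<Rightarrow> bool) \<Rightarrow> bool" where
  "two_coloring E f \<longleftrightarrow> (\<forall>e\<in>E. \<not> monochromatic f e)"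

text \<open>
  The bounds \<open>\<Delta> i\<close> may depend on the hypergraph. Since \<open>\<Delta> i \<le> D\<close>, the series always converges.
\<close>

definition hypergraph_class :: "real \<Rightarrow> real \<Rightarrow> ('a set \<times> 'a set set) set" where
  "hypergraph_class \<epsilon> D = {(V, E).
     hypergraph V E \<and> (\<forall>e\<in>E. 3 \<le> card e) \<and>
     (\<exists>\<Delta> :: nat \<Rightarrow> nat.
        (\<forall>i. real (\<Delta> i) \<le> D) \<and>
        (\<forall>i. \<forall>v\<in>V. card {e\<in>E. v \<in> e \<and> card e = i} \<le> \<Delta> i) \<and>
        (\<Sum>\<^sub>\<infinity>i\<in>{3..}. real (\<Delta> i) * 2 powr (- real i / 2)) \<le> (1 - \<epsilon>) / (6 * sqrt 2))}"


section \<open>Input representation\<close>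

text \<open>
  A hypergraph on \<open>{..<n}\<close> is presented to the algorithm by \<open>n\<close> and a list of edges, each edge being a
  list of its vertices; the order of the edges, and of the vertices inside an edge, is arbitrary.
\<close>

definition lists_edges :: "nat list list \<Rightarrow> nat set set \<Rightarrow> bool" where
  "lists_edges es E \<longleftrightarrow>
     (\<forall>e\<in>set es. distinct e) \<and> distinct (map set es) \<and> set (map set es) = E"

text \<open>
  The indices of the edges at \<open>v\<close>, smaller edges first. The class bounds the number of edges at a vertex
  only for each edge size separately, so that a vertex can have more than \<open>n powr \<beta>\<close> edges; with an
  unsorted incidence list its few small edges could not be found within the time bound.
\<close>

definition incidence_list :: "nat list list \<Rightarrow> nat \<Rightarrow> nat list" where
  "incidence_list es v =
     sort_key (\<lambda>j. length (es ! j)) (filter (\<lambda>j. v \<in> set (es ! j)) [0..<length es])"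

datatype access = Num_Vertices | Num_Edges | Edge_Size | Edge_Vertex | Degree | Incident_Edge

text \<open>Accesses outside the input return 0.\<close>

fun read_input :: "nat \<Rightarrow> nat list list \<Rightarrow> access \<Rightarrow> nat \<Rightarrow> nat \<Rightarrow> nat" where
  "read_input n es Num_Vertices x y = n"
| "read_input n es Num_Edges x y = length es"
| "read_input n es Edge_Size x y = (if x < length es then length (es ! x) else 0)"
| "read_input n es Edge_Vertex x y =
     (if x < length es \<and> y < length (es ! x) then es ! x ! y else 0)"
| "read_input n es Degree x y = length (incidence_list es x)"
| "read_input n es Incident_Edge x y =
     (if y < length (incidence_list es x) then incidence_list es x ! y else 0)"


section \<open>Randomized word RAM\<close>

datatype arith = Add | Sub | Mul | Div | Mod

fun arith_op :: "arith \<Rightarrow> nat \<Rightarrow> nat \<Rightarrow> nat" where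
  "arith_op Add x y = x + y"
| "arith_op Sub x y = x - y"
| "arith_op Mul x y = x * y"
| "arith_op Div x y = x div y"
| "arith_op Mod x y = x mod y"

text \<open>
  RAM programs in structured form. Registers are numbered; a program mentions only finitely many. In every
  command the first register is the destination, except that \<open>Store a b\<close> writes register \<open>b\<close> to the memory
  cell whose address is in register \<open>a\<close>.
\<close>

datatype com =
    Skip
  | Set_Const nat nat
  | Arith arith nat nat nat
  | Input access nat nat nat
  | Load nat nat
  | Store nat nat
  | Flip nat
  | Seq com com
  | Cond nat com com
  | While nat com

text \<open>Registers, local memory, and the part of the random tape that has not been read yet.\<close>

type_synonym state = "(nat \<Rightarrow> nat) \<times> (nat \<Rightarrow> nat) \<times> bool stream"

text \<open>
  \<open>exec n es w S c s t s'\<close>: on the given input, with words of \<open>w\<close> bits and a local memory consisting of the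
  cells \<open>0, \<dots>, S - 1\<close>, the program \<open>c\<close> started in \<open>s\<close> halts in \<open>s'\<close> after \<open>t\<close> steps. A program
  addressing a cell outside the local memory has no execution. Values are reduced modulo \<open>2 ^ w\<close>
  (subtraction is cut off at 0). The random tape can be read only sequentially, one bit per step.
\<close>

inductive exec ::
    "nat \<Rightarrow> nat list list \<Rightarrow> nat \<Rightarrow> nat \<Rightarrow> com \<Rightarrow> state \<Rightarrow> nat \<Rightarrow> state \<Rightarrow> bool"
  for n :: nat and es :: "nat list list" and w S :: nat where
  Skip: "exec n es w S Skip s 1 s"
| Set_Const: "exec n es w S (Set_Const d k) (\<rho>, \<mu>, \<omega>) 1 (\<rho>(d := k mod 2 ^ w), \<mu>, \<omega>)"
| Arith: "exec n es w S (Arith g d a b) (\<rho>, \<mu>, \<omega>) 1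
            (\<rho>(d := arith_op g (\<rho> a) (\<rho> b) mod 2 ^ w), \<mu>, \<omega>)"
| Input: "exec n es w S (Input q d a b) (\<rho>, \<mu>, \<omega>) 1
            (\<rho>(d := read_input n es q (\<rho> a) (\<rho> b) mod 2 ^ w), \<mu>, \<omega>)"
| Load: "\<rho> a < S \<Longrightarrow> exec n es w S (Load d a) (\<rho>, \<mu>, \<omega>) 1 (\<rho>(d := \<mu> (\<rho> a)), \<mu>, \<omega>)"
| Store: "\<rho> a < S \<Longrightarrow> exec n es w S (Store a b) (\<rho>, \<mu>, \<omega>) 1 (\<rho>, \<mu>(\<rho> a := \<rho> b), \<omega>)"
| Flip: "exec n es w S (Flip d) (\<rho>, \<mu>, \<omega>) 1 (\<rho>(d := of_bool (shd \<omega>)), \<mu>, stl \<omega>)"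
| Seq: "exec n es w S c1 s t1 s' \<Longrightarrow> exec n es w S c2 s' t2 s'' \<Longrightarrow>
          exec n es w S (Seq c1 c2) s (t1 + t2) s''"
| Cond_True: "fst s a \<noteq> 0 \<Longrightarrow> exec n es w S c1 s t s' \<Longrightarrow> exec n es w S (Cond a c1 c2) s (Suc t) s'"
| Cond_False: "fst s a = 0 \<Longrightarrow> exec n es w S c2 s t s' \<Longrightarrow> exec n es w S (Cond a c1 c2) s (Suc t) s'"
| While_True: "fst s a \<noteq> 0 \<Longrightarrow> exec n es w S c s t1 s' \<Longrightarrow> exec n es w S (While a c) s' t2 s'' \<Longrightarrow>
          exec n es w S (While a c) s (Suc (t1 + t2)) s''"
| While_False: "fst s a = 0 \<Longrightarrow> exec n es w S (While a c) s 1 s"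


section \<open>Local computation algorithms\<close>

text \<open>
  \<open>answers n es w S T P \<mu> \<omega> vs bs\<close>: starting with local memory \<open>\<mu>\<close> and random tape \<open>\<omega>\<close>, the program \<open>P\<close>
  answers the successive queries \<open>vs\<close> by the colors \<open>bs\<close>, spending at most \<open>T\<close> steps on each. A query
  starts with the queried vertex in register 0 and all other registers cleared, and the answer is read off
  register 0; only the local memory and the position on the random tape survive between queries.
\<close>

inductive answers ::
    "nat \<Rightarrow> nat list list \<Rightarrow> nat \<Rightarrow> nat \<Rightarrow> real \<Rightarrow> com \<Rightarrow>
     (nat \<Rightarrow> nat) \<Rightarrow> bool stream \<Rightarrow> nat list \<Rightarrow> bool list \<Rightarrow> bool"
  for n :: nat and es :: "nat list list" and w S :: nat and T :: real and P :: com where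
  Nil: "answers n es w S T P \<mu> \<omega> [] []"
| Cons: "exec n es w S P ((\<lambda>_. 0)(0 := v), \<mu>, \<omega>) t (\<rho>, \<mu>', \<omega>') \<Longrightarrow> real t \<le> T \<Longrightarrow>
     answers n es w S T P \<mu>' \<omega>' vs bs \<Longrightarrow>
     answers n es w S T P \<mu> \<omega> (v # vs) ((\<rho> 0 \<noteq> 0) # bs)"

definition random_tape :: "bool stream measure" where
  "random_tape = stream_space (measure_pmf (bernoulli_pmf (1/2)))"

text \<open>
  \<open>has_lca \<H> t s \<delta> q\<close>: one program (a uniform algorithm) is a \<open>(t, s, \<delta>)\<close>-local computation algorithm for
  2-coloring all hypergraphs in \<open>\<H>\<close> with sufficiently many vertices, answering up to \<open>q\<close> queries. The
  bounds \<open>t\<close>, \<open>\<delta>\<close>, \<open>q\<close> depend on the number \<open>n\<close> of vertices, and \<open>s\<close> also on the number of edges. A word has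
  \<open>k\<close> times as many bits as the binary representation of \<open>n + m\<close>, for some constant \<open>k > 0\<close> of the
  algorithm; memory is counted in words. The time and memory bounds hold for every content of the random
  tape, and the error bound holds for every sequence of queries fixed independently of the tape.
\<close>

definition has_lca ::
    "(nat set \<times> nat set set) set \<Rightarrow> (nat \<Rightarrow> real) \<Rightarrow> (nat \<Rightarrow> nat \<Rightarrow> nat) \<Rightarrow> (nat \<Rightarrow> real) \<Rightarrow>
     (nat \<Rightarrow> real) \<Rightarrow> bool" where
  "has_lca \<H> t s \<delta> q \<longleftrightarrow>
    (\<exists>P k n\<^sub>0. k > 0 \<and>
      (\<forall>n E es vs.
         n \<ge> n\<^sub>0 \<longrightarrow> ({..<n}, E) \<in> \<H> \<longrightarrow> lists_edges es E \<longrightarrow>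
         set vs \<subseteq> {..<n} \<longrightarrow> real (length vs) \<le> q n \<longrightarrow>
         (let m = card E; w = k * floorlog 2 (n + m);
              run = answers n es w (s n m) (t n) P (\<lambda>_. 0)
          in (\<forall>\<omega>. \<exists>bs. run \<omega> vs bs) \<and>
             measure random_tape {\<omega>. \<exists>f. two_coloring E f \<and> run \<omega> vs (map f vs)} \<ge> 1 - \<delta> n)))"

end

theory Submission
  imports Defs "HOL-Real_Asymp.Real_Asymp"
begin

text \<open>
  The algorithm is an online version of the Moser--Tardos resampling procedure. Let \<open>L\<close> be about \<open>4 log n\<close>. To
  answer a query \<open>v\<close>, it resamples monochromatic edges of size at most \<open>L\<close> in a ball around \<open>v\<close> with
  at most \<open>n powr \<beta>\<close> vertices and radius a large multiple of \<open>log log n\<close>, until there are none, and then outputs the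
  current color of \<open>v\<close>. All queries together with a final phase that exists only in the analysis, and that
  resamples arbitrary violated edges until none is left, form a single run of the resampling procedure. The
  answer for \<open>v\<close> is wrong only if an edge at \<open>v\<close> is resampled after the query; since the ball was quiet at that
  moment, the causal history of this resampling then leads out of the ball or contains an edge larger than
  \<open>L\<close>, so it has total size at least a large multiple of \<open>log log n\<close>. The sum over all causal histories of
  total size at least \<open>s\<close> of their probabilities is at most \<open>(5/4) * (8/9) ^ s\<close>. The final coloring is proper.

  Edges larger than \<open>L\<close> are replaced by at least \<open>L\<close> of their vertices; a vertex has at most \<open>D * n\<close> of them, which
  is negligible against \<open>2 powr (- L / 2)\<close>. The color of a vertex is stored in the memory cell of one of its edges,
  at its position in this edge, so that \<open>m\<close> cells suffice.
\<close>


section \<open>Decision trees over random bits\<close>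

text \<open>The time bound holds for every tape, so nothing may be repeated until it succeeds: a
  query makes a fixed number \<open>X * X * X\<close> of attempts on the edges reached by
  \<open>X\<close> walk codes, and that this suffices is part of the probabilistic analysis. If the
  ball were still not quiet, some edge would have been resampled \<open>X\<close> times, and its
  vertices would have causal histories of size at least \<open>X\<close>. Excluding such histories
  at all vertices also bounds the length of every valid log, so that the final phase ends.

  A history records which edges were resampled, not who chose them. Sweeps, successive queries and
  the final phase therefore need no separate treatment. Its probability is computed on a table that
  lists the successive colors of each vertex, since there the edges of a history read different
  entries. The program reads one sequential tape instead; the algorithm is written as a decision
  tree because this can be run on both.

  The radius is affordable because \<open>(D' * L * L) ^ s\<close>, with \<open>L\<close> of order
  log n and \<open>s\<close> of order log log n, is the exponential of O((log log n)^2) and hence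
  below every power of n.\<close>

datatype 'x dtree = Done 'x | Ask nat "bool \<Rightarrow> 'x dtree"

lemma dtree_induct [case_names Done Ask]:
  assumes "\<And>x. P (Done x)" "\<And>u k. (\<And>b. P (k b)) \<Longrightarrow> P (Ask u k)"
  shows "P t"
  using assms by (induction t) auto

lemma nn_integral_coin:
  assumes "\<And>b. 0 \<le> f b"
  shows "(\<integral>\<^sup>+b. ennreal (f b) \<partial>measure_pmf (bernoulli_pmf (1/2))) = ennreal ((f True + f False) / 2)"
proof -
  have h: "ennreal x * inverse 2 = ennreal (x / 2)" if "0 \<le> x" for x
    using divide_ennreal[of x 2] that by (simp add: divide_ennreal_def)
  show ?thesis
    using assms by (simp add: h ennreal_plus[symmetric] add_divide_distrib del: ennreal_plus)
qed

primrec tbind :: "'x dtree \<Rightarrow> ('x \<Rightarrow> 'y dtree) \<Rightarrow> 'y dtree" where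
  "tbind (Done x) f = f x"
| "tbind (Ask u k) f = Ask u (\<lambda>b. tbind (k b) f)"

primrec run_stream :: "'x dtree \<Rightarrow> bool stream \<Rightarrow> 'x \<times> bool stream" where
  "run_stream (Done x) = (\<lambda>\<omega>. (x, \<omega>))"
| "run_stream (Ask u k) = (\<lambda>\<omega>. run_stream (k (shd \<omega>)) (stl \<omega>))"

text \<open>
  Entry \<open>(u, i)\<close> of the table is the \<open>i\<close>-th bit drawn for the label \<open>u\<close>. No entry is read twice, so that reading
  a random table and reading a random stream have the same distribution.
\<close>

primrec run_table :: "(nat \<times> nat \<Rightarrow> bool) \<Rightarrow> 'x dtree \<Rightarrow> (nat \<Rightarrow> nat) \<Rightarrow> 'x \<times> (nat \<Rightarrow> nat)" where
  "run_table r (Done x) = (\<lambda>c. (x, c))"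
| "run_table r (Ask u k) = (\<lambda>c. run_table r (k (r (u, c u))) (c(u := Suc (c u))))"

primrec labels :: "'x dtree \<Rightarrow> nat set" where
  "labels (Done x) = {}"
| "labels (Ask u k) = insert u (labels (k True) \<union> labels (k False))"

primrec depth :: "'x dtree \<Rightarrow> nat" where
  "depth (Done x) = 0"
| "depth (Ask u k) = Suc (max (depth (k True)) (depth (k False)))"

primrec tprob :: "'x dtree \<Rightarrow> ('x \<Rightarrow> bool) \<Rightarrow> real" where
  "tprob (Done x) P = of_bool (P x)"
| "tprob (Ask u k) P = (tprob (k True) P + tprob (k False) P) / 2"

lemma run_stream_tbind:
  "run_stream (tbind t f) \<omega> = (case run_stream t \<omega> of (x, \<omega>') \<Rightarrow> run_stream (f x) \<omega>')"
  by (induction t arbitrary: \<omega> rule: dtree_induct) auto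

lemma run_table_tbind:
  "run_table r (tbind t f) c = (case run_table r t c of (x, c') \<Rightarrow> run_table r (f x) c')"
  by (induction t arbitrary: c rule: dtree_induct) auto

lemma finite_labels: "finite (labels t)"
  by (induction t rule: dtree_induct) auto

lemma tprob_nonneg: "0 \<le> tprob t P"
  by (induction t rule: dtree_induct) auto

lemma tprob_stream:
  "{\<omega>. P (fst (run_stream t \<omega>))} \<in> sets random_tape \<and>
   emeasure random_tape {\<omega>. P (fst (run_stream t \<omega>))} = ennreal (tprob t P)"
proof (induction t rule: dtree_induct)
  case (Done x)
  interpret prob_space random_tape
    unfolding random_tape_def by (intro prob_space.prob_space_stream_space measure_pmf.prob_space_axioms)
  have sp: "space random_tape = UNIV"
    by (simp add: random_tape_def space_stream_space)
  have "{\<omega>. P x} = (if P x then space random_tape else {})"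
    by (auto simp: sp)
  then show ?case
    using emeasure_space_1 by auto
next
  case (Ask u k)
  let ?S = "\<lambda>b. {\<omega>. P (fst (run_stream (k b) \<omega>))}"
  let ?X = "{\<omega>. P (fst (run_stream (Ask u k) \<omega>))}"
  have sp: "space random_tape = UNIV"
    by (simp add: random_tape_def space_stream_space)
  have [measurable]: "?S b \<in> sets random_tape" for b
    using Ask[of b] by auto
  have m1: "shd \<in> measurable random_tape (count_space UNIV)" and m2: "stl \<in> measurable random_tape random_tape"
    unfolding random_tape_def using measurable_shd[of "measure_pmf (bernoulli_pmf (1/2))"]
    by (auto intro: measurable_stl)
  have "?X = (\<Union>b. (shd -` {b} \<inter> space random_tape) \<inter> (stl -` ?S b \<inter> space random_tape))"
    by (auto simp: sp)
  moreover have "(shd -` {b} \<inter> space random_tape) \<inter> (stl -` ?S b \<inter> space random_tape) \<in> sets random_tape" for b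
    by (intro sets.Int measurable_sets[OF m1] measurable_sets[OF m2]) auto
  ultimately have X: "?X \<in> sets random_tape"
    by auto
  have "emeasure random_tape ?X = (\<integral>\<^sup>+b. emeasure random_tape {\<omega>\<in>space random_tape. b ## \<omega> \<in> ?X} \<partial>measure_pmf (bernoulli_pmf (1/2)))"
    using prob_space.emeasure_stream_space[OF measure_pmf.prob_space_axioms X[unfolded random_tape_def]]
    by (simp add: random_tape_def)
  also have "\<dots> = (\<integral>\<^sup>+b. ennreal (tprob (k b) P) \<partial>measure_pmf (bernoulli_pmf (1/2)))"
    using Ask by (simp add: sp)
  also have "\<dots> = ennreal (tprob (Ask u k) P)"
    by (subst nn_integral_coin) (auto simp: tprob_nonneg)
  finally show ?case using X by blast
qed

section \<open>Tables of independent fair bits\<close>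

abbreviation coins :: "(nat \<times> nat) set \<Rightarrow> (nat \<times> nat \<Rightarrow> bool) pmf" where
  "coins A \<equiv> Pi_pmf A False (\<lambda>_. bernoulli_pmf (1/2))"

abbreviation coin_prob :: "(nat \<times> nat) set \<Rightarrow> (nat \<times> nat \<Rightarrow> bool) set \<Rightarrow> real" where
  "coin_prob A \<equiv> measure_pmf.prob (coins A)"

lemma run_table_cong:
  "(\<And>u i. c u \<le> i \<Longrightarrow> r (u, i) = r' (u, i)) \<Longrightarrow> run_table r t c = run_table r' t c"
proof (induction t arbitrary: c rule: dtree_induct)
  case (Ask u k)
  have "run_table r (k b) (c(u := Suc (c u))) = run_table r' (k b) (c(u := Suc (c u)))" for b
    by (rule Ask.IH) (use Ask.prems in \<open>auto split: if_splits\<close>)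
  then show ?case using Ask.prems by simp
qed simp

text \<open>The entry that answers the first question is never read again, because the counter of
  its label has passed it. Conditioning on it leaves a subtree and the table without this entry. A
  finite \<open>A\<close> that contains every entry which might be read is enough, and
  \<open>Pi_pmf\<close> needs a finite index set.\<close>

lemma tprob_table:
  assumes "finite A" "\<And>u i. u \<in> labels t \<Longrightarrow> c u \<le> i \<Longrightarrow> i < c u + depth t \<Longrightarrow> (u, i) \<in> A"
  shows "emeasure (coins A) {r. P (fst (run_table r t c))} = ennreal (tprob t P)"
  using assms
proof (induction t arbitrary: c A rule: dtree_induct)
  case (Done x)
  then show ?case
    by (simp add: measure_pmf.emeasure_eq_measure)
next
  case (Ask u k)
  let ?x = "(u, c u)" and ?c = "c(u := Suc (c u))"
  let ?A = "A - {?x}"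
  have xA: "?x \<in> A" using Ask.prems(2)[of u "c u"] by auto
  have "coins A = bind_pmf (bernoulli_pmf (1/2)) (\<lambda>b. map_pmf (\<lambda>f. f(?x := b)) (coins ?A))"
    using Pi_pmf_insert'[of ?A ?x False "\<lambda>_. bernoulli_pmf (1/2)"] xA Ask.prems(1)
    by (simp add: insert_absorb map_pmf_def)
  then have "emeasure (coins A) {r. P (fst (run_table r (Ask u k) c))} =
      (\<integral>\<^sup>+b. emeasure (coins ?A) {r. P (fst (run_table (r(?x := b)) (k b) ?c))} \<partial>measure_pmf (bernoulli_pmf (1/2)))"
    by (simp add: emeasure_bind_pmf vimage_def)
  also have "\<dots> = (\<integral>\<^sup>+b. emeasure (coins ?A) {r. P (fst (run_table r (k b) ?c))} \<partial>measure_pmf (bernoulli_pmf (1/2)))"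
  proof -
    have "run_table (r(?x := b)) (k b) ?c = run_table r (k b) ?c" for r b
      by (rule run_table_cong) (auto split: if_splits)
    then show ?thesis by simp
  qed
  also have "\<dots> = (\<integral>\<^sup>+b. ennreal (tprob (k b) P) \<partial>measure_pmf (bernoulli_pmf (1/2)))"
  proof -
    have "emeasure (coins ?A) {r. P (fst (run_table r (k b) ?c))} = ennreal (tprob (k b) P)" for b
    proof (rule Ask.IH)
      fix u' i
      assume *: "u' \<in> labels (k b)" "?c u' \<le> i" "i < ?c u' + depth (k b)"
      have "u' \<in> labels (Ask u k)" "depth (k b) < depth (Ask u k)"
        using * by (cases b; auto)+
      with * show "(u', i) \<in> ?A"
        using Ask.prems(2)[of u' i] by (auto split: if_splits)
    qed (use Ask.prems in auto)
    then show ?thesis by simp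
  qed
  also have "\<dots> = ennreal (tprob (Ask u k) P)"
    by (subst nn_integral_coin) (auto simp: tprob_nonneg)
  finally show ?case .
qed

lemma tprob_stream_table:
  assumes "finite A" "\<And>u i. u \<in> labels t \<Longrightarrow> i < depth t \<Longrightarrow> (u, i) \<in> A"
  shows "measure random_tape {\<omega>. P (fst (run_stream t \<omega>))} =
    coin_prob A {r. P (fst (run_table r t (\<lambda>_. 0)))}"
  using tprob_stream[of P t] tprob_table[of A t "\<lambda>_. 0" P] assms
  by (simp add: measure_def)

lemma measure_pair_pmf_times:
  "measure_pmf.prob (pair_pmf M N) (A \<times> B) = measure_pmf.prob M A * measure_pmf.prob N B"
proof -
  have "emeasure (pair_pmf M N) (A \<times> B) = (\<integral>\<^sup>+a. \<integral>\<^sup>+b. indicator A a * indicator B b \<partial>N \<partial>M)"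
    by (subst nn_integral_indicator[symmetric])
      (auto simp: nn_integral_pair_pmf' indicator_times intro!: nn_integral_cong)
  also have "\<dots> = emeasure M A * emeasure N B"
    by (simp add: nn_integral_cmult nn_integral_multc)
  finally show ?thesis
    by (simp add: measure_def enn2real_mult)
qed

lemma coins_indep:
  assumes A: "finite A" and "A1 \<subseteq> A"
    and E1: "\<And>r r'. (\<And>x. x \<in> A1 \<Longrightarrow> r x = r' x) \<Longrightarrow> E1 r = E1 r'"
    and E2: "\<And>r r'. (\<And>x. x \<in> A - A1 \<Longrightarrow> r x = r' x) \<Longrightarrow> E2 r = E2 r'"
  shows "coin_prob A {r. E1 r \<and> E2 r} =
    coin_prob A {r. E1 r} * coin_prob A {r. E2 r}"
proof -
  let ?m = "\<lambda>(f, g) x. if x \<in> A1 then f x else g x"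
  let ?P = "pair_pmf (coins A1) (coins (A - A1))"
  have fin: "finite A1" using assms finite_subset by blast
  have "A1 \<union> (A - A1) = A" using assms by auto
  then have "coins A = map_pmf ?m ?P"
    using Pi_pmf_union[OF fin, of "A - A1" False "\<lambda>_. bernoulli_pmf (1/2)"] A by auto
  moreover have "E1 (?m (f, g)) = E1 f" "E2 (?m (f, g)) = E2 g" for f g
    by (auto intro!: E1 E2)
  \<comment> \<open>Allowing the constantly true event on either side makes the two marginals
    instances of the same statement.\<close>
  ultimately have *: "coin_prob A {r. Q1 r \<and> Q2 r} =
      measure_pmf.prob (coins A1) {r. Q1 r} * measure_pmf.prob (coins (A - A1)) {r. Q2 r}"
    if "Q1 = E1 \<or> Q1 = (\<lambda>_. True)" "Q2 = E2 \<or> Q2 = (\<lambda>_. True)" for Q1 Q2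
  proof -
    have Q: "Q1 (?m (f, g)) = Q1 f" "Q2 (?m (f, g)) = Q2 g" for f g
      using that by (elim disjE; simp only: \<open>\<And>f g. E1 (?m (f, g)) = E1 f\<close> \<open>\<And>f g. E2 (?m (f, g)) = E2 g\<close>)+
    have "x \<in> ?m -` {r. Q1 r \<and> Q2 r} \<longleftrightarrow> x \<in> {r. Q1 r} \<times> {r. Q2 r}" for x
      by (cases x) (simp only: vimage_eq mem_Collect_eq Q mem_Times_iff fst_conv snd_conv)
    then have "?m -` {r. Q1 r \<and> Q2 r} = {r. Q1 r} \<times> {r. Q2 r}"
      by blast
    then have "coin_prob A {r. Q1 r \<and> Q2 r} = measure_pmf.prob ?P ({r. Q1 r} \<times> {r. Q2 r})"
      using \<open>coins A = _\<close> by (simp only: measure_map_pmf)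
    also have "\<dots> = measure_pmf.prob (coins A1) {r. Q1 r} * measure_pmf.prob (coins (A - A1)) {r. Q2 r}"
      by (subst measure_pair_pmf_times) auto
    finally show ?thesis .
  qed
  show ?thesis
    using *[of E1 E2] *[of E1 "\<lambda>_. True"] *[of "\<lambda>_. True" E2] by simp
qed

lemma coins_mono:
  assumes "finite A" "S \<subseteq> A"
  shows "coin_prob A {r. \<exists>b. \<forall>x\<in>S. r x = b} \<le> 2 * (1 / 2) ^ card S"
proof -
  have *: "coin_prob A {r. \<forall>x\<in>S. r x = b} = (1 / 2) ^ card S" for b
  proof -
    have "{r. \<forall>x\<in>S. r x = b} = Pi A (\<lambda>x. if x \<in> S then {b} else UNIV)"
      using assms by (auto simp: Pi_def)
    then have "coin_prob A {r. \<forall>x\<in>S. r x = b} =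
        (\<Prod>x\<in>A. measure_pmf.prob (bernoulli_pmf (1/2)) (if x \<in> S then {b} else UNIV))"
      using assms by (simp only: measure_Pi_pmf_Pi)
    also have "\<dots> = (\<Prod>x\<in>A. if x \<in> S then 1 / 2 else 1)"
      by (rule prod.cong) (cases b; simp add: measure_pmf_single)+
    also have "\<dots> = (1 / 2) ^ card {x\<in>A. x \<in> S}"
      using assms by (simp flip: prod.inter_filter)
    also have "{x\<in>A. x \<in> S} = S" using assms by auto
    finally show ?thesis .
  qed
  have "{r. \<exists>b. \<forall>x\<in>S. r x = b} = {r. \<forall>x\<in>S. r x = True} \<union> {r. \<forall>x\<in>S. r x = False}"
    by auto
  then show ?thesis
    using measure_Un_le[of "{r. \<forall>x\<in>S. r x = True}" "coins A" "{r. \<forall>x\<in>S. r x = False}"]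
    by (simp add: *[of True, simplified] *[of False, simplified])
qed


section \<open>Logs of resampled edges\<close>

definition mono_at :: "(nat \<times> nat \<Rightarrow> bool) \<Rightarrow> (nat \<Rightarrow> nat) \<Rightarrow> nat set \<Rightarrow> bool" where
  "mono_at r q S \<longleftrightarrow> (\<exists>b. \<forall>u\<in>S. r (u, q u) = b)"

lemma mono_at_cong: "(\<And>u. u \<in> S \<Longrightarrow> q u = q' u) \<Longrightarrow> mono_at r q S = mono_at r q' S"
  by (simp add: mono_at_def)

locale moser_tardos =
  fixes J :: "nat set" and T :: "nat \<Rightarrow> nat set"
  assumes finite_J: "finite J"
    and finite_T: "j \<in> J \<Longrightarrow> finite (T j)"
    and T_nonempty: "j \<in> J \<Longrightarrow> T j \<noteq> {}"
begin

text \<open>Each resampling of an edge at \<open>u\<close> discards one bit of \<open>u\<close>, so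
  this is also the table index of the current color of \<open>u\<close>.\<close>

definition hits :: "nat list \<Rightarrow> nat \<Rightarrow> nat" where
  "hits l u = length (filter (\<lambda>j. u \<in> T j) l)"

text \<open>Only the violation of each edge at its moment is required, not a rule for choosing it.
  The program and the final phase are both covered.\<close>

definition valid :: "(nat \<times> nat \<Rightarrow> bool) \<Rightarrow> nat list \<Rightarrow> bool" where
  "valid r l \<longleftrightarrow> (\<forall>k<length l. mono_at r (hits (take k l)) (T (l ! k)))"

text \<open>
  The causal history of a resampling, built by going backwards through the log, is a list of levels: an edge
  that meets a level is put just below the deepest level that it meets. Hence the edges of a level are disjoint,
  each of them meets the level above, and the bit of \<open>u\<close> inspected by an edge is numbered by the deeper levels
  that contain \<open>u\<close>.
\<close>

definition cover :: "nat set \<Rightarrow> nat set" where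
  "cover W = \<Union> (T ` W)"

definition covers :: "nat set list \<Rightarrow> nat set" where
  "covers Ws = \<Union> (cover ` set Ws)"

fun insert_edge :: "nat \<Rightarrow> nat set list \<Rightarrow> nat set list" where
  "insert_edge f [] = []"
| "insert_edge f (W # Ws) =
     (if T f \<inter> covers Ws \<noteq> {} then W # insert_edge f Ws
      else if T f \<inter> cover W \<noteq> {} then W # (case Ws of [] \<Rightarrow> [{f}] | V # Vs \<Rightarrow> insert f V # Vs)
      else W # Ws)"

definition admissible :: "nat set \<Rightarrow> nat set set" where
  "admissible U = {W. W \<subseteq> J \<and> disjoint_family_on T W \<and> (\<forall>f\<in>W. T f \<inter> U \<noteq> {})}"

fun compat :: "nat set \<Rightarrow> nat set list \<Rightarrow> bool" where
  "compat U [] = True"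
| "compat U (W # Ws) = (W \<in> admissible U \<and> W \<noteq> {} \<and> compat (cover W) Ws)"

definition level_count :: "nat \<Rightarrow> nat set list \<Rightarrow> nat" where
  "level_count u Ws = length (filter (\<lambda>W. u \<in> cover W) Ws)"

fun occurs :: "(nat \<times> nat \<Rightarrow> bool) \<Rightarrow> (nat \<Rightarrow> nat) \<Rightarrow> nat set list \<Rightarrow> bool" where
  "occurs r q [] = True"
| "occurs r q (W # Ws) = ((\<forall>f\<in>W. mono_at r (\<lambda>u. q u + level_count u Ws) (T f)) \<and> occurs r q Ws)"

definition total :: "nat set list \<Rightarrow> nat" where
  "total Ws = (\<Sum>W\<leftarrow>Ws. \<Sum>f\<in>W. card (T f))"

lemma hits_simps [simp]: "hits [] u = 0" "hits (l @ l') u = hits l u + hits l' u"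
  "hits (f # l) u = of_bool (u \<in> T f) + hits l u"
  by (auto simp: hits_def)

lemma level_count_simps [simp]: "level_count u [] = 0" "level_count u (W # Ws) = of_bool (u \<in> cover W) + level_count u Ws"
  by (auto simp: level_count_def)

lemma covers_simps [simp]: "covers [] = {}" "covers (W # Ws) = cover W \<union> covers Ws"
  by (auto simp: covers_def)

lemma cover_simps [simp]: "cover {} = {}" "cover (insert f W) = T f \<union> cover W"
  by (auto simp: cover_def)

lemma total_simps [simp]: "total [] = 0" "total (W # Ws) = (\<Sum>f\<in>W. card (T f)) + total Ws"
  by (auto simp: total_def)

lemma valid_Nil [simp]: "valid r []"
  by (simp add: valid_def)

lemma valid_snoc [simp]: "valid r (l @ [f]) \<longleftrightarrow> valid r l \<and> mono_at r (hits l) (T f)"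
  by (auto simp: valid_def nth_append less_Suc_eq)

lemma valid_take: "valid r l \<Longrightarrow> valid r (take k l)"
  by (auto simp: valid_def min_def)

lemma level_count_eq_0: "u \<notin> covers Ws \<Longrightarrow> level_count u Ws = 0"
  by (induction Ws) auto

lemma occurs_cong: "(\<And>u. u \<in> covers Ws \<Longrightarrow> q u = q' u) \<Longrightarrow> occurs r q Ws = occurs r q' Ws"
proof (induction Ws)
  case (Cons W Ws)
  have "mono_at r (\<lambda>u. q u + level_count u Ws) (T f) = mono_at r (\<lambda>u. q' u + level_count u Ws) (T f)" if "f \<in> W" for f
    by (rule mono_at_cong) (use Cons.prems that in \<open>auto simp: cover_def\<close>)
  with Cons show ?case by auto
qed simp

lemma compat_mono: "compat U Ws \<Longrightarrow> U \<subseteq> U' \<Longrightarrow> compat U' Ws"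
  by (cases Ws) (auto simp: admissible_def, blast)

lemma insert_edge_id: "T f \<inter> covers Ws = {} \<Longrightarrow> insert_edge f Ws = Ws"
  by (cases Ws) auto

lemma covers_insert_edge: "T f \<inter> covers Ws \<noteq> {} \<Longrightarrow> covers (insert_edge f Ws) = T f \<union> covers Ws"
  by (induction Ws) (auto split: list.splits)

lemma compat_insert_edge: "f \<in> J \<Longrightarrow> compat U Ws \<Longrightarrow> compat U (insert_edge f Ws)"
proof (induction Ws arbitrary: U)
  case (Cons W Ws)
  show ?case
  proof (cases "T f \<inter> covers Ws \<noteq> {} \<or> T f \<inter> cover W = {} \<or> Ws = []")
    case True
    with Cons show ?thesis by (auto simp: admissible_def disjoint_family_on_def)
  next
    case False
    then obtain V Vs where V: "Ws = V # Vs" by (cases Ws) auto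
    have "insert f V \<in> admissible (cover W)"
      using Cons.prems False V by (auto simp: admissible_def disjoint_family_on_def cover_def)
    moreover have "compat (cover (insert f V)) Vs"
      using Cons.prems V compat_mono by (metis Un_upper2 compat.simps(2) cover_simps(2))
    ultimately show ?thesis
      using Cons.prems False V by auto
  qed
qed simp

lemma level_count_insert_edge: "T f \<inter> covers Ws \<noteq> {} \<Longrightarrow> level_count u (insert_edge f Ws) = level_count u Ws + of_bool (u \<in> T f)"
proof (induction Ws)
  case (Cons W Ws)
  then show ?case by (cases Ws) auto
qed simp

text \<open>A resampling of \<open>f\<close> before everything in \<open>Ws\<close> raises by one
  the index of every later bit of a vertex of \<open>f\<close>. The level that receives
  \<open>f\<close> lies below all levels that meet \<open>f\<close>, so \<open>level_count\<close>
  rises there by exactly this one. The levels from there on are disjoint from \<open>f\<close>, and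
  the shift does not concern them.\<close>

lemma occurs_insert_edge:
  "T f \<inter> covers Ws \<noteq> {} \<Longrightarrow> mono_at r q (T f) \<Longrightarrow> occurs r (\<lambda>u. q u + of_bool (u \<in> T f)) Ws \<Longrightarrow>
   occurs r q (insert_edge f Ws)"
proof (induction Ws)
  case (Cons W Ws)
  have W: "mono_at r (\<lambda>u. q u + of_bool (u \<in> T f) + level_count u Ws) (T g)" if "g \<in> W" for g
    using Cons.prems that by auto
  have shift: "(\<lambda>u. q u + of_bool (u \<in> T f) + level_count u Ws) = (\<lambda>u. q u + (level_count u Ws + of_bool (u \<in> T f)))"
    by auto
  show ?case
  proof (cases "T f \<inter> covers Ws \<noteq> {}")
    case True
    with Cons W show ?thesis by (auto simp: level_count_insert_edge shift)
  next
    case False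
    then have f: "T f \<inter> cover W \<noteq> {}" using Cons.prems by auto
    show ?thesis
    proof (cases Ws)
      case Nil
      with f Cons.prems W show ?thesis by auto
    next
      case (Cons V Vs)
      have d: "level_count u (insert f V # Vs) = level_count u Ws + of_bool (u \<in> T f)" for u
        using False Cons by auto
      have "mono_at r (\<lambda>u. q u + level_count u Vs) (T f)"
        using \<open>mono_at r q (T f)\<close> False Cons by (subst mono_at_cong[of _ _ q]) (auto simp: level_count_eq_0)
      moreover have "mono_at r (\<lambda>u. q u + level_count u Vs) (T g)" if "g \<in> V" for g
      proof -
        have "mono_at r (\<lambda>u. q u + of_bool (u \<in> T f) + level_count u Vs) (T g)"
          using Cons.prems Cons that by auto
        moreover have "T f \<inter> T g = {}" using False Cons that by (auto simp: cover_def)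
        ultimately show ?thesis by (subst mono_at_cong) auto
      qed
      moreover have "occurs r q Vs"
      proof -
        have "occurs r (\<lambda>u. q u + of_bool (u \<in> T f)) Vs" using Cons.prems Cons by auto
        then show ?thesis using False Cons by (subst occurs_cong) auto
      qed
      ultimately have "occurs r q (insert f V # Vs)" by auto
      moreover have "\<forall>g\<in>W. mono_at r (\<lambda>u. q u + level_count u (insert f V # Vs)) (T g)"
        unfolding d using W shift by auto
      ultimately have "occurs r q (W # insert f V # Vs)" by simp
      then show ?thesis using False f Cons by simp
    qed
  qed
qed simp

text \<open>\<open>foldr\<close> starts at the end of the log, so time runs backwards. The offset
  \<open>hits l\<close> counts the resamplings that are still to be inserted; it vanishes when the
  log is used up.\<close>

lemma occurs_foldr_insert_edge:
  "valid r l \<Longrightarrow> occurs r (hits l) Ws \<Longrightarrow> occurs r (\<lambda>_. 0) (foldr insert_edge l Ws)"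
proof (induction l arbitrary: Ws rule: rev_induct)
  case Nil
  have "hits [] = (\<lambda>_. 0)" by auto
  with Nil show ?case by simp
next
  case (snoc f l)
  have "occurs r (hits l) (insert_edge f Ws)"
  proof (cases "T f \<inter> covers Ws = {}")
    case True
    then have "occurs r (hits (l @ [f])) Ws = occurs r (hits l) Ws"
      by (intro occurs_cong) auto
    with snoc.prems(2) True show ?thesis by (simp add: insert_edge_id del: hits_simps)
  next
    case False
    have "(\<lambda>u. hits l u + of_bool (u \<in> T f)) = hits (l @ [f])" by auto
    with False snoc.prems show ?thesis by (intro occurs_insert_edge) simp_all
  qed
  with snoc show ?case by simp
qed

lemma compat_foldr_insert_edge: "set l \<subseteq> J \<Longrightarrow> compat U Ws \<Longrightarrow> compat U (foldr insert_edge l Ws)"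
  by (induction l) (auto intro: compat_insert_edge)

lemma length_insert_edge: "length (insert_edge f Ws) \<le> Suc (length Ws)"
  by (induction Ws) (auto split: list.splits)

lemma length_foldr_insert_edge: "length (foldr insert_edge l Ws) \<le> length l + length Ws"
  by (induction l) (auto intro: order_trans[OF length_insert_edge])

lemma finite_admissible_mem: "W \<in> admissible U \<Longrightarrow> finite W"
  using finite_J finite_subset by (auto simp: admissible_def)

lemma total_insert_edge:
  assumes "f \<in> J" "compat U Ws" "T f \<inter> covers Ws \<noteq> {}"
  shows "total (insert_edge f Ws) = total Ws + card (T f)"
  using assms(2,3)
proof (induction Ws arbitrary: U)
  case (Cons W Ws)
  show ?case
  proof (cases "T f \<inter> covers Ws \<noteq> {} \<or> Ws = []")
    case True
    with Cons show ?thesis by auto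
  next
    case False
    then obtain V Vs where V: "Ws = V # Vs" by (cases Ws) auto
    \<comment> \<open>The nonempty \<open>T f\<close> misses the cover of \<open>V\<close>. Hence
      \<open>f\<close> is new in this level and its full size is added.\<close>
    have "f \<notin> V" using False V T_nonempty[OF assms(1)] by (auto simp: cover_def)
    moreover have "finite V" using Cons.prems V finite_admissible_mem by auto
    ultimately show ?thesis using False V Cons.prems by auto
  qed
qed simp

lemma covers_foldr_insert_edge: "covers Ws \<subseteq> covers (foldr insert_edge l Ws)"
proof (induction l)
  case (Cons f l)
  then show ?case
    by (cases "T f \<inter> covers (foldr insert_edge l Ws) = {}") (auto simp: insert_edge_id covers_insert_edge)
qed simp

lemma total_foldr_insert_edge:
  assumes "set l \<subseteq> J" "compat U Ws"
  shows "total Ws \<le> total (foldr insert_edge l Ws)"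
  using assms(1)
proof (induction l)
  case (Cons f l)
  then show ?case
    using total_insert_edge[of f U "foldr insert_edge l Ws"] compat_foldr_insert_edge[of l U Ws] assms(2)
    by (cases "T f \<inter> covers (foldr insert_edge l Ws) = {}") (auto simp: insert_edge_id)
qed simp

text \<open>Since \<open>u\<close> stays covered, every earlier edge at \<open>u\<close> is inserted
  and adds at least one. A vertex that is resampled often thus has a heavy history, which later
  bounds the number of resamplings.\<close>

lemma total_foldr_insert_edge_hits:
  assumes "set l \<subseteq> J" "compat U Ws" "u \<in> covers Ws"
  shows "total Ws + hits l u \<le> total (foldr insert_edge l Ws)"
  using assms(1)
proof (induction l)
  case (Cons f l)
  show ?case
  proof (cases "T f \<inter> covers (foldr insert_edge l Ws) = {}")
    case True
    then have "u \<notin> T f" using covers_foldr_insert_edge assms(3) by blast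
    with Cons True show ?thesis by (auto simp: insert_edge_id)
  next
    case False
    then have "total (insert_edge f (foldr insert_edge l Ws)) = total (foldr insert_edge l Ws) + card (T f)"
      using total_insert_edge compat_foldr_insert_edge Cons.prems assms(2) by (meson list.set_intros(1) set_subset_Cons subset_iff subset_trans)
    moreover have "card (T f) \<ge> 1"
      using Cons.prems finite_T T_nonempty by (simp add: Suc_le_eq card_gt_0_iff)
    ultimately show ?thesis using Cons by auto
  qed
qed simp

text \<open>The event that a valid log resamples an edge at \<open>v\<close> after a causal history of total size at least \<open>s\<close>.\<close>

definition bad :: "(nat \<times> nat \<Rightarrow> bool) \<Rightarrow> nat \<Rightarrow> nat \<Rightarrow> nat \<Rightarrow> bool" where
  "bad r h s v \<longleftrightarrow> (\<exists>Ws. length Ws \<le> h \<and> compat {v} Ws \<and> s \<le> total Ws \<and> occurs r (\<lambda>_. 0) Ws)"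

lemma compat_singleton: "j \<in> J \<Longrightarrow> v \<in> T j \<Longrightarrow> compat {v} [{j}]"
  by (auto simp: admissible_def disjoint_family_on_def)

text \<open>This is the only bridge from logs to histories. The bound \<open>h\<close> on the number
  of levels keeps both the union over histories and the table finite; on the good event all logs are
  shorter.\<close>

lemma badI:
  assumes "valid r (l @ [j])" "set l \<subseteq> J" "j \<in> J" "v \<in> T j" "length l < h"
    and "s \<le> total (foldr insert_edge l [{j}])"
  shows "bad r h s v"
proof -
  have "occurs r (hits l) [{j}]"
    using assms(1) by simp
  then have "occurs r (\<lambda>_. 0) (foldr insert_edge l [{j}])"
    using assms(1) by (intro occurs_foldr_insert_edge) auto
  moreover have "compat {v} (foldr insert_edge l [{j}])"
    using assms by (intro compat_foldr_insert_edge compat_singleton)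
  moreover have "length (foldr insert_edge l [{j}]) \<le> h"
    using length_foldr_insert_edge[of l "[{j}]"] assms(5) by simp
  ultimately show ?thesis
    using assms(6) unfolding bad_def by blast
qed

section \<open>Total weight of all histories\<close>

lemma finite_admissible: "finite (admissible U)"
  by (rule finite_subset[of _ "Pow J"]) (auto simp: admissible_def finite_J)

text \<open>The edges of \<open>W\<close> are disjoint, so at most one of them contains
  \<open>u\<close>. Without it the rest is admissible for the remaining vertices. Each vertex
  therefore contributes the factor \<open>1 + y\<close>: no edge, or one edge of total weight at
  most \<open>y\<close>.\<close>

lemma sum_admissible:
  fixes a :: "nat \<Rightarrow> real"
  assumes "finite U" and a: "\<And>f. 0 \<le> a f" and y: "\<And>u. (\<Sum>f\<in>{f\<in>J. u \<in> T f}. a f) \<le> y"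
  shows "(\<Sum>W\<in>admissible U. \<Prod>f\<in>W. a f) \<le> (1 + y) ^ card U"
  using assms(1)
proof (induction U)
  case empty
  have "admissible {} = {{}}" by (auto simp: admissible_def disjoint_family_on_def)
  then show ?case by simp
next
  case (insert u U)
  let ?F = "{f\<in>J. u \<in> T f}"
  let ?I = "insert None (Some ` ?F) \<times> admissible U"
  let ?g = "\<lambda>(x, W). (case x of None \<Rightarrow> 1 | Some f \<Rightarrow> a f) * (\<Prod>f\<in>W. a f)"
  let ?i = "\<lambda>(x, W). case x of None \<Rightarrow> W | Some f \<Rightarrow> insert f W"
  have finF: "finite ?F" using finite_J by auto
  have y0: "0 \<le> y" using order_trans[OF sum_nonneg y] a by blast
  have "(\<Sum>W\<in>admissible (insert u U). \<Prod>f\<in>W. a f) \<le> sum ?g ?I"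
  proof (rule sum_le_included[where i = ?i])
    show "\<forall>W\<in>admissible (insert u U). \<exists>z\<in>?I. ?i z = W \<and> (\<Prod>f\<in>W. a f) \<le> ?g z"
    proof
      fix W assume W: "W \<in> admissible (insert u U)"
      show "\<exists>z\<in>?I. ?i z = W \<and> (\<Prod>f\<in>W. a f) \<le> ?g z"
      proof (cases "\<exists>f\<in>W. u \<in> T f")
        case False
        then have "W \<in> admissible U" using W by (auto simp: admissible_def)
        then show ?thesis by (intro bexI[of _ "(None, W)"]) auto
      next
        case True
        then obtain f where f: "f \<in> W" "u \<in> T f" by auto
        have "u \<notin> T g" if "g \<in> W - {f}" for g
          using W f that disjoint_family_onD[of T W f g] by (auto simp: admissible_def)
        then have "W - {f} \<in> admissible U"
          using W disjoint_family_on_mono[of "W - {f}" W T] by (auto simp: admissible_def)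
        moreover have "f \<in> ?F" using W f by (auto simp: admissible_def)
        moreover have "finite W" using W finite_J by (auto simp: admissible_def intro: finite_subset)
        ultimately show ?thesis
          using f by (intro bexI[of _ "(Some f, W - {f})"]) (auto simp: prod.remove)
      qed
    qed
  qed (use finF a finite_admissible in \<open>auto intro!: mult_nonneg_nonneg prod_nonneg split: option.splits\<close>)
  also have "\<dots> = (\<Sum>x\<in>insert None (Some ` ?F). (case x of None \<Rightarrow> 1 | Some f \<Rightarrow> a f)) * (\<Sum>W\<in>admissible U. \<Prod>f\<in>W. a f)"
    by (simp add: sum_product sum.cartesian_product case_prod_unfold)
  also have "(\<Sum>x\<in>insert None (Some ` ?F). (case x of None \<Rightarrow> 1 | Some f \<Rightarrow> a f)) = 1 + (\<Sum>f\<in>?F. a f)"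
    using finF by (subst sum.insert) (auto simp: sum.reindex)
  also have "(1 + (\<Sum>f\<in>?F. a f)) * (\<Sum>W\<in>admissible U. \<Prod>f\<in>W. a f) \<le> (1 + y) * (1 + y) ^ card U"
    using y[of u] y0 insert.IH a by (intro mult_mono) (auto intro!: sum_nonneg prod_nonneg)
  finally show ?case using insert by simp
qed

definition level_weight :: "(nat \<Rightarrow> real) \<Rightarrow> nat set list \<Rightarrow> real" where
  "level_weight a Ws = (\<Prod>W\<leftarrow>Ws. \<Prod>f\<in>W. a f)"

lemma level_weight_simps [simp]: "level_weight a [] = 1" "level_weight a (W # Ws) = (\<Prod>f\<in>W. a f) * level_weight a Ws"
  by (auto simp: level_weight_def)

lemma level_weight_nonneg: "(\<And>f. 0 \<le> a f) \<Longrightarrow> 0 \<le> level_weight a Ws"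
  by (induction Ws) (auto intro!: mult_nonneg_nonneg prod_nonneg)

definition level_lists :: "nat \<Rightarrow> nat set \<Rightarrow> nat set list set" where
  "level_lists h U = {Ws. length Ws \<le> h \<and> compat U Ws}"

lemma finite_level_lists: "finite (level_lists h U)"
proof (rule finite_subset)
  have "compat U Ws \<Longrightarrow> set Ws \<subseteq> Pow J" for Ws
    by (induction Ws arbitrary: U) (auto simp: admissible_def)
  then show "level_lists h U \<subseteq> {Ws. set Ws \<subseteq> Pow J \<and> length Ws \<le> h}"
    by (auto simp: level_lists_def)
  show "finite {Ws. set Ws \<subseteq> Pow J \<and> length Ws \<le> h}"
    by (intro finite_lists_length_le) (use finite_J in auto)
qed

lemma finite_cover: "W \<subseteq> J \<Longrightarrow> finite (cover W)"
  using finite_subset[OF _ finite_J] finite_T by (auto simp: cover_def)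

text \<open>A history splits into its top level \<open>W\<close> and a history below
  \<open>cover W\<close>. As \<open>W\<close> is disjoint, the inductive bound for the latter is a
  product over \<open>f\<close> in \<open>W\<close> of \<open>K ^ card (T f)\<close> and can be
  absorbed into the weights. The hypothesis says that \<open>K\<close> is a supersolution of the
  resulting recursion, as for a branching process; the bound does not depend on
  \<open>h\<close>.\<close>

lemma sum_level_lists:
  fixes a :: "nat \<Rightarrow> real"
  assumes a: "\<And>f. 0 \<le> a f" and K: "1 \<le> K"
    and y: "\<And>u. (\<Sum>f\<in>{f\<in>J. u \<in> T f}. a f * K ^ card (T f)) \<le> K - 1"
    and "finite U"
  shows "(\<Sum>Ws\<in>level_lists h U. level_weight a Ws) \<le> K ^ card U"
  using assms(4)
proof (induction h arbitrary: U)
  case 0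
  have "level_lists 0 U = {[]}" by (auto simp: level_lists_def)
  then show ?case using K by simp
next
  case (Suc h)
  let ?I = "SIGMA W:admissible U. level_lists h (cover W)"
  \<comment> \<open>The empty set is admissible and stands for the end of the list.\<close>
  let ?i = "\<lambda>(W, Ws). if W = {} then [] else W # Ws"
  have "(\<Sum>Ws\<in>level_lists (Suc h) U. level_weight a Ws) \<le> (\<Sum>(W, Ws)\<in>?I. (\<Prod>f\<in>W. a f) * level_weight a Ws)"
  proof (rule sum_le_included[where i = ?i])
    show "\<forall>Ws\<in>level_lists (Suc h) U. \<exists>z\<in>?I. ?i z = Ws \<and> level_weight a Ws \<le> (case z of (W, Ws) \<Rightarrow> (\<Prod>f\<in>W. a f) * level_weight a Ws)"
    proof
      fix Ws assume Ws: "Ws \<in> level_lists (Suc h) U"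
      show "\<exists>z\<in>?I. ?i z = Ws \<and> level_weight a Ws \<le> (case z of (W, Ws) \<Rightarrow> (\<Prod>f\<in>W. a f) * level_weight a Ws)"
      proof (cases Ws)
        case Nil
        then show ?thesis
          by (intro bexI[of _ "({}, [])"]) (auto simp: level_lists_def admissible_def disjoint_family_on_def)
      next
        case (Cons V Vs)
        with Ws show ?thesis
          by (intro bexI[of _ "(V, Vs)"]) (auto simp: level_lists_def)
      qed
    qed
  qed (use a finite_admissible in \<open>auto intro!: finite_SigmaI finite_level_lists mult_nonneg_nonneg prod_nonneg level_weight_nonneg\<close>)
  also have "\<dots> = (\<Sum>W\<in>admissible U. (\<Prod>f\<in>W. a f) * (\<Sum>Ws\<in>level_lists h (cover W). level_weight a Ws))"
    by (simp add: sum.Sigma[symmetric] finite_admissible finite_level_lists sum_distrib_left)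
  also have "\<dots> \<le> (\<Sum>W\<in>admissible U. \<Prod>f\<in>W. a f * K ^ card (T f))"
  proof (rule sum_mono)
    fix W assume W: "W \<in> admissible U"
    then have WJ: "W \<subseteq> J" and finW: "finite W"
      using finite_J by (auto simp: admissible_def intro: finite_subset)
    have "card (cover W) = (\<Sum>f\<in>W. card (T f))"
      unfolding cover_def using W WJ finW finite_T
      by (intro card_UN_disjoint) (auto simp: admissible_def disjoint_family_on_def)
    then have "(\<Sum>Ws\<in>level_lists h (cover W). level_weight a Ws) \<le> (\<Prod>f\<in>W. K ^ card (T f))"
      using Suc.IH[OF finite_cover[OF WJ]] by (simp add: power_sum)
    then have "(\<Prod>f\<in>W. a f) * (\<Sum>Ws\<in>level_lists h (cover W). level_weight a Ws) \<le> (\<Prod>f\<in>W. a f) * (\<Prod>f\<in>W. K ^ card (T f))"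
      using a by (intro mult_left_mono prod_nonneg) auto
    then show "(\<Prod>f\<in>W. a f) * (\<Sum>Ws\<in>level_lists h (cover W). level_weight a Ws) \<le> (\<Prod>f\<in>W. a f * K ^ card (T f))"
      by (simp add: prod.distrib)
  qed
  also have "\<dots> \<le> (1 + (K - 1)) ^ card U"
    using a K y Suc.prems by (intro sum_admissible) auto
  finally show ?case by simp
qed

section \<open>Probability of a history\<close>

lemma occurs_depends:
  "(\<And>u i. u \<in> covers Ws \<Longrightarrow> i < level_count u Ws \<Longrightarrow> r (u, i) = r' (u, i)) \<Longrightarrow> occurs r (\<lambda>_. 0) Ws = occurs r' (\<lambda>_. 0) Ws"
proof (induction Ws)
  case (Cons W Ws)
  have "mono_at r (\<lambda>u. level_count u Ws) (T f) = mono_at r' (\<lambda>u. level_count u Ws) (T f)" if "f \<in> W" for f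
  proof -
    have "r (u, level_count u Ws) = r' (u, level_count u Ws)" if "u \<in> T f" for u
      by (rule Cons.prems) (use that \<open>f \<in> W\<close> in \<open>auto simp: cover_def\<close>)
    then show ?thesis by (simp add: mono_at_def)
  qed
  moreover have "occurs r (\<lambda>_. 0) Ws = occurs r' (\<lambda>_. 0) Ws"
    by (rule Cons.IH, rule Cons.prems) auto
  ultimately show ?case by auto
qed simp

lemma level_count_le: "level_count u Ws \<le> length Ws"
  by (simp add: level_count_def)

lemma prob_level:
  assumes "finite A" "finite W" "W \<subseteq> J" "disjoint_family_on T W" "\<And>u. u \<in> cover W \<Longrightarrow> (u, q u) \<in> A"
  shows "coin_prob A {r. \<forall>f\<in>W. mono_at r q (T f)} \<le> (\<Prod>f\<in>W. 2 * (1/2) ^ card (T f))"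
  using assms(2-)
proof (induction W)
  case (insert f W)
  let ?S = "(\<lambda>u. (u, q u)) ` T f"
  have S: "?S \<subseteq> A" using insert.prems by auto
  have "coin_prob A {r. \<forall>f\<in>insert f W. mono_at r q (T f)} =
      coin_prob A {r. (\<exists>b. \<forall>x\<in>?S. r x = b) \<and> (\<forall>f\<in>W. mono_at r q (T f))}"
    by (simp add: mono_at_def)
  also have "\<dots> = coin_prob A {r. \<exists>b. \<forall>x\<in>?S. r x = b} *
      coin_prob A {r. \<forall>f\<in>W. mono_at r q (T f)}"
  proof (rule coins_indep[OF assms(1) S])
    fix r r' :: "nat \<times> nat \<Rightarrow> bool"
    assume *: "\<And>x. x \<in> A - ?S \<Longrightarrow> r x = r' x"
    have "mono_at r q (T g) = mono_at r' q (T g)" if "g \<in> W" for g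
    proof -
      have "T f \<inter> T g = {}" using insert that by (auto simp: disjoint_family_on_def)
      then have "r (u, q u) = r' (u, q u)" if "u \<in> T g" for u
        using that \<open>g \<in> W\<close> insert.prems(3)[of u] by (intro *) (auto simp: cover_def)
      then show ?thesis by (simp add: mono_at_def)
    qed
    then show "(\<forall>f\<in>W. mono_at r q (T f)) = (\<forall>f\<in>W. mono_at r' q (T f))" by auto
  qed simp
  also have "\<dots> \<le> (2 * (1/2) ^ card ?S) * (\<Prod>f\<in>W. 2 * (1/2) ^ card (T f))"
    using insert S assms(1)
    by (intro mult_mono coins_mono insert.IH) (auto simp: disjoint_family_on_def)
  also have "card ?S = card (T f)"
    by (intro card_image) (auto simp: inj_on_def)
  finally show ?case using insert by simp
qed simp

lemma compat_covers: "compat U Ws \<Longrightarrow> covers Ws \<subseteq> \<Union> (T ` J)"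
  by (induction Ws arbitrary: U) (auto simp: cover_def admissible_def)

text \<open>For a vertex \<open>u\<close> of the top level the entry with index
  \<open>level_count u Ws\<close> is read there, whereas the deeper levels read only smaller
  indices. The two parts read disjoint sets of entries and are independent.\<close>

lemma prob_occurs:
  assumes "finite A" "\<Union> (T ` J) \<times> {..<h} \<subseteq> A" "compat U Ws" "length Ws \<le> h"
  shows "coin_prob A {r. occurs r (\<lambda>_. 0) Ws} \<le> level_weight (\<lambda>f. 2 * (1/2) ^ card (T f)) Ws"
  using assms(3-)
proof (induction Ws arbitrary: U)
  case (Cons W Ws)
  let ?S = "(\<lambda>u. (u, level_count u Ws)) ` cover W"
  have W: "W \<subseteq> J" "finite W" "disjoint_family_on T W"
    using Cons.prems finite_J by (auto simp: admissible_def intro: finite_subset)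
  have S: "(u, level_count u Ws) \<in> A" if "u \<in> cover W" for u
    using that W(1) assms(2) Cons.prems le_less_trans[OF level_count_le[of u Ws], of h] by (auto simp: cover_def)
  have "coin_prob A {r. occurs r (\<lambda>_. 0) (W # Ws)} =
      coin_prob A {r. (\<forall>f\<in>W. mono_at r (\<lambda>u. level_count u Ws) (T f)) \<and> occurs r (\<lambda>_. 0) Ws}"
    by simp
  also have "\<dots> = coin_prob A {r. \<forall>f\<in>W. mono_at r (\<lambda>u. level_count u Ws) (T f)} *
      coin_prob A {r. occurs r (\<lambda>_. 0) Ws}"
  proof (rule coins_indep[OF assms(1), of ?S])
    show "?S \<subseteq> A" using S by auto
  next
    fix r r' :: "nat \<times> nat \<Rightarrow> bool"
    assume *: "\<And>x. x \<in> ?S \<Longrightarrow> r x = r' x"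
    have "mono_at r (\<lambda>u. level_count u Ws) (T g) = mono_at r' (\<lambda>u. level_count u Ws) (T g)" if "g \<in> W" for g
    proof -
      have "r (u, level_count u Ws) = r' (u, level_count u Ws)" if "u \<in> T g" for u
        by (rule *) (use that \<open>g \<in> W\<close> in \<open>auto simp: cover_def\<close>)
      then show ?thesis by (simp add: mono_at_def)
    qed
    then show "(\<forall>f\<in>W. mono_at r (\<lambda>u. level_count u Ws) (T f)) = (\<forall>f\<in>W. mono_at r' (\<lambda>u. level_count u Ws) (T f))" by auto
  next
    fix r r' :: "nat \<times> nat \<Rightarrow> bool"
    assume *: "\<And>x. x \<in> A - ?S \<Longrightarrow> r x = r' x"
    show "occurs r (\<lambda>_. 0) Ws = occurs r' (\<lambda>_. 0) Ws"
    proof (rule occurs_depends)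
      fix u i assume u: "u \<in> covers Ws" "i < level_count u Ws"
      have "u \<in> \<Union> (T ` J)" using u(1) compat_covers[of "cover W" Ws] Cons.prems by auto
      moreover have "i < h" using u(2) level_count_le[of u Ws] Cons.prems by simp
      ultimately have "(u, i) \<in> A" using assms(2) by auto
      then show "r (u, i) = r' (u, i)" using u(2) by (intro *) auto
    qed
  qed
  also have "\<dots> \<le> (\<Prod>f\<in>W. 2 * (1/2) ^ card (T f)) * level_weight (\<lambda>f. 2 * (1/2) ^ card (T f)) Ws"
    using Cons W S assms(1) by (intro mult_mono prob_level Cons.IH) (auto intro!: prod_nonneg)
  finally show ?case by simp
qed simp

lemma level_weight_power: "compat U Ws \<Longrightarrow> level_weight (\<lambda>f. a f * g ^ card (T f)) Ws = level_weight a Ws * g ^ total Ws"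
  by (induction Ws arbitrary: U) (auto simp: prod.distrib power_add power_sum algebra_simps)

text \<open>An exponential Markov inequality: in the union bound each history of total size at least
  \<open>s\<close> is given the additional factor \<open>g ^ (total Ws - s)\<close>, which is at
  least 1. What remains is the weighted sum over all histories below one vertex, divided by
  \<open>g ^ s\<close>.\<close>

lemma prob_bad:
  assumes "finite A" "\<Union> (T ` J) \<times> {..<h} \<subseteq> A" and g: "1 \<le> g" and K: "1 \<le> K"
    and y: "\<And>u. (\<Sum>f\<in>{f\<in>J. u \<in> T f}. 2 * (1/2) ^ card (T f) * g ^ card (T f) * K ^ card (T f)) \<le> K - 1"
  shows "coin_prob A {r. bad r h s v} \<le> K / g ^ s"
proof -
  let ?p = "\<lambda>f. 2 * (1/2) ^ card (T f) :: real"
  let ?B = "{Ws\<in>level_lists h {v}. s \<le> total Ws}"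
  have fin: "finite ?B" using finite_level_lists by auto
  have "{r. bad r h s v} = (\<Union>Ws\<in>?B. {r. occurs r (\<lambda>_. 0) Ws})"
    by (auto simp: bad_def level_lists_def)
  then have "coin_prob A {r. bad r h s v} \<le> (\<Sum>Ws\<in>?B. coin_prob A {r. occurs r (\<lambda>_. 0) Ws})"
    using fin by (auto intro!: measure_UNION_le)
  also have "\<dots> \<le> (\<Sum>Ws\<in>?B. level_weight (\<lambda>f. ?p f * g ^ card (T f)) Ws / g ^ s)"
  proof (rule sum_mono)
    fix Ws assume "Ws \<in> ?B"
    then have Ws: "compat {v} Ws" "length Ws \<le> h" "s \<le> total Ws" by (auto simp: level_lists_def)
    have "coin_prob A {r. occurs r (\<lambda>_. 0) Ws} \<le> level_weight ?p Ws * 1"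
      using prob_occurs[OF assms(1,2) Ws(1,2)] by simp
    also have "\<dots> \<le> level_weight ?p Ws * (g ^ total Ws / g ^ s)"
      using g Ws(3) by (intro mult_left_mono level_weight_nonneg) (auto simp: power_increasing)
    also have "\<dots> = level_weight (\<lambda>f. ?p f * g ^ card (T f)) Ws / g ^ s"
      using level_weight_power[OF Ws(1)] by simp
    finally show "coin_prob A {r. occurs r (\<lambda>_. 0) Ws} \<le> level_weight (\<lambda>f. ?p f * g ^ card (T f)) Ws / g ^ s" .
  qed
  also have "\<dots> = (\<Sum>Ws\<in>?B. level_weight (\<lambda>f. ?p f * g ^ card (T f)) Ws) / g ^ s"
    by (simp add: sum_divide_distrib)
  also have "\<dots> \<le> (\<Sum>Ws\<in>level_lists h {v}. level_weight (\<lambda>f. ?p f * g ^ card (T f)) Ws) / g ^ s"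
    using g finite_level_lists by (intro divide_right_mono sum_mono2 level_weight_nonneg) auto
  also have "\<dots> \<le> K ^ card {v} / g ^ s"
    using g K y by (intro divide_right_mono sum_level_lists) auto
  finally show ?thesis by simp
qed

end

section \<open>The coloring algorithm on a table of random bits\<close>

text \<open>\<open>X\<close> is the number of walk codes per ball and also the number of incident
  edges searched for an owner. A walk chooses among \<open>d\<close> incident edges at each step,
  and \<open>Z\<close> is the number of attempts per query.\<close>

locale lca =
  fixes n :: nat and es :: "nat list list" and L X d Z :: nat
begin

definition incident :: "nat \<Rightarrow> nat \<Rightarrow> nat" where "incident u a = read_input n es Incident_Edge u a"
definition vertex :: "nat \<Rightarrow> nat \<Rightarrow> nat" where "vertex j p = read_input n es Edge_Vertex j p"
definition size_of :: "nat \<Rightarrow> nat" where "size_of j = read_input n es Edge_Size j 0"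

text \<open>
  \<open>owner u\<close> is the slot (edge, position) in which the color of \<open>u\<close> is stored. Junk reads are harmless: slot
  \<open>(j, p)\<close> can only belong to the vertex \<open>vertex j p\<close>.
\<close>

primrec find_slot :: "nat \<Rightarrow> nat \<Rightarrow> (nat \<times> nat) option \<Rightarrow> (nat \<times> nat) option" where
  "find_slot u 0 acc = acc"
| "find_slot u (Suc z) acc =
     find_slot u z (if vertex (incident u (z div L)) (z mod L) = u then Some (incident u (z div L), z mod L) else acc)"

definition owner :: "nat \<Rightarrow> (nat \<times> nat) option" where
  "owner u = find_slot u (X * L) None"

text \<open>The digits of the code in base \<open>d * L\<close>, lowest first, choose an incident
  edge and a position in it. Counting through codes replaces a graph search, which would have to
  store visited vertices, while all memory cells are taken by the colors. The test
  \<open>d * L \<le> 1\<close> is for termination.\<close>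

fun walk :: "nat \<Rightarrow> nat \<Rightarrow> nat \<Rightarrow> nat \<times> nat" where
  "walk u j y =
     (if y = 0 \<or> d * L \<le> 1 then (u, j)
      else walk (vertex (incident u (y mod (d * L) div L)) (y mod (d * L) mod L))
             (incident u (y mod (d * L) div L)) (y div (d * L)))"

declare walk.simps [simp del]

definition edge :: "nat \<Rightarrow> nat \<Rightarrow> nat" where
  "edge v x = snd (walk v 0 x)"

type_synonym colors = "nat \<Rightarrow> bool option"

text \<open>Colors are drawn when first needed. The default \<open>False\<close> is safe: in
  \<open>lca_table\<close> a vertex without a slot lies in no edge of size at most \<open>L\<close>
  and, if it is queried, in no set \<open>T j\<close>.\<close>

definition get_color :: "nat \<Rightarrow> colors \<Rightarrow> (bool \<times> colors) dtree" where
  "get_color u col =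
     (case owner u of
        None \<Rightarrow> Done (False, col)
      | Some _ \<Rightarrow>
          (case col u of
             Some b \<Rightarrow> Done (b, col)
           | None \<Rightarrow> Ask u (\<lambda>b. Done (b, col(u := Some b)))))"

primrec count_true :: "nat \<Rightarrow> nat \<Rightarrow> nat \<Rightarrow> colors \<Rightarrow> (nat \<times> colors) dtree" where
  "count_true j 0 s col = Done (s, col)"
| "count_true j (Suc i) s col = tbind (get_color (vertex j i) col) (\<lambda>(b, col'). count_true j i (s + of_bool b) col')"

text \<open>Resampling merely erases; the fresh bit is drawn at the next reading.\<close>

primrec clear_colors :: "nat \<Rightarrow> nat \<Rightarrow> colors \<Rightarrow> colors" where
  "clear_colors j 0 col = col"
| "clear_colors j (Suc i) col = clear_colors j i (if owner (vertex j i) = None then col else col(vertex j i := None))"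

text \<open>The log of resampled edges serves the analysis only; it is not stored by the program.\<close>

type_synonym lstate = "colors \<times> nat list"

text \<open>The product is zero if none or all of the vertices are \<open>True\<close>, a test for
  monochromaticity that the machine can evaluate without comparisons.\<close>

definition fix_edge :: "nat \<Rightarrow> lstate \<Rightarrow> lstate dtree" where
  "fix_edge j st =
     (if size_of j \<le> L
      then tbind (count_true j (size_of j) 0 (fst st)) (\<lambda>(s, col').
        Done (if (size_of j - s) * s = 0 then (clear_colors j (size_of j) col', snd st @ [j]) else (col', snd st)))
      else Done st)"

primrec iters :: "nat \<Rightarrow> nat \<Rightarrow> lstate \<Rightarrow> lstate dtree" where
  "iters v 0 st = Done st"
| "iters v (Suc k) st = tbind (fix_edge (edge v (k mod X)) st) (iters v k)"

definition query :: "nat \<Rightarrow> lstate \<Rightarrow> (bool \<times> lstate) dtree" where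
  "query v st = tbind (iters v Z st) (\<lambda>(col, l). tbind (get_color v col) (\<lambda>(b, col'). Done (b, (col', l))))"

primrec queries :: "nat list \<Rightarrow> lstate \<Rightarrow> bool list dtree" where
  "queries [] st = Done []"
| "queries (v # vs) st = tbind (query v st) (\<lambda>(b, st'). tbind (queries vs st') (\<lambda>bs. Done (b # bs)))"

lemma find_slot_cases: "find_slot u k acc = acc \<or>
   (\<exists>z<k. find_slot u k acc = Some (incident u (z div L), z mod L) \<and> vertex (incident u (z div L)) (z mod L) = u)"
proof (induction k arbitrary: acc)
  case (Suc k)
  show ?case using Suc.IH[of "if vertex (incident u (k div L)) (k mod L) = u then Some (incident u (k div L), k mod L) else acc"]
    by (auto split: if_splits intro: less_SucI)
qed simp

lemma find_slot_Some: "find_slot u k (Some x) \<noteq> None"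
  using find_slot_cases[of u k "Some x"] by auto

lemma find_slot_found: "z < k \<Longrightarrow> vertex (incident u (z div L)) (z mod L) = u \<Longrightarrow> find_slot u k acc \<noteq> None"
proof (induction k arbitrary: acc)
  case (Suc k)
  then show ?case by (cases "z = k") (auto simp: find_slot_Some)
qed simp

lemma owner_SomeD:
  assumes "owner u = Some (j, p)"
  shows "vertex j p = u" "\<exists>a. j = incident u a" "L > 0 \<Longrightarrow> p < L"
  using find_slot_cases[of u "X * L" None] assms unfolding owner_def by auto

lemma owner_found:
  assumes "a < X" "p < L" "vertex (incident u a) p = u"
  shows "owner u \<noteq> None"
proof -
  have "p + L * a < L * Suc a" using assms by simp
  also have "\<dots> \<le> L * X" using assms by (intro mult_le_mono2) simp
  finally show ?thesis
    unfolding owner_def by (intro find_slot_found[of "p + L * a"]) (use assms in \<open>auto simp: mult.commute\<close>)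
qed

lemma incident_less: "es \<noteq> [] \<Longrightarrow> incident u a < length es"
proof -
  assume *: "es \<noteq> []"
  have "set (incidence_list es u) \<subseteq> {..<length es}" by (auto simp: incidence_list_def)
  then have "a < length (incidence_list es u) \<Longrightarrow> incidence_list es u ! a < length es"
    using nth_mem by blast
  then show ?thesis using * by (simp add: incident_def)
qed

lemma walk_less: "es \<noteq> [] \<Longrightarrow> j < length es \<Longrightarrow> snd (walk u j y) < length es"
  by (induction u j y rule: walk.induct) (subst walk.simps, auto simp: incident_less)

lemma edge_less: "es \<noteq> [] \<Longrightarrow> edge v x < length es"
  by (simp add: edge_def walk_less)

lemma clear_colors_apply: "clear_colors j k col u = (if owner u \<noteq> None \<and> (\<exists>i<k. vertex j i = u) then None else col u)"
proof (induction k arbitrary: col)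
  case (Suc k)
  have "(\<exists>i<Suc k. vertex j i = u) \<longleftrightarrow> vertex j k = u \<or> (\<exists>i<k. vertex j i = u)"
    by (auto simp: less_Suc_eq)
  then show ?case
    by (cases "vertex j k = u") (auto simp: Suc)
qed simp

end

text \<open>\<open>s\<close> is the size of a history that endangers an answer. By
  \<open>radius\<close> the codes below \<open>X\<close> include all walks of \<open>s\<close>
  digits, and by \<open>s_le\<close> one large edge is already a history of this size.\<close>

locale lca_table = lca n es L X d Z + moser_tardos "{..<length es}" T
  for n es L X d Z T +
  fixes vs :: "nat list" and s :: nat
  assumes m_pos: "es \<noteq> []"
    and distinct_edge: "j < length es \<Longrightarrow> distinct (es ! j)"
    and edge_vertices: "j < length es \<Longrightarrow> set (es ! j) \<subseteq> {..<n}"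
    and edge_size: "j < length es \<Longrightarrow> 2 \<le> length (es ! j)"
    and T_small: "j < length es \<Longrightarrow> length (es ! j) \<le> L \<Longrightarrow> T j = set (es ! j)"
    and T_big: "j < length es \<Longrightarrow> L < length (es ! j) \<Longrightarrow> L \<le> card (T j)"
    and T_sub: "j < length es \<Longrightarrow> T j \<subseteq> set (es ! j)"
    and small_owned: "j < length es \<Longrightarrow> length (es ! j) \<le> L \<Longrightarrow> u \<in> set (es ! j) \<Longrightarrow> owner u \<noteq> None"
    and queried_owned: "j < length es \<Longrightarrow> u \<in> T j \<Longrightarrow> u \<in> set vs \<Longrightarrow> owner u \<noteq> None"
    and small_incident: "j < length es \<Longrightarrow> length (es ! j) \<le> L \<Longrightarrow> u \<in> set (es ! j) \<Longrightarrow> \<exists>a<d. incident u a = j"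
    and radius: "(d * L) ^ s \<le> X" and s_le: "s \<le> L" and L_ge: "2 \<le> L" and d_pos: "1 \<le> d"
    and Z_def: "Z = X * X * X"
begin

section \<open>The algorithm as an evolution of logs\<close>

abbreviation m where "m \<equiv> length es"

lemma size_of_eq [simp]: "j < m \<Longrightarrow> size_of j = length (es ! j)"
  by (simp add: size_of_def)

lemma vertex_eq [simp]: "j < m \<Longrightarrow> i < length (es ! j) \<Longrightarrow> vertex j i = es ! j ! i"
  by (simp add: vertex_def)

text \<open>On a table the log determines every color, so that the analysis can forget the stored
  colors and follow the log alone.\<close>

definition fix_log :: "(nat \<times> nat \<Rightarrow> bool) \<Rightarrow> nat \<Rightarrow> nat list \<Rightarrow> nat list" where
  "fix_log r j l = (if length (es ! j) \<le> L \<and> mono_at r (hits l) (T j) then l @ [j] else l)"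

primrec iter_log :: "(nat \<times> nat \<Rightarrow> bool) \<Rightarrow> nat \<Rightarrow> nat \<Rightarrow> nat list \<Rightarrow> nat list" where
  "iter_log r v 0 l = l"
| "iter_log r v (Suc k) l = iter_log r v k (fix_log r (edge v (k mod X)) l)"

primrec replies :: "(nat \<times> nat \<Rightarrow> bool) \<Rightarrow> nat list \<Rightarrow> nat list \<Rightarrow> bool list" where
  "replies r [] l = []"
| "replies r (v # us) l =
     (owner v \<noteq> None \<and> r (v, hits (iter_log r v Z l) v)) # replies r us (iter_log r v Z l)"

text \<open>The violation test colors all vertices of an edge before it can be resampled. So each
  resampling discards exactly one drawn bit per vertex, and lazy drawing stays in step with
  \<open>hits\<close>.\<close>

definition inv :: "(nat \<times> nat \<Rightarrow> bool) \<Rightarrow> (nat \<Rightarrow> nat) \<Rightarrow> lstate \<Rightarrow> bool" where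
  "inv r c st \<longleftrightarrow> (\<forall>u. c u = hits (snd st) u + of_bool (fst st u \<noteq> None) \<and>
     (\<forall>b. fst st u = Some b \<longrightarrow> b = r (u, hits (snd st) u)))"

lemma run_get:
  assumes "inv r c (col, l)" "run_table r (get_color u col) c = ((b, col'), c')"
  shows "inv r c' (col', l)" "b \<longleftrightarrow> owner u \<noteq> None \<and> r (u, hits l u)"
    "owner u \<noteq> None \<longrightarrow> col' u \<noteq> None" "\<And>w. col w \<noteq> None \<Longrightarrow> col' w \<noteq> None"
proof -
  have "inv r c' (col', l) \<and> (b \<longleftrightarrow> owner u \<noteq> None \<and> r (u, hits l u)) \<and> (owner u \<noteq> None \<longrightarrow> col' u \<noteq> None) \<and>
      (\<forall>w. col w \<noteq> None \<longrightarrow> col' w \<noteq> None)"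
  proof (cases "owner u")
    case None
    with assms show ?thesis by (auto simp: get_color_def)
  next
    case (Some o')
    then show ?thesis
    proof (cases "col u")
      case None
      then have "c u = hits l u" using assms(1) by (auto simp: inv_def)
      with None Some assms show ?thesis by (auto simp: get_color_def inv_def split: if_splits)
    next
      case (Some b')
      with \<open>owner u = _\<close> assms show ?thesis by (auto simp: get_color_def inv_def)
    qed
  qed
  then show "inv r c' (col', l)" "b \<longleftrightarrow> owner u \<noteq> None \<and> r (u, hits l u)"
    "owner u \<noteq> None \<longrightarrow> col' u \<noteq> None" "\<And>w. col w \<noteq> None \<Longrightarrow> col' w \<noteq> None" by blast+
qed

lemma run_count_true:
  assumes "j < m" "length (es ! j) \<le> L" "k \<le> length (es ! j)"
    "inv r c (col, l)" "run_table r (count_true j k t col) c = ((t', col'), c')"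
  shows "inv r c' (col', l) \<and> t' = t + card {i. i < k \<and> r (es ! j ! i, hits l (es ! j ! i))} \<and>
    (\<forall>i<k. col' (es ! j ! i) \<noteq> None) \<and> (\<forall>w. col w \<noteq> None \<longrightarrow> col' w \<noteq> None)"
  using assms(3-)
proof (induction k arbitrary: t col c)
  case (Suc k)
  let ?u = "es ! j ! k"
  obtain b col1 c1 where g: "run_table r (get_color ?u col) c = ((b, col1), c1)"
    by (metis surj_pair)
  have own: "owner ?u \<noteq> None"
    using small_owned[OF assms(1,2)] Suc.prems by auto
  note 1 = run_get[OF Suc.prems(2) g]
  have b: "b \<longleftrightarrow> r (?u, hits l ?u)" using 1(2) own by auto
  have "run_table r (count_true j k (t + of_bool b) col1) c1 = ((t', col'), c')"
    using Suc.prems g assms(1) by (simp add: run_table_tbind)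
  note 2 = Suc.IH[OF _ 1(1) this]
  have "{i. i < Suc k \<and> r (es ! j ! i, hits l (es ! j ! i))} =
      {i. i < k \<and> r (es ! j ! i, hits l (es ! j ! i))} \<union> (if b then {k} else {})"
    using b by (auto simp: less_Suc_eq)
  then have "card {i. i < Suc k \<and> r (es ! j ! i, hits l (es ! j ! i))} =
      card {i. i < k \<and> r (es ! j ! i, hits l (es ! j ! i))} + of_bool b"
    by auto
  with 1 2 own Suc.prems show ?case
    by (auto simp: less_Suc_eq)
qed (auto simp: inv_def)

lemma mono_iff_count:
  assumes "j < m" "length (es ! j) \<le> L"
  shows "mono_at r q (T j) \<longleftrightarrow>
    (let t = card {i. i < length (es ! j) \<and> r (es ! j ! i, q (es ! j ! i))} in (length (es ! j) - t) * t = 0)"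
proof -
  let ?k = "length (es ! j)"
  let ?S = "{i. i < ?k \<and> r (es ! j ! i, q (es ! j ! i))}"
  have S: "?S \<subseteq> {..<?k}" "finite ?S" by auto
  have le: "card ?S \<le> ?k" using card_mono[OF _ S(1)] by simp
  have "card ?S = 0 \<longleftrightarrow> (\<forall>i<?k. \<not> r (es ! j ! i, q (es ! j ! i)))"
    using S(2) by auto
  moreover have "card ?S = ?k \<longleftrightarrow> (\<forall>i<?k. r (es ! j ! i, q (es ! j ! i)))"
  proof
    assume "card ?S = ?k"
    then have "?S = {..<?k}" by (intro card_subset_eq[OF _ S(1)]) auto
    then show "\<forall>i<?k. r (es ! j ! i, q (es ! j ! i))" by blast
  next
    assume "\<forall>i<?k. r (es ! j ! i, q (es ! j ! i))"
    then have "?S = {..<?k}" by auto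
    then show "card ?S = ?k" by simp
  qed
  moreover have "mono_at r q (T j) \<longleftrightarrow> (\<forall>i<?k. r (es ! j ! i, q (es ! j ! i))) \<or> (\<forall>i<?k. \<not> r (es ! j ! i, q (es ! j ! i)))"
    unfolding mono_at_def T_small[OF assms] by (simp add: all_set_conv_all_nth ex_bool_eq)
  ultimately show ?thesis using le by (auto simp: Let_def)
qed

lemma run_fix_edge:
  assumes "j < m" "inv r c (col, l)" "run_table r (fix_edge j (col, l)) c = ((col', l'), c')"
  shows "inv r c' (col', l') \<and> l' = fix_log r j l"
proof (cases "length (es ! j) \<le> L")
  case False
  with assms show ?thesis by (auto simp: fix_edge_def fix_log_def)
next
  case True
  let ?k = "length (es ! j)"
  obtain t col1 c1 where g: "run_table r (count_true j ?k 0 col) c = ((t, col1), c1)"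
    by (metis surj_pair)
  note 1 = run_count_true[OF assms(1) True _ assms(2) g, simplified]
  let ?m = "mono_at r (hits l) (T j)"
  have m: "?m \<longleftrightarrow> (?k - t) * t = 0"
    using mono_iff_count[OF assms(1) True, of r "hits l"] 1 by (simp add: Let_def)
  have "run_table r (fix_edge j (col, l)) c =
      (if (?k - t) * t = 0 then (clear_colors j ?k col1, l @ [j]) else (col1, l), c1)"
    by (simp only: fix_edge_def run_table_tbind g size_of_eq[OF assms(1)] True if_True fst_conv snd_conv
        prod.case run_table.simps)
  then have res: "(col', l') = (if ?m then (clear_colors j ?k col1, l @ [j]) else (col1, l))" "c' = c1"
    using assms(3) by (auto simp only: m prod.inject)
  show ?thesis
  proof (cases ?m)
    case False
    with res 1 show ?thesis by (simp add: fix_log_def)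
  next
    case mono: True
    have e: "col' = clear_colors j ?k col1" "l' = l @ [j]" "c' = c1"
      using res mono by auto
    have "inv r c1 (clear_colors j ?k col1, l @ [j])"
      unfolding inv_def fst_conv snd_conv
    proof (intro allI conjI impI)
      fix u
      have i: "inv r c1 (col1, l)" using 1 by simp
      have uT: "u \<in> T j \<longleftrightarrow> (\<exists>i<?k. vertex j i = u)"
        using T_small[OF assms(1) True] assms(1) by (auto simp: in_set_conv_nth)
      have own: "u \<in> T j \<Longrightarrow> owner u \<noteq> None \<and> col1 u \<noteq> None"
        using T_small[OF assms(1) True] small_owned[OF assms(1) True] 1 by (auto simp: in_set_conv_nth)
      then show "c1 u = hits (l @ [j]) u + of_bool (clear_colors j ?k col1 u \<noteq> None)"
        using i uT by (auto simp: clear_colors_apply inv_def)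
      fix b assume "clear_colors j ?k col1 u = Some b"
      with i uT own show "b = r (u, hits (l @ [j]) u)"
        by (auto simp: clear_colors_apply inv_def split: if_splits)
    qed
    then show ?thesis using e mono True by (simp add: fix_log_def)
  qed
qed

lemma run_iters:
  assumes "inv r c (col, l)" "run_table r (iters v k (col, l)) c = ((col', l'), c')"
  shows "inv r c' (col', l') \<and> l' = iter_log r v k l"
  using assms
proof (induction k arbitrary: c col l)
  case (Suc k)
  obtain col1 l1 c1 where g: "run_table r (fix_edge (edge v (k mod X)) (col, l)) c = ((col1, l1), c1)"
    by (metis surj_pair)
  note 1 = run_fix_edge[OF edge_less[OF m_pos] Suc.prems(1) g]
  with Suc.IH[of c1 col1 l1] Suc.prems(2) g show ?case
    by (auto simp: run_table_tbind)
qed simp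

lemma run_queries:
  assumes "inv r c (col, l)"
  shows "fst (run_table r (queries us (col, l)) c) = replies r us l"
  using assms
proof (induction us arbitrary: c col l)
  case (Cons v us)
  obtain col1 l1 c1 where g: "run_table r (iters v Z (col, l)) c = ((col1, l1), c1)"
    by (metis surj_pair)
  note 1 = run_iters[OF Cons.prems g]
  obtain b col2 c2 where g2: "run_table r (get_color v col1) c1 = ((b, col2), c2)"
    by (metis surj_pair)
  note 2 = run_get[OF conjunct1[OF 1] g2]
  show ?case
    using Cons.IH[OF 2(1)] 1 2(2) g g2
    by (simp add: query_def run_table_tbind split: prod.split)
      (metis fst_conv)
qed simp

lemma valid_fix_log: "valid r l \<Longrightarrow> valid r (fix_log r j l)"
  by (simp add: fix_log_def)

lemma valid_iter_log: "valid r l \<Longrightarrow> valid r (iter_log r v k l)"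
  by (induction k arbitrary: l) (auto simp: valid_fix_log)

lemma set_fix_log: "set l \<subseteq> {..<m} \<Longrightarrow> j < m \<Longrightarrow> set (fix_log r j l) \<subseteq> {..<m}"
  by (auto simp: fix_log_def)

lemma set_iter_log: "set l \<subseteq> {..<m} \<Longrightarrow> set (iter_log r v k l) \<subseteq> {..<m}"
  by (induction k arbitrary: l) (simp_all add: edge_less m_pos set_fix_log)

lemma fix_log_prefix: "\<exists>x. fix_log r j l = l @ x"
  by (auto simp: fix_log_def)

lemma iter_log_prefix: "\<exists>x. iter_log r v k l = l @ x"
  by (induction k arbitrary: l) (auto, metis append.assoc fix_log_prefix)

section \<open>Sweeps and quiet balls\<close>

definition quiet :: "(nat \<times> nat \<Rightarrow> bool) \<Rightarrow> nat \<Rightarrow> nat list \<Rightarrow> bool" where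
  "quiet r v l \<longleftrightarrow> (\<forall>x<X. length (es ! edge v x) \<le> L \<longrightarrow> \<not> mono_at r (hits l) (T (edge v x)))"

lemma fix_log_id: "fix_log r j l = l \<longleftrightarrow> \<not> (length (es ! j) \<le> L \<and> mono_at r (hits l) (T j))"
  by (simp add: fix_log_def)

lemma X_pos: "0 < X"
proof -
  have "0 < (d * L) ^ s" using L_ge d_pos by simp
  with radius show ?thesis by linarith
qed

lemma iter_log_quiet: "quiet r v l \<Longrightarrow> iter_log r v k l = l"
proof (induction k)
  case (Suc k)
  then have "fix_log r (edge v (k mod X)) l = l"
    using X_pos by (auto simp: fix_log_id quiet_def)
  with Suc show ?case by simp
qed simp

lemma fix_log_length: "length l \<le> length (fix_log r j l)"
  by (simp add: fix_log_def)

lemma fix_log_eq: "length (fix_log r j l) = length l \<Longrightarrow> fix_log r j l = l"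
  by (simp add: fix_log_def split: if_splits)

primrec block :: "(nat \<times> nat \<Rightarrow> bool) \<Rightarrow> nat \<Rightarrow> nat \<Rightarrow> nat list \<Rightarrow> nat list" where
  "block r v 0 l = l"
| "block r v (Suc k) l = block r v k (fix_log r (edge v k) l)"

lemma iter_log_block: "k \<le> X \<Longrightarrow> iter_log r v (k + y * X) l = iter_log r v (y * X) (block r v k l)"
  by (induction k arbitrary: l) auto

lemma block_prefix: "\<exists>x. block r v k l = l @ x \<and> set x \<subseteq> edge v ` {..<k}"
proof (induction k arbitrary: l)
  case (Suc k)
  obtain x where x: "block r v k (fix_log r (edge v k) l) = fix_log r (edge v k) l @ x" "set x \<subseteq> edge v ` {..<k}"
    using Suc by blast
  then show ?case
    by (auto simp: fix_log_def lessThan_Suc)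
qed simp

lemma block_id: "length (block r v k l) = length l \<Longrightarrow> \<forall>x<k. fix_log r (edge v x) l = l"
proof (induction k arbitrary: l)
  case (Suc k)
  have "length (fix_log r (edge v k) l) \<le> length (block r v (Suc k) l)"
    using block_prefix[of r v k "fix_log r (edge v k) l"] by auto
  then have e: "fix_log r (edge v k) l = l"
    using Suc.prems fix_log_length[of l r "edge v k"] by (intro fix_log_eq) simp
  with Suc have "\<forall>x<k. fix_log r (edge v x) l = l" by simp
  with e show ?case by (auto simp: less_Suc_eq)
qed simp

text \<open>A sweep over all \<open>X\<close> codes that resamples nothing has tested all of them on
  the same log, so the ball is quiet and stays so. Every other sweep adds an entry.\<close>

lemma iter_log_progress:
  "\<exists>x. iter_log r v (y * X) l = l @ x \<and> set x \<subseteq> edge v ` {..<X} \<and> (quiet r v (l @ x) \<or> y \<le> length x)"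
proof (induction y arbitrary: l)
  case (Suc y)
  obtain x where x: "block r v X l = l @ x" "set x \<subseteq> edge v ` {..<X}"
    using block_prefix by blast
  have eq: "iter_log r v (Suc y * X) l = iter_log r v (y * X) (l @ x)"
    using iter_log_block[of X r v y l] x by simp
  show ?case
  proof (cases "x = []")
    case True
    then have "quiet r v l"
      using block_id[of r v X l] x by (auto simp: quiet_def fix_log_id)
    then show ?thesis using iter_log_quiet by (intro exI[of _ "[]"]) auto
  next
    case False
    obtain x' where x': "iter_log r v (y * X) (l @ x) = (l @ x) @ x'" "set x' \<subseteq> edge v ` {..<X}"
        "quiet r v ((l @ x) @ x') \<or> y \<le> length x'"
      using Suc.IH by blast
    moreover have "1 \<le> length x" using False by (cases x) auto
    ultimately show ?thesis
      using x eq by (intro exI[of _ "x @ x'"]) auto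
  qed
qed auto

section \<open>Bounds on the number of resamplings\<close>

lemma card_T_pos: "j < m \<Longrightarrow> 1 \<le> card (T j)"
  using finite_T[of j] T_nonempty[of j] by (simp add: Suc_le_eq card_gt_0_iff)

text \<open>The last resampling of an edge at \<open>u\<close> has all earlier ones at
  \<open>u\<close> in its history, and each of them adds at least one to the total.\<close>

lemma bad_of_hits:
  assumes "valid r l" "set l \<subseteq> {..<m}" "length l \<le> h" "k \<le> hits l u" "0 < k"
  shows "bad r h k u"
proof -
  have "hits l u \<noteq> 0" using assms(4,5) by simp
  then have "\<exists>j\<in>set l. u \<in> T j"
    by (auto simp: hits_def filter_empty_conv)
  then obtain l1 j l2 where l: "l = l1 @ j # l2" "u \<in> T j" "\<forall>j\<in>set l2. u \<notin> T j"
    using split_list_last_prop[of l "\<lambda>j. u \<in> T j"] by blast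
  have "hits l2 u = 0" using l(3) by (induction l2) auto
  then have c: "k \<le> Suc (hits l1 u)" using assms(4) l by simp
  have v: "valid r (l1 @ [j])"
    using valid_take[OF assms(1), of "Suc (length l1)"] l by simp
  have j: "j < m" "set l1 \<subseteq> {..<m}" using assms(2) l by auto
  have "total [{j}] + hits l1 u \<le> total (foldr insert_edge l1 [{j}])"
    using j l compat_singleton[of j u] by (intro total_foldr_insert_edge_hits) auto
  then have "k \<le> total (foldr insert_edge l1 [{j}])"
    using c card_T_pos[OF j(1)] by simp
  with v j l assms(3) show ?thesis by (intro badI[of r l1 j]) auto
qed

lemma T_less: "j < m \<Longrightarrow> u \<in> T j \<Longrightarrow> u < n"
  using T_sub[of j] edge_vertices[of j] by auto

lemma sum_hits: "set l \<subseteq> {..<m} \<Longrightarrow> length l \<le> (\<Sum>u<n. hits l u)"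
proof (induction l)
  case (Cons j l)
  obtain u where "u \<in> T j" using T_nonempty[of j] Cons.prems by auto
  then have "1 \<le> (\<Sum>u<n. of_bool (u \<in> T j) :: nat)"
    using T_less[of j u] Cons.prems by (intro order_trans[OF _ member_le_sum[of u]]) auto
  with Cons show ?case by (simp add: sum.distrib)
qed simp

text \<open>By pigeonhole the first \<open>n * k\<close> entries of a longer log would hit some
  vertex at least \<open>k\<close> times. Cutting the log there keeps it within the bound
  \<open>h\<close>.\<close>

lemma length_valid:
  assumes good: "\<And>u. u < n \<Longrightarrow> \<not> bad r h k u" and h: "n * k \<le> h" and k: "0 < k"
    and "valid r l" "set l \<subseteq> {..<m}"
  shows "length l < n * k"
proof (rule ccontr)
  assume "\<not> length l < n * k"
  define l' where "l' = take (n * k) l"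
  have len: "length l' = n * k" using \<open>\<not> _\<close> by (simp add: l'_def)
  have l': "valid r l'" "set l' \<subseteq> {..<m}"
    using assms(4,5) set_take_subset[of "n * k" l] by (auto simp: l'_def valid_take)
  have np: "0 < n"
    using T_less[of 0] T_nonempty[of 0] m_pos by (auto intro: gr0I)
  have "\<exists>u<n. k \<le> hits l' u"
  proof (rule ccontr)
    assume "\<not> ?thesis"
    then have "(\<Sum>u<n. hits l' u) < (\<Sum>u<n. k)"
      using np by (intro sum_strict_mono) auto
    with sum_hits[OF l'(2)] len show False by simp
  qed
  then obtain u where "u < n" "k \<le> hits l' u" by auto
  with bad_of_hits[OF l'(1,2), of h k u] len h good k show False by simp
qed

text \<open>This is the origin of the cube: \<open>X * X\<close> sweeps of \<open>X\<close> codes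
  that never become quiet yield \<open>X * X\<close> resamplings among at most \<open>X\<close>
  edges. Hence one edge is resampled \<open>X\<close> times, and so are its vertices.\<close>

lemma iter_log_Z_quiet:
  assumes good: "\<And>u. u < n \<Longrightarrow> \<not> bad r h X u" and h: "n * X \<le> h"
    and "valid r l" "set l \<subseteq> {..<m}"
  shows "quiet r v (iter_log r v Z l)"
proof (rule ccontr)
  assume nq: "\<not> ?thesis"
  obtain x where x: "iter_log r v Z l = l @ x" "set x \<subseteq> edge v ` {..<X}" "X * X \<le> length x"
    using iter_log_progress[of r v "X * X" l] nq unfolding Z_def by metis
  have v: "valid r (l @ x)" "set (l @ x) \<subseteq> {..<m}"
    using valid_iter_log[OF assms(3), of v Z] set_iter_log[OF assms(4), of r v Z] x by auto
  have "\<exists>j\<in>edge v ` {..<X}. X \<le> count_list x j"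
  proof (rule ccontr)
    assume "\<not> ?thesis"
    then have "(\<Sum>j\<in>edge v ` {..<X}. count_list x j) < (\<Sum>j\<in>edge v ` {..<X}. X)"
      using X_pos by (intro sum_strict_mono) (auto simp: not_le)
    also have "\<dots> \<le> X * X"
      using card_image_le[of "{..<X}" "edge v"] by simp
    also have "\<dots> \<le> length x" by fact
    also have "\<dots> = sum (count_list x) (set x)" by (simp add: sum_count_set)
    also have "\<dots> \<le> sum (count_list x) (edge v ` {..<X})"
      using x by (intro sum_mono2) auto
    finally show False by simp
  qed
  then obtain j where j: "X \<le> count_list x j" "j < m"
    using edge_less[OF m_pos] by auto
  obtain u where u: "u \<in> T j" using T_nonempty[of j] j by auto
  have "count_list x j \<le> hits x u"
    using u by (induction x) auto
  then have "bad r h X u"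
    using v j length_valid[OF good h X_pos v] h X_pos by (intro bad_of_hits[of r "l @ x"]) auto
  with good T_less[OF j(2) u] show False by auto
qed

text \<open>
  \<open>reach v i w\<close>: following the \<open>i\<close> lowest digits of some code leads from \<open>v\<close> to \<open>w\<close>. The remaining code \<open>z\<close> must
  be positive, since a walk stops as soon as only zero digits are left.
\<close>

definition reach :: "nat \<Rightarrow> nat \<Rightarrow> nat \<Rightarrow> bool" where
  "reach v i w \<longleftrightarrow> (\<exists>y<(d * L) ^ i. \<forall>z j. 0 < z \<longrightarrow> (\<exists>j'. walk v j (y + (d * L) ^ i * z) = walk w j' z))"

lemma dL: "1 < d * L"
  using L_ge d_pos mult_le_mono[of 1 d 2 L] by simp

lemma div_mod_digit: "(x :: nat) < q \<Longrightarrow> (x + q * z) div q = z \<and> (x + q * z) mod q = x"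
  by auto

lemma walk_digit:
  assumes "a < d" "p < L"
  shows "walk u j (a * L + p + d * L * z) =
    (if a * L + p + d * L * z = 0 then (u, j) else walk (vertex (incident u a) p) (incident u a) z)"
proof -
  have "a * L + p < Suc a * L" using assms by simp
  also have "\<dots> \<le> d * L" using assms by (intro mult_le_mono1) simp
  finally have lt: "a * L + p < d * L" .
  have "(a * L + p + d * L * z) mod (d * L) = a * L + p" "(a * L + p + d * L * z) div (d * L) = z"
    using div_mod_digit[OF lt] by blast+
  moreover have "(a * L + p) div L = a" "(a * L + p) mod L = p" using assms by auto
  ultimately show ?thesis using dL by (subst walk.simps) auto
qed

lemma digit_less:
  assumes "a < d" "p < L" "y < (d * L) ^ i"
  shows "y + (d * L) ^ i * (a * L + p) < (d * L) ^ Suc i"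
proof -
  have "a * L + p < Suc a * L" using assms by simp
  also have "\<dots> \<le> d * L" using assms by (intro mult_le_mono1) simp
  finally have lt: "Suc (a * L + p) \<le> d * L" by simp
  have "y + (d * L) ^ i * (a * L + p) < (d * L) ^ i * Suc (a * L + p)" using assms by simp
  also have "\<dots> \<le> (d * L) ^ i * (d * L)" using lt by (intro mult_le_mono2)
  finally show ?thesis by (simp add: mult.commute)
qed

lemma reach_0: "reach v 0 v"
  unfolding reach_def
proof (rule exI[of _ 0], intro conjI allI impI)
  fix z j :: nat assume "0 < z"
  then show "\<exists>j'. walk v j (0 + (d * L) ^ 0 * z) = walk v j' z" by auto
qed simp

lemma reach_Suc:
  assumes "reach v i w" "j < m" "length (es ! j) \<le> L" "w \<in> T j" "u \<in> T j"
  shows "reach v (Suc i) u"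
proof -
  obtain y where y: "y < (d * L) ^ i" "\<And>z j. 0 < z \<Longrightarrow> \<exists>j'. walk v j (y + (d * L) ^ i * z) = walk w j' z"
    using assms(1) unfolding reach_def by blast
  have w: "w \<in> set (es ! j)" and "u \<in> set (es ! j)" using assms T_small by auto
  then obtain a p where a: "a < d" "incident w a = j" and p: "p < length (es ! j)" "es ! j ! p = u"
    using small_incident[OF assms(2,3) w] by (auto simp: in_set_conv_nth)
  have "p < L" using p assms(3) by simp
  show ?thesis
    unfolding reach_def
  proof (rule exI[of _ "y + (d * L) ^ i * (a * L + p)"], intro conjI allI impI)
    show "y + (d * L) ^ i * (a * L + p) < (d * L) ^ Suc i"
      using digit_less a(1) \<open>p < L\<close> y(1) .
    fix z j0 :: nat assume z: "0 < z"
    have "y + (d * L) ^ i * (a * L + p) + (d * L) ^ Suc i * z = y + (d * L) ^ i * (a * L + p + d * L * z)"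
      by (simp add: algebra_simps)
    moreover obtain j' where "walk v j0 (y + (d * L) ^ i * (a * L + p + d * L * z)) = walk w j' (a * L + p + d * L * z)"
      using y(2)[of "a * L + p + d * L * z" j0] z L_ge d_pos by auto
    moreover have "walk w j' (a * L + p + d * L * z) = walk u j z"
      using walk_digit[OF a(1) \<open>p < L\<close>, of w j' z] z dL a p assms(2) by auto
    ultimately show "\<exists>j'. walk v j0 (y + (d * L) ^ i * (a * L + p) + (d * L) ^ Suc i * z) = walk u j' z"
      by metis
  qed
qed

lemma reach_edge:
  assumes "reach v i w" "j < m" "length (es ! j) \<le> L" "w \<in> T j"
  shows "\<exists>x<(d * L) ^ Suc i. edge v x = j"
proof -
  obtain y where y: "y < (d * L) ^ i" "\<And>z j. 0 < z \<Longrightarrow> \<exists>j'. walk v j (y + (d * L) ^ i * z) = walk w j' z"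
    using assms(1) unfolding reach_def by blast
  have w: "w \<in> set (es ! j)" using assms T_small by auto
  then obtain a where a: "a < d" "incident w a = j"
    using small_incident[OF assms(2,3) w] by auto
  \<comment> \<open>Position 1 is chosen for the last step because its digit is nonzero even for
    \<open>a = 0\<close>; a walk with code zero would stop before reaching \<open>j\<close>.\<close>
  have "1 < L" using L_ge by simp
  obtain j' where "walk v 0 (y + (d * L) ^ i * (a * L + 1)) = walk w j' (a * L + 1)"
    using y(2)[of "a * L + 1" 0] by auto
  moreover have "walk w j' (a * L + 1) = walk (vertex j 1) j 0"
    using walk_digit[OF a(1) \<open>1 < L\<close>, of w j' 0] a by simp
  moreover have "walk (vertex j 1) j 0 = (vertex j 1, j)" by (subst walk.simps) simp
  ultimately have "edge v (y + (d * L) ^ i * (a * L + 1)) = j" by (simp add: edge_def)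
  with digit_less[OF a(1) \<open>1 < L\<close> y(1)] show ?thesis by blast
qed

text \<open>
  An edge that is not monochromatic when the ball is quiet can become so only after the resampling of a
  neighbor; iterating this leads out of the ball, or to an edge larger than \<open>L\<close>.
\<close>

lemma chain:
  assumes q: "quiet r v l" and l: "set l \<subseteq> {..<m}"
    and "reach v i w" "j < m" "w \<in> T j" "valid r (l @ R @ [j])" "set R \<subseteq> {..<m}"
    and "compat U Ws" "T j \<subseteq> covers Ws" "i < total Ws" "card (T j) \<le> total Ws"
  shows "s \<le> total (foldr insert_edge (l @ R) Ws)"
  using assms(3-)
proof (induction "s - i" arbitrary: i w j R Ws)
  \<comment> \<open>Each step raises \<open>i\<close> by one and \<open>total\<close> by at least
    one, so \<open>i < total Ws\<close> persists. When \<open>i\<close> has reached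
    \<open>s\<close>, the history is large enough.\<close>
  case (0 i w j R Ws)
  have "total Ws \<le> total (foldr insert_edge (l @ R) Ws)"
    using l 0 by (intro total_foldr_insert_edge) auto
  then show ?case using 0 by simp
next
  case (Suc k i w j R Ws)
  have mono: "total Ws \<le> total (foldr insert_edge (l @ R) Ws)"
    using l Suc.prems by (intro total_foldr_insert_edge) auto
  show ?case
  proof (cases "length (es ! j) \<le> L")
    case False
    then have "L \<le> total Ws" using T_big[of j] Suc.prems by linarith
    then show ?thesis using mono s_le by linarith
  next
    case small: True
    obtain x where x: "x < (d * L) ^ Suc i" "edge v x = j"
      using reach_edge[OF Suc.prems(1,2) small Suc.prems(3)] by blast
    have "(d * L) ^ Suc i \<le> (d * L) ^ s"
      using Suc.hyps(2) less_imp_le[OF dL] by (intro power_increasing) simp_all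
    then have "x < X" using x radius by linarith
    then have "\<not> mono_at r (hits l) (T j)" using q x small by (auto simp: quiet_def)
    moreover have "mono_at r (hits (l @ R)) (T j)"
      using Suc.prems(4) valid_snoc[of r "l @ R" j] by simp
    ultimately obtain u where u: "u \<in> T j" "hits R u \<noteq> 0"
      using mono_at_cong[of "T j" "hits l" "hits (l @ R)" r] by auto
    then have "\<exists>f\<in>set R. u \<in> T f" by (auto simp: hits_def filter_empty_conv)
    then obtain R1 f R2 where R: "R = R1 @ f # R2" "u \<in> T f" by (meson split_list)
    have f: "f < m" "set R1 \<subseteq> {..<m}" "set R2 \<subseteq> {..<m}" using Suc.prems R by auto
    let ?Ws = "foldr insert_edge R2 Ws"
    have c: "compat U ?Ws" using f Suc.prems by (intro compat_foldr_insert_edge) auto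
    have "T j \<subseteq> covers ?Ws" using covers_foldr_insert_edge Suc.prems by blast
    then have touch: "T f \<inter> covers ?Ws \<noteq> {}" using u R by auto
    have t: "total (insert_edge f ?Ws) = total ?Ws + card (T f)" "total Ws \<le> total ?Ws"
      using total_insert_edge[OF _ c touch] total_foldr_insert_edge[OF f(3) Suc.prems(6)] f by auto
    have "valid r (l @ R1 @ [f])"
      using valid_take[OF Suc.prems(4), of "length l + Suc (length R1)"] R by simp
    then have "s \<le> total (foldr insert_edge (l @ R1) (insert_edge f ?Ws))"
      using Suc.hyps(2) reach_Suc[OF Suc.prems(1,2) small Suc.prems(3) u(1)] f R compat_insert_edge[OF _ c, of f]
        covers_insert_edge[OF touch] t Suc.prems card_T_pos[OF f(1)]
      by (intro Suc.hyps(1)[of "Suc i" u f]) auto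
    then show ?thesis using R by simp
  qed
qed

section \<open>Correctness of the answers\<close>

lemma no_later_resampling:
  assumes "quiet r v l" "set (l @ R) \<subseteq> {..<m}" "valid r (l @ R)" "length (l @ R) \<le> h" "\<not> bad r h s v"
  shows "hits (l @ R) v = hits l v"
proof (rule ccontr)
  assume "\<not> ?thesis"
  then have "\<exists>f\<in>set R. v \<in> T f" by (auto simp: hits_def filter_empty_conv)
  then obtain R1 f R2 where R: "R = R1 @ f # R2" "v \<in> T f" by (meson split_list)
  have f: "f < m" using assms R by auto
  have val: "valid r (l @ R1 @ [f])"
    using valid_take[OF assms(3), of "length l + Suc (length R1)"] R by simp
  have "s \<le> total (foldr insert_edge (l @ R1) [{f}])"
    using assms R f val reach_0 card_T_pos[OF f] compat_singleton[of f v]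
    by (intro chain[of r v l 0 v f]) auto
  then have "bad r h s v"
    using assms R f val by (intro badI[of r "l @ R1" f]) auto
  with assms show False by simp
qed

lemma extends:
  assumes good: "\<And>u. u < n \<Longrightarrow> \<not> bad r h X u" "\<And>v. v \<in> set us \<Longrightarrow> \<not> bad r h s v" and h: "n * X \<le> h"
    and "valid r l" "set l \<subseteq> {..<m}"
  shows "\<exists>F. valid r (l @ F) \<and> set (l @ F) \<subseteq> {..<m} \<and> (\<forall>j<m. \<not> mono_at r (hits (l @ F)) (T j)) \<and>
    replies r us l = map (\<lambda>v. owner v \<noteq> None \<and> r (v, hits (l @ F) v)) us"
  using assms(4,5,2)
proof (induction us arbitrary: l)
  case Nil
  let ?P = "\<lambda>F. valid r (l @ F) \<and> set (l @ F) \<subseteq> {..<m}"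
  \<comment> \<open>The final phase as a maximality argument: lengths of valid logs are bounded, so
    a longest valid extension exists. A violated edge could be appended to it, hence there is
    none.\<close>
  have "\<exists>F. ?P F \<and> (\<forall>F'. ?P F' \<longrightarrow> length F' \<le> length F)"
    by (rule Lattices_Big.ex_has_greatest_nat[of ?P "[]" length "n * X"])
      (use Nil length_valid[OF good(1) h X_pos] in \<open>fastforce+\<close>)
  then obtain F where F: "?P F" "\<And>F'. ?P F' \<Longrightarrow> length F' \<le> length F" by blast
  have "\<not> mono_at r (hits (l @ F)) (T j)" if "j < m" for j
  proof
    assume "mono_at r (hits (l @ F)) (T j)"
    then have "?P (F @ [j])" using F(1) that valid_snoc[of r "l @ F" j] by simp
    from F(2)[OF this] show False by simp
  qed
  with F(1) show ?case by (intro exI[of _ F]) (simp del: hits_simps)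
next
  case (Cons v us)
  let ?l = "iter_log r v Z l"
  obtain x where x: "?l = l @ x" using iter_log_prefix by blast
  have v: "valid r ?l" "set ?l \<subseteq> {..<m}" using Cons valid_iter_log set_iter_log by auto
  have us: "\<And>w. w \<in> set us \<Longrightarrow> \<not> bad r h s w" using Cons.prems(3) by simp
  have "\<exists>F. valid r (?l @ F) \<and> set (?l @ F) \<subseteq> {..<m} \<and> (\<forall>j<m. \<not> mono_at r (hits (?l @ F)) (T j)) \<and>
      replies r us ?l = map (\<lambda>v. owner v \<noteq> None \<and> r (v, hits (?l @ F) v)) us"
    by (rule Cons.IH[OF v]) (use us in blast)
  then obtain F where F: "valid r (?l @ F)" "set (?l @ F) \<subseteq> {..<m}" "\<forall>j<m. \<not> mono_at r (hits (?l @ F)) (T j)"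
      "replies r us ?l = map (\<lambda>v. owner v \<noteq> None \<and> r (v, hits (?l @ F) v)) us"
    by blast
  have "length (?l @ F) \<le> h"
    using length_valid[OF good(1) h X_pos F(1,2)] h by simp
  then have "hits (?l @ F) v = hits ?l v"
    using Cons.prems F iter_log_Z_quiet[OF good(1) h Cons.prems(1,2)] by (intro no_later_resampling) auto
  with F x show ?case by (intro exI[of _ "x @ F"]) (auto simp del: hits_simps)
qed

theorem table_good:
  assumes "\<And>u. u < n \<Longrightarrow> \<not> bad r h X u" "\<And>v. v \<in> set vs \<Longrightarrow> \<not> bad r h s v" "n * X \<le> h"
  shows "\<exists>f. (\<forall>j<m. \<not> monochromatic f (T j)) \<and>
    fst (run_table r (queries vs (\<lambda>_. None, [])) (\<lambda>_. 0)) = map f vs"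
proof -
  have "inv r (\<lambda>_. 0) (\<lambda>_. None, [])" by (simp add: inv_def)
  then have run: "fst (run_table r (queries vs (\<lambda>_. None, [])) (\<lambda>_. 0)) = replies r vs []"
    by (rule run_queries)
  obtain F where F: "\<forall>j<m. \<not> mono_at r (hits F) (T j)"
      "replies r vs [] = map (\<lambda>v. owner v \<noteq> None \<and> r (v, hits F v)) vs"
    using extends[OF assms, of vs "[]"] by auto
  \<comment> \<open>The final coloring, overridden by the default \<open>False\<close> at queried
    vertices without a slot. By \<open>queried_owned\<close> these lie in no
    \<open>T j\<close>.\<close>
  let ?f = "\<lambda>u. (u \<in> set vs \<longrightarrow> owner u \<noteq> None) \<and> r (u, hits F u)"
  have "\<not> monochromatic ?f (T j)" if "j < m" for j
  proof -
    have "?f u = r (u, hits F u)" if "u \<in> T j" for u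
      using queried_owned[OF \<open>j < m\<close> that] by auto
    then have "monochromatic ?f (T j) = mono_at r (hits F) (T j)"
      by (simp add: monochromatic_def mono_at_def)
    then show ?thesis using F(1) that by simp
  qed
  moreover have "replies r vs [] = map ?f vs" using F(2) by auto
  ultimately show ?thesis using run by (intro exI[of _ ?f]) simp
qed

end

section \<open>Implementation on the word RAM\<close>

text \<open>
  A memory cell has one digit in base 4 for each position in its edge: 0 stands for a vertex without color,
  and \<open>2 + b\<close> for the color \<open>b\<close>.
\<close>

definition digit :: "nat \<Rightarrow> nat \<Rightarrow> nat" where
  "digit x p = x div 4 ^ p mod 4"

lemma div_mod_4:
  fixes z a :: nat
  shows "z mod 4 = 0 \<Longrightarrow> a < 4 \<Longrightarrow> (z + a) div 4 = z div 4"
    and "z mod 4 = 0 \<Longrightarrow> a < 4 \<Longrightarrow> (z + a) mod 4 = a"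
    and "(z - z mod 4) mod 4 = 0"
    apply (simp add: div_add1_eq)
   apply (metis add_0 mod_add_left_eq mod_less)
  apply (simp add: minus_mod_eq_mult_div)
  done

text \<open>Adding to a zero digit produces no carry. This is why storing a color can be an addition
  and erasing it a subtraction of the old digit, without disturbing other digits of the
  cell.\<close>

lemma div_pow_add:
  assumes "digit x p = 0" "a < 4" "p < q"
  shows "(x + a * 4 ^ p) div 4 ^ q = x div 4 ^ q"
proof -
  have "(x + a * 4 ^ p) div 4 ^ p = x div 4 ^ p + a" by simp
  then have "(x + a * 4 ^ p) div 4 ^ p div 4 = x div 4 ^ p div 4"
    using div_mod_4(1)[of "x div 4 ^ p" a] assms(1,2) by (simp add: digit_def)
  moreover have q: "4 ^ q = (4 ^ p * 4 * 4 ^ (q - Suc p) :: nat)"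
    using assms(3) power_add[of "4 :: nat" "Suc p" "q - Suc p"] by simp
  have "y div 4 ^ q = y div 4 ^ p div 4 div 4 ^ (q - Suc p)" for y :: nat
    unfolding q by (simp only: div_mult2_eq)
  ultimately show ?thesis by simp
qed

lemma digit_add:
  assumes "digit x p = 0" "a < 4"
  shows "digit (x + a * 4 ^ p) q = (if q = p then a else digit x q)"
proof -
  consider "q < p" | "q = p" | "p < q" by linarith
  then show ?thesis
  proof cases
    case 1
    then have "4 ^ p = (4 ^ q * (4 * 4 ^ (p - Suc q)) :: nat)"
      by (simp flip: power_Suc power_add)
    then have "x + a * 4 ^ p = x + 4 ^ q * (4 * (a * 4 ^ (p - Suc q)))"
      by simp
    then have "(x + a * 4 ^ p) div 4 ^ q = x div 4 ^ q + 4 * (a * 4 ^ (p - Suc q))"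
      by (simp only: div_mult_self2 power_not_zero zero_neq_numeral not_False_eq_True add.commute)
    then show ?thesis using 1 by (simp add: digit_def)
  next
    case 2
    have "(x + a * 4 ^ p) div 4 ^ p = x div 4 ^ p + a" by simp
    then have "digit (x + a * 4 ^ p) p = a"
      using div_mod_4(2)[of "x div 4 ^ p" a] assms unfolding digit_def by metis
    with 2 show ?thesis by simp
  next
    case 3
    with assms show ?thesis by (simp add: digit_def div_pow_add)
  qed
qed

lemma digit_add_less:
  assumes "digit x p = 0" "a < 4" "p < L" "x < 4 ^ L"
  shows "x + a * 4 ^ p < 4 ^ L"
proof -
  have "(x + a * 4 ^ p) div 4 ^ L = 0"
    using div_pow_add[OF assms(1-3)] assms(4) by simp
  then show ?thesis by (metis div_greater_zero_iff neq0_conv not_less zero_less_numeral zero_less_power less_irrefl)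
qed

lemma digit_mult_le: "digit x p * 4 ^ p \<le> x"
proof -
  have "digit x p \<le> x div 4 ^ p" by (simp add: digit_def)
  then show ?thesis
    by (meson div_times_less_eq_dividend le_trans mult_le_mono1)
qed

lemma digit_sub: "digit (x - digit x p * 4 ^ p) q = (if q = p then 0 else digit x q)"
proof -
  let ?y = "x - digit x p * 4 ^ p"
  have "?y div 4 ^ p = x div 4 ^ p - digit x p"
    using div_mult_self4[of "4 ^ p" "digit x p" ?y] digit_mult_le[of x p]
    by (metis add_diff_cancel_left' le_add_diff_inverse mult.commute power_not_zero zero_neq_numeral)
  then have "digit ?y p = 0"
    using div_mod_4(3)[of "x div 4 ^ p"] by (simp only: digit_def)
  moreover have "digit x p < 4" by (simp add: digit_def)
  ultimately show ?thesis
    using digit_add[of ?y p "digit x p" q] digit_mult_le[of x p] by (auto split: if_splits)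
qed

section \<open>The program\<close>

primrec seqs :: "com list \<Rightarrow> com" where
  "seqs [] = Skip"
| "seqs (c # cs) = Seq c (seqs cs)"

abbreviation copy :: "nat \<Rightarrow> nat \<Rightarrow> com" where
  "copy a b \<equiv> Arith Add a b 8"

text \<open>
  Register 8 is never written, so it holds 0; registers 1 to 7 hold \<open>1\<close>, \<open>2\<close>, \<open>4\<close>, \<open>L\<close>, \<open>d * L\<close>, \<open>X\<close>, \<open>X * L\<close>.
  The vertex whose color is accessed is in register 30, and the edge to be fixed in register 20.
\<close>

definition LOCATE :: com where
  "LOCATE = seqs
    [copy 31 7, Set_Const 32 0,
     While 31 (seqs
       [Arith Sub 31 31 1, Arith Div 35 31 4, Arith Mod 36 31 4,
        Input Incident_Edge 35 30 35, Input Edge_Vertex 37 35 36,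
        Arith Sub 38 37 30, Arith Sub 39 30 37, Arith Add 38 38 39,
        Cond 38 Skip (seqs [Set_Const 32 1, copy 33 35, copy 34 36])])]"

text \<open>Besides the digit in register 40, the power of 4 in register 38 and the cell in register
  39 are left for the caller to modify and write back.\<close>

definition DIGIT :: com where
  "DIGIT = seqs
    [copy 38 1, While 34 (seqs [Arith Sub 34 34 1, Arith Mul 38 38 3]),
     Load 39 33, Arith Div 40 39 38, Arith Mod 40 40 3]"

definition GET :: com where
  "GET = seqs
    [LOCATE,
     Cond 32
       (seqs [DIGIT,
            Cond 40 Skip
              (seqs [Flip 40, Arith Add 40 40 2, Arith Mul 36 40 38, Arith Add 39 39 36, Store 33 39]),
            Arith Sub 41 40 2])
       (Set_Const 41 0)]"

definition CLEAR :: com where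
  "CLEAR = seqs
    [LOCATE,
     Cond 32 (seqs [DIGIT, Arith Mul 36 40 38, Arith Sub 39 39 36, Store 33 39]) Skip]"

text \<open>The machine has no comparisons. A cut-off difference is nonzero exactly when the first
  number is larger, which detects large edges here; \<open>LOCATE\<close> tests equality by the sum
  of both cut-off differences.\<close>

definition FIX :: com where
  "FIX = seqs
    [Input Edge_Size 21 20 8, Arith Sub 24 21 4,
     Cond 24 Skip (seqs
       [copy 22 21, Set_Const 23 0,
        While 22 (seqs [Arith Sub 22 22 1, Input Edge_Vertex 30 20 22, GET, Arith Add 23 23 41]),
        Arith Sub 24 21 23, Arith Mul 24 24 23,
        Cond 24 Skip (seqs
          [copy 22 21, While 22 (seqs [Arith Sub 22 22 1, Input Edge_Vertex 30 20 22, CLEAR])])])]"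

definition WALK :: com where
  "WALK = seqs
    [copy 12 0, copy 13 8,
     While 11 (seqs
       [Arith Mod 14 11 5, Arith Div 11 11 5, Arith Div 15 14 4, Arith Mod 14 14 4,
        Input Incident_Edge 13 12 15, Input Edge_Vertex 12 13 14])]"

definition ITERS :: com where
  "ITERS = While 10 (seqs [Arith Sub 10 10 1, Arith Mod 11 10 6, WALK, copy 20 13, FIX])"

text \<open>Registers are cleared between queries, so each query computes the parameters anew: the
  length of \<open>n\<close> by halving and \<open>X\<close> by doubling, about log n steps
  each.\<close>

definition SETUP :: "nat \<Rightarrow> nat \<Rightarrow> com" where
  "SETUP K D' = seqs
    [Set_Const 1 1, Set_Const 2 2, Set_Const 3 4,
     Input Num_Vertices 9 8 8, Set_Const 10 0,
     While 9 (seqs [Arith Div 9 9 2, Arith Add 10 10 1]),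
     Arith Mul 4 10 3, Set_Const 5 D', Arith Mul 5 5 4, Arith Mul 5 5 4,
     Set_Const 11 K, Arith Div 11 10 11, Set_Const 6 1,
     While 11 (seqs [Arith Sub 11 11 1, Arith Mul 6 6 2]),
     Arith Mul 7 6 4, Arith Mul 10 6 6, Arith Mul 10 10 6]"

text \<open>Without edges the local memory is empty, and a junk read could still locate a slot and
  address a cell, so that there would be no execution. This case is answered by register 0 as it
  is.\<close>

definition PROG :: "nat \<Rightarrow> nat \<Rightarrow> com" where
  "PROG K D' = seqs
    [Input Num_Edges 9 8 8,
     Cond 9 (seqs [SETUP K D', ITERS, copy 30 0, GET, copy 0 41]) Skip]"

section \<open>Total correctness with step counts\<close>

locale ram =
  fixes n :: nat and es :: "nat list list" and w S :: nat
begin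

definition W :: nat where "W = 2 ^ w"

text \<open>A weakest precondition whose postcondition sees the number of steps: termination, time
  and result are proved together. The equivalences \<open>runs_simps\<close> turn it into symbolic
  execution by rewriting.\<close>

definition runs :: "com \<Rightarrow> state \<Rightarrow> (nat \<Rightarrow> state \<Rightarrow> bool) \<Rightarrow> bool" where
  "runs c s Q \<longleftrightarrow> (\<exists>t s'. exec n es w S c s t s' \<and> Q t s')"

inductive_cases exec_SkipE: "exec n es w S Skip s t s'"
inductive_cases exec_SetE: "exec n es w S (Set_Const d k) s t s'"
inductive_cases exec_ArithE: "exec n es w S (Arith g d a b) s t s'"
inductive_cases exec_InputE: "exec n es w S (Input q d a b) s t s'"
inductive_cases exec_LoadE: "exec n es w S (Load d a) s t s'"
inductive_cases exec_StoreE: "exec n es w S (Store a b) s t s'"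
inductive_cases exec_FlipE: "exec n es w S (Flip d) s t s'"
inductive_cases exec_SeqE: "exec n es w S (Seq c1 c2) s t s'"
inductive_cases exec_CondE: "exec n es w S (Cond a c1 c2) s t s'"

lemma exec_Cond_iff:
  "exec n es w S (Cond a c1 c2) s t s' \<longleftrightarrow>
    (\<exists>t'. t = Suc t' \<and> exec n es w S (if fst s a \<noteq> 0 then c1 else c2) s t' s')"
proof
  assume "exec n es w S (Cond a c1 c2) s t s'"
  then show "\<exists>t'. t = Suc t' \<and> exec n es w S (if fst s a \<noteq> 0 then c1 else c2) s t' s'"
    by (rule exec_CondE) auto
next
  assume "\<exists>t'. t = Suc t' \<and> exec n es w S (if fst s a \<noteq> 0 then c1 else c2) s t' s'"
  then show "exec n es w S (Cond a c1 c2) s t s'"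
    by (auto intro: exec.Cond_True exec.Cond_False split: if_splits)
qed

lemma runs_simps:
  "runs Skip s Q \<longleftrightarrow> Q 1 s"
  "runs (Set_Const d k) (\<rho>, \<mu>, \<omega>) Q \<longleftrightarrow> Q 1 (\<rho>(d := k mod W), \<mu>, \<omega>)"
  "runs (Arith g d a b) (\<rho>, \<mu>, \<omega>) Q \<longleftrightarrow> Q 1 (\<rho>(d := arith_op g (\<rho> a) (\<rho> b) mod W), \<mu>, \<omega>)"
  "runs (Input q d a b) (\<rho>, \<mu>, \<omega>) Q \<longleftrightarrow> Q 1 (\<rho>(d := read_input n es q (\<rho> a) (\<rho> b) mod W), \<mu>, \<omega>)"
  "runs (Load d a) (\<rho>, \<mu>, \<omega>) Q \<longleftrightarrow> \<rho> a < S \<and> Q 1 (\<rho>(d := \<mu> (\<rho> a)), \<mu>, \<omega>)"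
  "runs (Store a b) (\<rho>, \<mu>, \<omega>) Q \<longleftrightarrow> \<rho> a < S \<and> Q 1 (\<rho>, \<mu>(\<rho> a := \<rho> b), \<omega>)"
  "runs (Flip d) (\<rho>, \<mu>, \<omega>) Q \<longleftrightarrow> Q 1 (\<rho>(d := of_bool (shd \<omega>)), \<mu>, stl \<omega>)"
  "runs (Seq c1 c2) s Q \<longleftrightarrow> runs c1 s (\<lambda>t1 s1. runs c2 s1 (\<lambda>t2. Q (t1 + t2)))"
  "runs (Cond a c1 c2) s Q \<longleftrightarrow> runs (if fst s a \<noteq> 0 then c1 else c2) s (\<lambda>t. Q (Suc t))"
  unfolding runs_def W_def
  subgoal by (metis exec.Skip exec_SkipE)
  subgoal by (metis exec.Set_Const exec_SetE prod.inject)
  subgoal by (metis exec.Arith exec_ArithE prod.inject)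
  subgoal by (metis exec.Input exec_InputE prod.inject)
  subgoal by (metis exec.Load exec_LoadE prod.inject)
  subgoal by (metis exec.Store exec_StoreE prod.inject)
  subgoal by (metis exec.Flip exec_FlipE prod.inject)
  subgoal by (metis exec.Seq exec_SeqE)
  subgoal unfolding exec_Cond_iff by blast
  done

lemma runs_While:
  assumes "I s"
    and body: "\<And>\<rho> \<mu> \<omega>. I (\<rho>, \<mu>, \<omega>) \<Longrightarrow> \<rho> a \<noteq> 0 \<Longrightarrow>
      runs c (\<rho>, \<mu>, \<omega>) (\<lambda>t s'. t \<le> K \<and> I s' \<and> M s' < M (\<rho>, \<mu>, \<omega>))"
    and post: "\<And>t \<rho> \<mu> \<omega>. t \<le> M s * (K + 1) + 1 \<Longrightarrow> I (\<rho>, \<mu>, \<omega>) \<Longrightarrow> \<rho> a = 0 \<Longrightarrow> Q t (\<rho>, \<mu>, \<omega>)"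
  shows "runs (While a c) s Q"
proof -
  have "\<exists>t s'. exec n es w S (While a c) s t s' \<and> t \<le> M s * (K + 1) + 1 \<and> I s' \<and> fst s' a = 0"
    using assms(1)
  proof (induction "M s" arbitrary: s rule: less_induct)
    case less
    show ?case
    proof (cases "fst s a = 0")
      case True
      then show ?thesis using less.prems exec.While_False[of s a] by fastforce
    next
      case False
      obtain t1 s1 where 1: "exec n es w S c s t1 s1" "t1 \<le> K" "I s1" "M s1 < M s"
        using body[of "fst s" "fst (snd s)" "snd (snd s)"] less.prems False by (auto simp: runs_def)
      obtain t2 s2 where 2: "exec n es w S (While a c) s1 t2 s2" "t2 \<le> M s1 * (K + 1) + 1" "I s2" "fst s2 a = 0"
        using less.hyps[OF 1(4,3)] by blast
      have "exec n es w S (While a c) s (Suc (t1 + t2)) s2"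
        using exec.While_True False 1 2 by blast
      moreover have "Suc (t1 + t2) \<le> (M s1 + 1) * (K + 1) + 1"
        using 1 2 by simp
      moreover have "(M s1 + 1) * (K + 1) \<le> M s * (K + 1)"
        using 1(4) by (intro mult_le_mono1) simp
      ultimately have "Suc (t1 + t2) \<le> M s * (K + 1) + 1" by linarith
      with \<open>exec n es w S (While a c) s _ s2\<close> 2(3,4) show ?thesis by blast
    qed
  qed
  then obtain t \<rho> \<mu> \<omega> where t: "exec n es w S (While a c) s t (\<rho>, \<mu>, \<omega>)" "t \<le> M s * (K + 1) + 1"
      "I (\<rho>, \<mu>, \<omega>)" "\<rho> a = 0"
    by (metis prod_cases3 fst_conv)
  then have "Q t (\<rho>, \<mu>, \<omega>)"
    by (intro post)
  with t(1) show ?thesis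
    unfolding runs_def by blast
qed

end

text \<open>The generic rule for \<open>Input\<close> is omitted, so that \<open>runs_input\<close>
  applies, where the reduction modulo \<open>W\<close> has disappeared.\<close>

lemmas (in ram) runs_step = runs_simps(1-3,5-9)

section \<open>The program follows the decision tree\<close>

locale lca_ram = lca n es L X d Z + ram n es w "length es" for n es L X d Z w +
  assumes nonempty: "es \<noteq> []"
    and entries: "j < length es \<Longrightarrow> set (es ! j) \<subseteq> {..<n}"
    and sizes: "j < length es \<Longrightarrow> length (es ! j) \<le> n"
    and small: "n < W" "length es < W" "X * L < W" "d * L < W" "4 ^ L \<le> W" "Z < W"
      "4 < W"
    and pos: "1 \<le> X" "2 \<le> L" "1 \<le> d"
begin

lemma mod_word:
  fixes x y :: nat
  shows "x < W \<Longrightarrow> (x - y) mod W = x - y" "x < W \<Longrightarrow> (x div y) mod W = x div y"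
    "x < W \<Longrightarrow> (x mod y) mod W = x mod y"
  by (auto intro!: mod_less le_less_trans[OF div_le_dividend] le_less_trans[OF mod_less_eq_dividend])

lemma vertex_small: "vertex j p < W"
proof -
  have "vertex j p \<le> n"
    using entries[of j] nth_mem[of p "es ! j"] by (auto simp: vertex_def subset_iff less_imp_le)
  then show ?thesis using small by linarith
qed

lemma incident_small: "incident u a < W"
  using incident_less[OF nonempty, of u a] small by linarith

lemma size_of_small: "size_of j < W" "size_of j \<le> n"
proof -
  show "size_of j \<le> n" using sizes[of j] by (auto simp: size_of_def)
  then show "size_of j < W" using small by linarith
qed

lemma runs_input:
  "runs (Input Incident_Edge d' a b) (\<rho>, \<mu>, \<omega>) Q \<longleftrightarrow> Q 1 (\<rho>(d' := incident (\<rho> a) (\<rho> b)), \<mu>, \<omega>)"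
  "runs (Input Edge_Vertex d' a b) (\<rho>, \<mu>, \<omega>) Q \<longleftrightarrow> Q 1 (\<rho>(d' := vertex (\<rho> a) (\<rho> b)), \<mu>, \<omega>)"
  "runs (Input Edge_Size d' a b) (\<rho>, \<mu>, \<omega>) Q \<longleftrightarrow> Q 1 (\<rho>(d' := size_of (\<rho> a)), \<mu>, \<omega>)"
  using incident_small vertex_small size_of_small
  by (simp_all only: runs_simps flip: incident_def vertex_def) (simp_all add: size_of_def)

definition params :: "(nat \<Rightarrow> nat) \<Rightarrow> bool" where
  "params \<rho> \<longleftrightarrow> \<rho> 1 = 1 \<and> \<rho> 2 = 2 \<and> \<rho> 3 = 4 \<and> \<rho> 4 = L \<and> \<rho> 5 = d * L \<and> \<rho> 6 = X \<and> \<rho> 7 = X * L \<and> \<rho> 8 = 0"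

fun enc :: "bool option \<Rightarrow> nat" where
  "enc None = 0"
| "enc (Some b) = of_bool b + 2"

definition mem :: "(nat \<Rightarrow> nat) \<Rightarrow> (nat \<Rightarrow> bool option) \<Rightarrow> bool" where
  "mem \<mu> col \<longleftrightarrow> (\<forall>j. \<mu> j < 4 ^ L) \<and> (\<forall>u j p. owner u = Some (j, p) \<longrightarrow> digit (\<mu> j) p = enc (col u))"

lemma L_small: "L < W" "X < W" "W > (1::nat)"
proof -
  have "1 * L \<le> X * L" "X * 1 \<le> X * L" using pos by (auto intro: mult_le_mono1 mult_le_mono2)
  then show "L < W" "X < W" using small by linarith+
  show "W > (1::nat)" using small by linarith
qed

lemma params_cong: "(\<And>r. r < 9 \<Longrightarrow> \<rho>' r = \<rho> r) \<Longrightarrow> params \<rho>' = params \<rho>"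
  by (simp add: params_def)

lemma runs_LOCATE:
  assumes "params \<rho>" "\<rho> 30 < W"
    and Q: "\<And>t \<rho>'. t \<le> 20 * (X * L) + 10 \<Longrightarrow> (\<forall>r<31. \<rho>' r = \<rho> r) \<Longrightarrow>
      (case owner (\<rho> 30) of None \<Rightarrow> \<rho>' 32 = 0 | Some (j, p) \<Rightarrow> \<rho>' 32 = 1 \<and> \<rho>' 33 = j \<and> \<rho>' 34 = p) \<Longrightarrow>
      Q t (\<rho>', \<mu>, \<omega>)"
  shows "runs LOCATE (\<rho>, \<mu>, \<omega>) Q"
proof -
  let ?acc = "\<lambda>\<rho>'. if \<rho>' 32 = 0 then None else Some (\<rho>' 33, \<rho>' 34)"
  let ?I = "\<lambda>(\<rho>', \<mu>', \<omega>'). \<mu>' = \<mu> \<and> \<omega>' = \<omega> \<and> (\<forall>r<31. \<rho>' r = \<rho> r) \<and> \<rho>' 31 \<le> X * L \<and> \<rho>' 32 \<le> 1 \<and>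
      find_slot (\<rho> 30) (\<rho>' 31) (?acc \<rho>') = owner (\<rho> 30)"
  note p = assms(1)[unfolded params_def, simplified]
  have W: "1 mod W = 1" "0 mod W = 0" "(X * L) mod W = X * L" using small L_small by auto
  show ?thesis
    unfolding LOCATE_def seqs.simps
    apply (simp only: runs_simps arith_op.simps fun_upd_apply)
    apply (rule runs_While[where I = ?I and K = 17 and M = "\<lambda>s. fst s 31"])
    subgoal
      using p small by (auto simp: owner_def)
    subgoal premises prems for \<rho>' \<mu>' \<omega>'
    proof -
      have r: "\<rho>' 1 = 1" "\<rho>' 4 = L" "\<rho>' 8 = 0" "\<rho>' 30 = \<rho> 30" and low: "\<And>r. r < 31 \<Longrightarrow> \<rho>' r = \<rho> r"
        and i: "\<mu>' = \<mu>" "\<omega>' = \<omega>" "\<rho>' 31 \<le> X * L" "\<rho>' 32 \<le> 1" "find_slot (\<rho> 30) (\<rho>' 31) (?acc \<rho>') = owner (\<rho> 30)"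
        using prems(1) p by auto
      obtain z where z: "\<rho>' 31 = Suc z" using prems(2) not0_implies_Suc by blast
      have zw: "z < W" using i(3) z small by linarith
      let ?j = "incident (\<rho> 30) (z div L)" and ?p = "z mod L"
      let ?D = "vertex ?j ?p - \<rho> 30 + (\<rho> 30 - vertex ?j ?p)"
      have D: "?D < W" using vertex_small[of ?j ?p] assms(2) by linarith
      have small': "?j < W" "?p < W" "z div L < W"
        using incident_small zw by (auto intro: le_less_trans[OF div_le_dividend] le_less_trans[OF mod_less_eq_dividend])
      show ?thesis
        using zw D small' vertex_small[of ?j ?p] assms(2) i low
        by (cases "vertex ?j ?p = \<rho> 30") (auto simp: runs_step runs_input r z mod_word W simp del: One_nat_def)
    qed
    subgoal premises prems for t \<rho>' \<mu>' \<omega>'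
    proof -
      have "t \<le> X * L * 18 + 1" using prems(1) p W by simp
      moreover have "owner (\<rho> 30) = ?acc \<rho>'" using prems(2,3) by simp
      ultimately show ?thesis
        using prems(2) by (cases "\<rho>' 32 = 0") (auto intro!: Q split: option.splits)
    qed
    done
qed

lemma runs_DIGIT:
  assumes "params \<rho>" "\<rho> 33 < length es" "\<rho> 34 < L" "\<mu> (\<rho> 33) < 4 ^ L"
    and Q: "\<And>t \<rho>'. t \<le> 4 * L + 10 \<Longrightarrow> (\<forall>r<34. \<rho>' r = \<rho> r) \<Longrightarrow> \<rho>' 38 = 4 ^ \<rho> 34 \<Longrightarrow>
      \<rho>' 39 = \<mu> (\<rho> 33) \<Longrightarrow> \<rho>' 40 = digit (\<mu> (\<rho> 33)) (\<rho> 34) \<Longrightarrow> Q t (\<rho>', \<mu>, \<omega>)"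
  shows "runs DIGIT (\<rho>, \<mu>, \<omega>) Q"
proof -
  let ?I = "\<lambda>(\<rho>', \<mu>', \<omega>'). \<mu>' = \<mu> \<and> \<omega>' = \<omega> \<and> (\<forall>r<34. \<rho>' r = \<rho> r) \<and> \<rho>' 34 \<le> \<rho> 34 \<and>
      \<rho>' 38 * 4 ^ \<rho>' 34 = 4 ^ \<rho> 34"
  note p = assms(1)[unfolded params_def, simplified]
  have W1: "1 mod W = 1" using L_small by simp
  have pw: "4 ^ \<rho> 34 < W"
    using power_strict_increasing[OF assms(3), of "4 :: nat"] small by linarith
  have \<mu>w: "\<mu> (\<rho> 33) < W" using assms small by linarith
  show ?thesis
    unfolding DIGIT_def seqs.simps
    apply (simp only: runs_simps arith_op.simps fun_upd_apply)
    apply (rule runs_While[where I = ?I and K = 3 and M = "\<lambda>s. fst s 34"])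
    subgoal
      using p W1 by simp
    subgoal premises prems for \<rho>' \<mu>' \<omega>'
    proof -
      have r: "\<rho>' 1 = 1" "\<rho>' 3 = 4" and low: "\<And>r. r < 34 \<Longrightarrow> \<rho>' r = \<rho> r"
        and i: "\<mu>' = \<mu>" "\<omega>' = \<omega>" "\<rho>' 34 \<le> \<rho> 34" "\<rho>' 38 * 4 ^ \<rho>' 34 = 4 ^ \<rho> 34"
        using prems(1) p by auto
      obtain z where z: "\<rho>' 34 = Suc z" using prems(2) not0_implies_Suc by blast
      have "z < W" using i(3) z assms(3) L_small by linarith
      moreover have e: "\<rho>' 38 * 4 * 4 ^ z = 4 ^ \<rho> 34" using i(4) z by simp
      moreover have "\<rho>' 38 * 4 < W"
        using mult_le_mono2[of 1 "4 ^ z" "\<rho>' 38 * 4"] e pw by simp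
      ultimately show ?thesis
        using i low p by (simp add: runs_simps r z mod_word)
    qed
    subgoal premises prems for t \<rho>' \<mu>' \<omega>'
    proof -
      have low: "\<And>r. r < 34 \<Longrightarrow> \<rho>' r = \<rho> r" and i: "\<mu>' = \<mu>" "\<omega>' = \<omega>" "\<rho>' 38 = 4 ^ \<rho> 34"
        using prems(2,3) by auto
      have "t \<le> 4 * L + 1" using prems(1) assms(3) by simp
      moreover have dw: "x mod 4 mod W = x mod 4" for x
        using small(7) less_trans[of "x mod 4" 4 W] by simp
      ultimately show ?thesis
        using low i assms \<mu>w p dw by (simp add: runs_simps mod_word Q digit_def)
    qed
    done
qed

lemma memD: "mem \<mu> col \<Longrightarrow> \<mu> j < 4 ^ L" "mem \<mu> col \<Longrightarrow> owner u = Some (j, p) \<Longrightarrow> digit (\<mu> j) p = enc (col u)"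
  by (auto simp: mem_def)

lemma owner_slot: "owner u = Some (j, p) \<Longrightarrow> j < length es \<and> p < L \<and> vertex j p = u"
proof -
  assume o': "owner u = Some (j, p)"
  obtain a where "j = incident u a" using owner_SomeD(2)[OF o'] by blast
  then show ?thesis using owner_SomeD(1,3)[OF o'] incident_less[OF nonempty, of u a] pos by simp
qed

lemma mem_update:
  assumes "mem \<mu> col" "owner u = Some (j, p)" "x < 4 ^ L" "\<And>q. digit x q = (if q = p then enc y else digit (\<mu> j) q)"
  shows "mem (\<mu>(j := x)) (col(u := y))"
  unfolding mem_def
proof (intro conjI allI impI)
  show "(\<mu>(j := x)) k < 4 ^ L" for k using assms memD by auto
  fix u' k q assume o': "owner u' = Some (k, q)"
  show "digit ((\<mu>(j := x)) k) q = enc ((col(u := y)) u')"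
  proof (cases "k = j \<and> q = p")
    case True
    then have "u' = u" using owner_slot[OF o'] owner_slot[OF assms(2)] by simp
    with True show ?thesis by (simp add: assms(4))
  next
    case False
    then have "u' \<noteq> u" using o' assms(2) by auto
    with False show ?thesis using memD(2)[OF assms(1) o'] by (auto simp: assms(4))
  qed
qed

abbreviation "TG \<equiv> 30 * (X * L) + 50"

lemma XL_ge: "L \<le> X * L"
  using pos mult_le_mono1[of 1 X L] by simp

lemma runs_GET:
  assumes "params \<rho>" "\<rho> 30 < W" "mem \<mu> col"
    and Q: "\<And>t \<rho>' \<mu>' \<omega>' b col'. t \<le> TG \<Longrightarrow> (\<forall>r<31. \<rho>' r = \<rho> r) \<Longrightarrow>
      run_stream (get_color (\<rho> 30) col) \<omega> = ((b, col'), \<omega>') \<Longrightarrow> mem \<mu>' col' \<Longrightarrow> \<rho>' 41 = of_bool b \<Longrightarrow>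
      Q t (\<rho>', \<mu>', \<omega>')"
  shows "runs GET (\<rho>, \<mu>, \<omega>) Q"
  unfolding GET_def seqs.simps
  apply (simp only: runs_simps)
  apply (rule runs_LOCATE[OF assms(1,2)])
  subgoal premises prems for t \<rho>'
  proof (cases "owner (\<rho> 30)")
    case None
    then show ?thesis
      using prems assms by (simp add: runs_simps) (rule Q, auto simp: get_color_def)
  next
    case (Some o')
    then obtain j p where o': "owner (\<rho> 30) = Some (j, p)" by (metis surj_pair)
    note slot = owner_slot[OF o']
    have r: "\<rho>' 32 = 1" "\<rho>' 33 = j" "\<rho>' 34 = p" using prems(3) o' by auto
    have low: "\<And>r. r < 31 \<Longrightarrow> \<rho>' r = \<rho> r" using prems(2) by simp
    then have par: "params \<rho>'" using params_cong[of \<rho>' \<rho>] assms(1) by simp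
    note \<mu>j = memD[OF assms(3), of j] memD(2)[OF assms(3) o']
    have runD: "runs DIGIT (\<rho>', \<mu>, \<omega>) Q'" if "\<And>t \<rho>''. t \<le> 4 * L + 10 \<Longrightarrow> (\<forall>r<34. \<rho>'' r = \<rho>' r) \<Longrightarrow>
        \<rho>'' 38 = 4 ^ p \<Longrightarrow> \<rho>'' 39 = \<mu> j \<Longrightarrow> \<rho>'' 40 = enc (col (\<rho> 30)) \<Longrightarrow> Q' t (\<rho>'', \<mu>, \<omega>)" for Q'
      by (rule runs_DIGIT[OF par]) (use that r slot \<mu>j in auto)
    show ?thesis
      apply (simp only: r fst_conv one_neq_zero not_False_eq_True if_True runs_simps)
      apply (rule runD)
      subgoal premises prems' for t' \<rho>''
      proof -
        have low'': "\<And>r. r < 31 \<Longrightarrow> \<rho>'' r = \<rho> r" "\<rho>'' 33 = j" "\<rho>'' 2 = 2" "\<rho>' 2 = 2"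
          using prems'(2) low r assms(1) by (simp_all add: params_def)
        have tb: "t + t' + 20 \<le> TG" using prems(1) prems'(1) XL_ge by linarith
        show ?thesis
        proof (cases "col (\<rho> 30)")
          case (Some b)
          have "3 mod W = 3" "2 mod W = 2" "1 mod W = 1" using small by simp_all
          with Some o' prems prems' low'' assms tb show ?thesis
            by (cases b) (simp_all add: runs_simps get_color_def Q)
        next
          case None
          define fl :: nat where "fl = of_bool (shd \<omega>)"
          let ?x = "\<mu> j + (fl + 2) * 4 ^ p"
          have fl: "of_bool (shd \<omega>) = fl" "fl \<le> 1" by (auto simp: fl_def)
          have d0: "digit (\<mu> j) p = 0" using \<mu>j None by simp
          have x: "?x < 4 ^ L" using slot \<mu>j fl by (intro digit_add_less[OF d0]) auto
          have xw: "?x < W" "(fl + 2) * 4 ^ p < W" "fl + 2 < W" "fl < W" using x small fl by linarith+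
          have m: "mem (\<mu>(j := ?x)) (col(\<rho> 30 := Some (shd \<omega>)))"
          proof (rule mem_update[OF assms(3) o' x])
            show "digit ?x q = (if q = p then enc (Some (shd \<omega>)) else digit (\<mu> j) q)" for q
              using digit_add[OF d0, of "fl + 2" q] fl by auto
          qed
          have g: "run_stream (get_color (\<rho> 30) col) \<omega> = ((shd \<omega>, col(\<rho> 30 := Some (shd \<omega>))), stl \<omega>)"
            using None o' by (simp add: get_color_def)
          show ?thesis
            using None prems(1) prems' low'' low slot xw m tb
            by (simp add: runs_simps fl) (rule Q[OF _ _ g], auto simp: fl)
        qed
      qed
      done
  qed
  done

abbreviation uncolor :: "nat \<Rightarrow> (nat \<Rightarrow> bool option) \<Rightarrow> nat \<Rightarrow> bool option" where
  "uncolor u col \<equiv> if owner u = None then col else col(u := None)"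

lemma runs_CLEAR:
  assumes "params \<rho>" "\<rho> 30 < W" "mem \<mu> col"
    and Q: "\<And>t \<rho>' \<mu>'. t \<le> TG \<Longrightarrow> (\<forall>r<31. \<rho>' r = \<rho> r) \<Longrightarrow> mem \<mu>' (uncolor (\<rho> 30) col) \<Longrightarrow> Q t (\<rho>', \<mu>', \<omega>)"
  shows "runs CLEAR (\<rho>, \<mu>, \<omega>) Q"
  unfolding CLEAR_def seqs.simps
  apply (simp only: runs_simps)
  apply (rule runs_LOCATE[OF assms(1,2)])
  subgoal premises prems for t \<rho>'
  proof (cases "owner (\<rho> 30)")
    case None
    then show ?thesis
      using prems assms by (simp add: runs_simps Q)
  next
    case (Some o')
    then obtain j p where o': "owner (\<rho> 30) = Some (j, p)" by (metis surj_pair)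
    note slot = owner_slot[OF o']
    have r: "\<rho>' 32 = 1" "\<rho>' 33 = j" "\<rho>' 34 = p" using prems(3) o' by auto
    have low: "\<And>r. r < 31 \<Longrightarrow> \<rho>' r = \<rho> r" using prems(2) by simp
    then have par: "params \<rho>'" using params_cong[of \<rho>' \<rho>] assms(1) by simp
    note \<mu>j = memD[OF assms(3), of j] memD(2)[OF assms(3) o']
    let ?x = "\<mu> j - digit (\<mu> j) p * 4 ^ p"
    have x: "?x < 4 ^ L" "digit (\<mu> j) p * 4 ^ p < W" "\<mu> j < W"
      using \<mu>j(1) digit_mult_le[of "\<mu> j" p] small by linarith+
    have m: "mem (\<mu>(j := ?x)) (col(\<rho> 30 := None))"
      by (rule mem_update[OF assms(3) o' x(1)]) (simp add: digit_sub)
    show ?thesis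
      apply (simp only: r fst_conv one_neq_zero not_False_eq_True if_True runs_simps)
      apply (rule runs_DIGIT[OF par])
      subgoal using r slot by simp
      subgoal using r slot by simp
      subgoal using r \<mu>j by simp
      subgoal premises prems' for t' \<rho>''
      proof -
        have "\<And>r. r < 31 \<Longrightarrow> \<rho>'' r = \<rho> r" "\<rho>'' 33 = j"
          using prems'(2) low r by simp_all
        moreover have "t + t' + 20 \<le> TG" using prems(1) prems'(1) XL_ge by linarith
        ultimately show ?thesis
          using prems(1) prems' x m o' slot r by (simp add: runs_simps mod_word Q)
      qed
      done
  qed
  done

abbreviation "TF \<equiv> (2 * L + 2) * (TG + 10) + 20"

lemma runs_FIX:
  assumes "params \<rho>" "\<rho> 20 < length es" "mem \<mu> col"
    and Q: "\<And>t \<rho>' \<mu>' \<omega>' col' l'. t \<le> TF \<Longrightarrow> (\<forall>r<20. \<rho>' r = \<rho> r) \<Longrightarrow>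
      run_stream (fix_edge (\<rho> 20) (col, l)) \<omega> = ((col', l'), \<omega>') \<Longrightarrow> mem \<mu>' col' \<Longrightarrow> Q t (\<rho>', \<mu>', \<omega>')"
  shows "runs FIX (\<rho>, \<mu>, \<omega>) Q"
proof -
  let ?j = "\<rho> 20"
  note p = assms(1)[unfolded params_def, simplified]
  have W: "0 mod W = 0" using small by simp
  \<comment> \<open>The rest of the tree on the rest of the tape must give the same result as the
    whole on the whole tape. This avoids describing the tape position. The bound on the sum of
    registers 22 and 23 prevents an overflow of the count.\<close>
  let ?I1 = "\<lambda>(\<rho>', \<mu>', \<omega>'). (\<forall>r<22. \<rho>' r = (\<rho>(21 := size_of ?j)) r) \<and> \<rho>' 22 + \<rho>' 23 \<le> size_of ?j \<and>
    (\<exists>col'. mem \<mu>' col' \<and> run_stream (count_true ?j (\<rho>' 22) (\<rho>' 23) col') \<omega>' = run_stream (count_true ?j (size_of ?j) 0 col) \<omega>)"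
  have clear: "runs (While 22 (Seq (Arith Sub 22 22 (Suc 0)) (Seq (Input Edge_Vertex 30 20 22) (Seq CLEAR Skip)))) (\<rho>1, \<mu>1, \<omega>1) Q1"
    if "\<forall>r<22. \<rho>1 r = (\<rho>(21 := size_of ?j)) r" "\<rho>1 22 = size_of ?j" "mem \<mu>1 col1" "size_of ?j \<le> L"
      and Q1: "\<And>t \<rho>' \<mu>'. t \<le> L * (TG + 5) + 1 \<Longrightarrow> (\<forall>r<20. \<rho>' r = \<rho> r) \<Longrightarrow> mem \<mu>' (clear_colors ?j (size_of ?j) col1) \<Longrightarrow>
        Q1 t (\<rho>', \<mu>', \<omega>1)"
    for \<rho>1 \<mu>1 \<omega>1 col1 Q1
    apply (rule runs_While[where K = "TG + 4" and M = "\<lambda>s. fst s 22" and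
        I = "\<lambda>(\<rho>', \<mu>', \<omega>'). (\<forall>r<22. \<rho>' r = (\<rho>(21 := size_of ?j)) r) \<and> \<rho>' 22 \<le> size_of ?j \<and> \<omega>' = \<omega>1 \<and>
          (\<exists>col'. mem \<mu>' col' \<and> clear_colors ?j (\<rho>' 22) col' = clear_colors ?j (size_of ?j) col1)"])
    subgoal using that by auto
    subgoal premises prems for \<rho>' \<mu>' \<omega>'
    proof -
      obtain i where i: "\<rho>' 22 = Suc i" using prems(2) not0_implies_Suc by blast
      have low: "\<And>r. r < 21 \<Longrightarrow> \<rho>' r = \<rho> r" and i': "\<rho>' 22 \<le> size_of ?j" "\<omega>' = \<omega>1" "\<rho>' 21 = size_of ?j"
        using prems(1) by auto
      obtain col' where col': "mem \<mu>' col'" "clear_colors ?j (Suc i) col' = clear_colors ?j (size_of ?j) col1" using prems(1) i by auto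
      have iw: "i < W" using i i' size_of_small(1)[of ?j] by linarith
      have r1: "\<rho>' (Suc 0) = 1" using low p by simp
      have par: "params (\<rho>'(22 := i, 30 := vertex ?j i))"
        using params_cong[of "\<rho>'(22 := i, 30 := vertex ?j i)" \<rho>] low assms(1) by simp
      show ?thesis
        apply (simp add: runs_step runs_input mod_word iw r1 low i)
        apply (rule runs_CLEAR[OF par _ col'(1)])
        subgoal using vertex_small by simp
        subgoal premises pr for t2 \<rho>2 \<mu>2
        proof -
          have "mem \<mu>2 (uncolor (vertex ?j i) col')" using pr(3) by (cases "owner (vertex ?j i)") simp_all
          then show ?thesis
            using pr(1,2) i i' col'(2) low by (auto intro!: exI[of _ "uncolor (vertex ?j i) col'"])
        qed
        done
    qed
    subgoal premises prems for t \<rho>' \<mu>' \<omega>'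
    proof (goal_cases)
      case 1
      have "t \<le> size_of ?j * (TG + 5) + 1" using prems(1) that(2) by simp
      also have "\<dots> \<le> L * (TG + 5) + 1" using that(4) by (intro add_mono mult_le_mono1) auto
      finally have "t \<le> L * (TG + 5) + 1" .
      then show ?case using prems(2,3) Q1 by auto
    qed
    done
  show ?thesis
  proof (cases "size_of ?j \<le> L")
    case False
    then show ?thesis
      unfolding FIX_def seqs.simps using p size_of_small(1)[of ?j] assms(3)
      by (simp add: runs_step runs_input mod_word) (rule Q, auto simp: fix_edge_def)
  next
    case True
    show ?thesis
      unfolding FIX_def seqs.simps
      apply (simp add: runs_step runs_input mod_word p size_of_small(1)[of ?j] True W)
      apply (rule runs_While[where I = ?I1 and K = "TG + 5" and M = "\<lambda>s. fst s 22"])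
      subgoal using assms(3) by auto
      subgoal premises prems for \<rho>' \<mu>' \<omega>'
      proof -
        obtain i where i: "\<rho>' 22 = Suc i" using prems(2) not0_implies_Suc by blast
        have low: "\<And>r. r < 21 \<Longrightarrow> \<rho>' r = \<rho> r" and i': "\<rho>' 22 + \<rho>' 23 \<le> size_of ?j" "\<rho>' 21 = size_of ?j"
          using prems(1) by auto
        obtain col' where col': "mem \<mu>' col'"
            "run_stream (count_true ?j (Suc i) (\<rho>' 23) col') \<omega>' = run_stream (count_true ?j (size_of ?j) 0 col) \<omega>"
          using prems(1) i by auto
        have iw: "i < W" "Suc (\<rho>' 23) < W" using i i' size_of_small(1)[of ?j] by linarith+
        have r1: "\<rho>' (Suc 0) = 1" using low p by simp
        have par: "params (\<rho>'(22 := i, 30 := vertex ?j i))"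
          using params_cong[of "\<rho>'(22 := i, 30 := vertex ?j i)" \<rho>] low assms(1) by simp
        show ?thesis
          apply (simp add: runs_step runs_input mod_word iw r1 low i)
          apply (rule runs_GET[OF par _ col'(1)])
          subgoal using vertex_small by simp
          subgoal premises pr for t2 \<rho>2 \<mu>2 \<omega>2 b col2
          proof -
            have "run_stream (count_true ?j i (\<rho>' 23 + of_bool b) col2) \<omega>2 = run_stream (count_true ?j (size_of ?j) 0 col) \<omega>"
              using col'(2) pr by (simp add: run_stream_tbind)
            moreover have "\<rho>2 22 = i" "\<rho>2 23 = \<rho>' 23" "\<rho>2 41 = of_bool b" "\<And>r. r < 21 \<Longrightarrow> \<rho>2 r = \<rho> r" "\<rho>2 21 = size_of ?j"
              using pr low i' by auto
            moreover have "(\<rho>' 23 + of_bool b) mod W = \<rho>' 23 + of_bool b" using iw by simp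
            moreover have "r < 22 \<longleftrightarrow> r < 21 \<or> r = 21" for r :: nat by auto
            ultimately show ?thesis
              using i i' pr(1,4) by (auto simp: runs_simps intro!: exI[of _ col2])
          qed
          done
      qed
      subgoal premises prems for t \<rho>' \<mu>' \<omega>'
      proof -
        have low: "\<And>r. r < 20 \<Longrightarrow> \<rho>' r = \<rho> r" and i': "\<rho>' 23 \<le> size_of ?j" "\<rho>' 21 = size_of ?j" "\<rho>' 20 = ?j"
          and low': "\<forall>r<22. \<rho>' r = (\<rho>(21 := size_of ?j)) r"
          using prems(2) by auto
        obtain col' where col': "mem \<mu>' col'" "run_stream (count_true ?j (size_of ?j) 0 col) \<omega> = ((\<rho>' 23, col'), \<omega>')"
          using prems(2,3) by auto
        let ?s = "\<rho>' 23"
        have "t \<le> size_of ?j * (TG + 6) + 1" using prems(1) by simp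
        also have "\<dots> \<le> L * (TG + 6) + 1" using True by (intro add_mono mult_le_mono1) auto
        finally have t: "t \<le> L * (TG + 6) + 1" .
        have fe: "run_stream (fix_edge ?j (col, l)) \<omega> =
            (if (size_of ?j - ?s) * ?s = 0 then (clear_colors ?j (size_of ?j) col', l @ [?j]) else (col', l), \<omega>')"
          by (simp only: fix_edge_def True if_True fst_conv snd_conv run_stream_tbind col'(2) prod.case run_stream.simps)
        have "(size_of ?j - ?s) * ?s \<le> L * L" using True i' by (intro mult_le_mono) auto
        moreover have "L * L < 4 ^ L"
        proof -
          have "L < 2 ^ L" by simp
          then have "L * L < 2 ^ L * 2 ^ L" by (intro mult_strict_mono) auto
          then show ?thesis by (simp flip: power_mult_distrib)
        qed
        ultimately have prod: "(size_of ?j - ?s) * ?s < W" using small by linarith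
        have r8: "\<rho>' 8 = 0" using low p by simp
        have tb: "t + L * (TG + 5) + 20 \<le> TF" using t by (simp add: algebra_simps)
        show ?thesis
        proof (cases "(size_of ?j - ?s) * ?s = 0")
          case False
          then show ?thesis
            using prod i' size_of_small(1)[of ?j] tb low col' fe
            by (simp add: runs_simps mod_word) (rule Q, auto)
        next
          case zero: True
          then have zero': "(\<rho>' 23 < size_of ?j \<and> 0 < \<rho>' 23) = False" by auto
          show ?thesis
            apply (simp add: runs_simps mod_word zero' prod i' size_of_small(1)[of ?j] r8 W)
            apply (intro conjI impI)
            subgoal by (rule clear[OF _ _ col'(1) True]) (use low' fe zero tb in \<open>auto intro!: Q\<close>)
            subgoal by (rule clear[OF _ _ col'(1) True]) (use low' fe zero tb in \<open>auto intro!: Q\<close>)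
            done
        qed
      qed
      done
  qed
qed

lemma walk_0: "walk u j 0 = (u, j)"
  by (subst walk.simps) simp

lemma dL_gt: "1 < d * L"
  using pos mult_le_mono[of 1 d 2 L] by simp

lemma runs_WALK:
  assumes "params \<rho>" "\<rho> 0 < W" "\<rho> 11 < X"
    and Q: "\<And>t \<rho>'. t \<le> 8 * X + 10 \<Longrightarrow> (\<forall>r<11. \<rho>' r = \<rho> r) \<Longrightarrow> \<rho>' 13 = edge (\<rho> 0) (\<rho> 11) \<Longrightarrow> Q t (\<rho>', \<mu>, \<omega>)"
  shows "runs WALK (\<rho>, \<mu>, \<omega>) Q"
proof -
  note p = assms(1)[unfolded params_def, simplified]
  have W: "0 mod W = 0" "\<rho> 0 mod W = \<rho> 0" using small assms by auto
  show ?thesis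
    unfolding WALK_def seqs.simps
    apply (simp add: runs_step p W)
    apply (rule runs_While[where K = 7 and M = "\<lambda>s. fst s 11" and
        I = "\<lambda>(\<rho>', \<mu>', \<omega>'). \<mu>' = \<mu> \<and> \<omega>' = \<omega> \<and> (\<forall>r<11. \<rho>' r = \<rho> r) \<and> \<rho>' 11 < X \<and>
          walk (\<rho>' 12) (\<rho>' 13) (\<rho>' 11) = walk (\<rho> 0) 0 (\<rho> 11)"])
    subgoal using assms by simp
    subgoal premises prems for \<rho>' \<mu>' \<omega>'
    proof -
      have low: "\<And>r. r < 11 \<Longrightarrow> \<rho>' r = \<rho> r" and i: "\<mu>' = \<mu>" "\<omega>' = \<omega>" "\<rho>' 11 < X"
          "walk (\<rho>' 12) (\<rho>' 13) (\<rho>' 11) = walk (\<rho> 0) 0 (\<rho> 11)"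
        using prems(1) by auto
      have r: "\<rho>' 4 = L" "\<rho>' 5 = d * L" using low p by auto
      have yw: "\<rho>' 11 < W" "\<rho>' 11 mod (d * L) < W"
        using i L_small by (auto intro: le_less_trans[OF mod_less_eq_dividend] less_trans)
      have "\<rho>' 11 div (d * L) < \<rho>' 11" using prems(2) dL_gt by (intro div_less_dividend) auto
      moreover have "walk (\<rho>' 12) (\<rho>' 13) (\<rho>' 11) =
          walk (vertex (incident (\<rho>' 12) (\<rho>' 11 mod (d * L) div L)) (\<rho>' 11 mod (d * L) mod L))
             (incident (\<rho>' 12) (\<rho>' 11 mod (d * L) div L)) (\<rho>' 11 div (d * L))"
        using prems(2) dL_gt by (subst walk.simps) simp
      ultimately show ?thesis
        using low i r yw by (simp add: runs_step runs_input mod_word)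
    qed
    subgoal premises prems for t \<rho>' \<mu>' \<omega>'
    proof -
      have "t \<le> X * 8 + 1" using prems(1) assms(3) by simp
      moreover have "\<rho>' 13 = edge (\<rho> 0) (\<rho> 11)" "\<forall>r<11. \<rho>' r = \<rho> r" "\<mu>' = \<mu>" "\<omega>' = \<omega>"
        using prems(2,3) by (auto simp: walk_0 edge_def dest: arg_cong[of _ _ snd])
      ultimately show ?thesis by (auto intro!: Q)
    qed
    done
qed

abbreviation "TI \<equiv> TF + 8 * X + 20"

lemma runs_ITERS:
  assumes "params \<rho>" "\<rho> 0 < W" "\<rho> 10 \<le> Z" "mem \<mu> col"
    and Q: "\<And>t \<rho>' \<mu>' \<omega>' col' l'. t \<le> Z * (TI + 1) + 1 \<Longrightarrow> (\<forall>r<10. \<rho>' r = \<rho> r) \<Longrightarrow>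
      run_stream (iters (\<rho> 0) (\<rho> 10) (col, l)) \<omega> = ((col', l'), \<omega>') \<Longrightarrow> mem \<mu>' col' \<Longrightarrow> Q t (\<rho>', \<mu>', \<omega>')"
  shows "runs ITERS (\<rho>, \<mu>, \<omega>) Q"
proof -
  note p = assms(1)[unfolded params_def, simplified]
  show ?thesis
    unfolding ITERS_def seqs.simps
    apply (rule runs_While[where K = TI and M = "\<lambda>s. fst s 10" and
        I = "\<lambda>(\<rho>', \<mu>', \<omega>'). (\<forall>r<10. \<rho>' r = \<rho> r) \<and> \<rho>' 10 \<le> Z \<and>
          (\<exists>col' l'. mem \<mu>' col' \<and> run_stream (iters (\<rho> 0) (\<rho>' 10) (col', l')) \<omega>' =
            run_stream (iters (\<rho> 0) (\<rho> 10) (col, l)) \<omega>)"])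
    subgoal using assms by auto
    subgoal premises prems for \<rho>' \<mu>' \<omega>'
    proof -
      obtain k where k: "\<rho>' 10 = Suc k" using prems(2) not0_implies_Suc by blast
      have low: "\<And>r. r < 10 \<Longrightarrow> \<rho>' r = \<rho> r" and kZ: "Suc k \<le> Z" using prems(1) k by auto
      obtain col' l' where c: "mem \<mu>' col'"
          "run_stream (iters (\<rho> 0) (Suc k) (col', l')) \<omega>' = run_stream (iters (\<rho> 0) (\<rho> 10) (col, l)) \<omega>"
        using prems(1) k by auto
      have kw: "k < W" "k mod X < W" using kZ small by (auto intro: le_less_trans[OF mod_less_eq_dividend])
      have r: "\<rho>' (Suc 0) = 1" "\<rho>' 6 = X" "\<rho>' 8 = 0" "\<rho>' 0 = \<rho> 0" using low p by auto
      let ?\<rho> = "\<rho>'(10 := k, 11 := k mod X)"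
      have par: "params ?\<rho>" using params_cong[of ?\<rho> \<rho>] low assms(1) by simp
      show ?thesis
        apply (simp add: runs_step mod_word kw r k)
        apply (rule runs_WALK[OF par])
        subgoal using r assms by simp
        subgoal using pos by simp
        subgoal premises pr for t1 \<rho>1
        proof -
          let ?j = "edge (\<rho> 0) (k mod X)"
          have j: "\<rho>1 13 = ?j" "?j < length es" "?j < W"
            using pr(3) r edge_less[OF nonempty] small by (auto intro: less_trans)
          have low1: "\<And>r. r < 10 \<Longrightarrow> \<rho>1 r = \<rho> r" "\<rho>1 10 = k" using pr(2) low by auto
          let ?\<rho>1 = "\<rho>1(20 := ?j)"
          have par1: "params ?\<rho>1" using params_cong[of ?\<rho>1 \<rho>] low1 assms(1) by simp
          have r8: "\<rho>1 8 = 0" using low1 p by simp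
          show ?thesis
            apply (simp add: runs_step j r8)
            apply (rule runs_FIX[OF par1 _ c(1), where l = l'])
            subgoal using j by simp
            subgoal premises pf for t2 \<rho>2 \<mu>2 \<omega>2 col2 l2
            proof -
              have "run_stream (iters (\<rho> 0) k (col2, l2)) \<omega>2 = run_stream (iters (\<rho> 0) (\<rho> 10) (col, l)) \<omega>"
                using c(2) pf(3) by (simp add: run_stream_tbind)
              moreover have "\<And>r. r < 10 \<Longrightarrow> \<rho>2 r = \<rho> r" "\<rho>2 10 = k" using pf(2) low1 by auto
              ultimately show ?thesis
                using pf(1,4) pr(1) kZ k by auto
            qed
            done
        qed
        done
    qed
    subgoal premises prems for t \<rho>' \<mu>' \<omega>'
    proof -
      have "t \<le> \<rho> 10 * (TI + 1) + 1" using prems(1) by simp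
      also have "\<dots> \<le> Z * (TI + 1) + 1" using assms(3) by (intro add_mono mult_le_mono1) auto
      finally have "t \<le> Z * (TI + 1) + 1" .
      moreover obtain col' l' where c: "mem \<mu>' col'"
          "run_stream (iters (\<rho> 0) (\<rho>' 10) (col', l')) \<omega>' = run_stream (iters (\<rho> 0) (\<rho> 10) (col, l)) \<omega>"
        using prems(2) by auto
      moreover have "run_stream (iters (\<rho> 0) (\<rho> 10) (col, l)) \<omega> = ((col', l'), \<omega>')"
        using c(2) prems(3) by simp
      ultimately show ?thesis using prems(2) by (auto intro!: Q)
    qed
    done
qed

end

locale lca_prog = lca_ram n es L X d Z w for n es L X d Z w +
  fixes K D' :: nat
  assumes L_eq: "L = 4 * floorlog 2 n" and d_eq: "d = D' * L" and X_eq: "X = 2 ^ (floorlog 2 n div K)"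
    and Z_eq: "Z = X * X * X" and const_small: "K < 2 ^ w" "D' < 2 ^ w"
begin

lemma runs_SETUP:
  assumes "\<rho> 8 = 0"
    and Q: "\<And>t \<rho>'. t \<le> 10 * L + 40 \<Longrightarrow> params \<rho>' \<Longrightarrow> \<rho>' 0 = \<rho> 0 \<Longrightarrow> \<rho>' 10 = Z \<Longrightarrow> Q t (\<rho>', \<mu>, \<omega>)"
  shows "runs (SETUP K D') (\<rho>, \<mu>, \<omega>) Q"
proof -
  let ?l = "floorlog 2 n"
  have lw: "?l < W" "?l * 4 < W" using L_small L_eq by linarith+
  have cw: "0 mod W = 0" "Suc 0 mod W = Suc 0" "2 mod W = 2" "4 mod W = 4" "n mod W = n" "K mod W = K" "D' mod W = D'"
    "W \<noteq> Suc 0"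
    using small const_small[folded W_def] L_small by auto
  have dL: "D' * (?l * 4) * (?l * 4) < W" using small L_eq d_eq by (simp add: ac_simps)
  have dL': "D' * (?l * (?l * 16)) < W" using dL by (simp add: ac_simps)
  have D'L: "D' * (?l * 4) < W"
  proof -
    have "D' * (?l * 4) * 1 \<le> D' * (?l * 4) * (?l * 4)" using pos L_eq by (intro mult_le_mono2) auto
    then show ?thesis using dL by linarith
  qed
  let ?\<rho>0 = "\<rho>(Suc 0 := Suc 0, 2 := 2, 3 := 4)"
  show ?thesis
    unfolding SETUP_def seqs.simps
    apply (simp add: runs_simps assms cw)
    apply (rule runs_While[where K = 4 and M = "\<lambda>s. floorlog 2 (fst s 9)" and
        I = "\<lambda>(\<rho>', \<mu>', \<omega>'). \<mu>' = \<mu> \<and> \<omega>' = \<omega> \<and> (\<forall>r. r \<noteq> 9 \<longrightarrow> r \<noteq> 10 \<longrightarrow> \<rho>' r = ?\<rho>0 r) \<and>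
          floorlog 2 (\<rho>' 9) + \<rho>' 10 = ?l \<and> \<rho>' 9 \<le> n"])
    subgoal by simp
    subgoal premises prems for \<rho>' \<mu>' \<omega>'
    proof -
      have low: "\<rho>' 1 = 1" "\<rho>' (Suc 0) = 1" "\<rho>' 2 = 2" and i: "floorlog 2 (\<rho>' 9) + \<rho>' 10 = ?l" "\<rho>' 9 \<le> n"
        using prems(1) by auto
      have f: "floorlog 2 (\<rho>' 9) = floorlog 2 (\<rho>' 9 div 2) + 1"
        using prems(2) by (subst compute_floorlog) simp
      have "Suc (\<rho>' 10) < W" "\<rho>' 9 < W" using f i lw small by linarith+
      moreover have "\<rho>' 9 div 2 \<le> n" using i by simp
      ultimately show ?thesis
        using prems(1) f i by (simp add: runs_simps low mod_word)
    qed
    subgoal premises prems for t1 \<rho>1 \<mu>1 \<omega>1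
    proof -
      have low: "\<And>r. r \<noteq> 9 \<Longrightarrow> r \<noteq> 10 \<Longrightarrow> \<rho>1 r = ?\<rho>0 r" and e: "\<mu>1 = \<mu>" "\<omega>1 = \<omega>" and l: "\<rho>1 10 = ?l"
        using prems(2,3) by (auto simp: floorlog_def)
      let ?\<rho>1 = "\<rho>1(4 := L, 5 := d * L)"
      have t1: "t1 \<le> 5 * ?l + 1" using prems(1) by simp
      show ?thesis
        apply (simp add: runs_simps low l lw dL dL' D'L cw mod_word assms const_small e)
        apply (rule runs_While[where K = 4 and M = "\<lambda>s. fst s 11" and
            I = "\<lambda>(\<rho>', \<mu>', \<omega>'). \<mu>' = \<mu> \<and> \<omega>' = \<omega> \<and> (\<forall>r. r \<noteq> 6 \<longrightarrow> r \<noteq> 11 \<longrightarrow> \<rho>' r = ?\<rho>1 r) \<and>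
              \<rho>' 6 * 2 ^ \<rho>' 11 = X \<and> \<rho>' 11 \<le> ?l"])
        subgoal by (simp add: X_eq L_eq d_eq dL' ac_simps)
        subgoal premises prems' for \<rho>' \<mu>' \<omega>'
        proof -
          obtain y where y: "\<rho>' 11 = Suc y" using prems'(2) not0_implies_Suc by blast
          have low': "\<And>r. r \<noteq> 6 \<Longrightarrow> r \<noteq> 11 \<Longrightarrow> \<rho>' r = ?\<rho>1 r" and i: "\<mu>' = \<mu>" "\<omega>' = \<omega>" "\<rho>' 6 * 2 ^ Suc y = X" "Suc y \<le> ?l"
            using prems'(1) y by auto
          have "y < W" using i lw by linarith
          moreover have m: "\<rho>' 6 * 2 * 2 ^ y = X" using i(3) by simp
          moreover have "\<rho>' 6 * 2 < W"
            using mult_le_mono2[of 1 "2 ^ y" "\<rho>' 6 * 2"] m L_small by simp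
          ultimately show ?thesis
            using i low' low by (simp add: runs_simps y mod_word)
        qed
        subgoal premises prems' for t2 \<rho>2 \<mu>2 \<omega>2
        proof -
          have low': "\<And>r. r \<noteq> 6 \<Longrightarrow> r \<noteq> 11 \<Longrightarrow> \<rho>2 r = ?\<rho>1 r" and X: "\<rho>2 6 = X" and e': "\<mu>2 = \<mu>" "\<omega>2 = \<omega>"
            using prems'(2,3) by auto
          have "?l div K * 5 \<le> ?l * 5" by (intro mult_le_mono1) simp
          moreover have "t2 \<le> ?l div K * 5 + 1" using prems'(1) by simp
          ultimately have t: "t1 + t2 + 30 \<le> 10 * L + 40"
            using t1 L_eq by linarith
          have "X * X * 1 \<le> X * X * X" using pos by (intro mult_le_mono2)
          then have XX: "X * X < W" "X * X * X < W" "X * L < W"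
            using small(3,6) Z_eq by linarith+
          show ?thesis
            unfolding e'
            by (simp add: runs_simps low low' X assms XX) (rule Q; use t in \<open>simp add: params_def low low' X assms Z_eq\<close>)
        qed
        done
    qed
    done
qed

abbreviation "TP \<equiv> Z * (TI + 1) + TG + 10 * L + 80"

lemma runs_PROG:
  assumes "v < n" "mem \<mu> col"
    and Q: "\<And>t \<rho>' \<mu>' \<omega>' b col' l'. t \<le> TP \<Longrightarrow> run_stream (query v (col, l)) \<omega> = ((b, (col', l')), \<omega>') \<Longrightarrow>
      mem \<mu>' col' \<Longrightarrow> \<rho>' 0 = of_bool b \<Longrightarrow> Q t (\<rho>', \<mu>', \<omega>')"
  shows "runs (PROG K D') ((\<lambda>_. 0)(0 := v), \<mu>, \<omega>) Q"
proof -
  have m: "length es mod W = length es" "length es \<noteq> 0" using small nonempty by auto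
  have vw: "v < W" using assms(1) small by linarith
  show ?thesis
    unfolding PROG_def seqs.simps
    apply (simp add: runs_simps m nonempty)
    apply (rule runs_SETUP)
    subgoal by simp
    subgoal premises pr for t1 \<rho>1
      apply (rule runs_ITERS[OF pr(2) _ _ assms(2), where l = l])
      subgoal using pr vw by simp
      subgoal using pr by simp
      subgoal premises pi for t2 \<rho>2 \<mu>2 \<omega>2 col2 l2
      proof -
        have low: "\<And>r. r < 10 \<Longrightarrow> \<rho>2 r = \<rho>1 r" using pi(2) by simp
        have r: "\<rho>2 0 = v" "\<rho>2 8 = 0" using low pr by (auto simp: params_def)
        have par: "params (\<rho>2(30 := v))" using params_cong[of "\<rho>2(30 := v)" \<rho>1] low pr(2) by simp
        show ?thesis
          apply (simp add: runs_simps r vw)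
          apply (rule runs_GET[OF par _ pi(4)])
          subgoal using vw by simp
          subgoal premises pg for t3 \<rho>3 \<mu>3 \<omega>3 b col3
          proof -
            have r8: "\<rho>3 8 = 0" using pg(2) r by simp
            have q: "run_stream (query v (col, l)) \<omega> = ((b, (col3, l2)), \<omega>3)"
              using pi(3) pg(3) pr(3,4) by (simp add: query_def run_stream_tbind)
            have "1 mod W = 1" "0 mod W = 0" using small by simp_all
            moreover have "t1 + t2 + t3 + 10 \<le> TP" using pr(1) pi(1) pg(1) by linarith
            ultimately show ?thesis
              using r8 pg(5) by (cases b) (simp_all add: runs_simps Q[OF _ q pg(4)])
          qed
          done
      qed
      done
    done
qed

text \<open>The log is a ghost: the program stores none, so the simulation holds for any
  \<open>l\<close>.\<close>

lemma answers_queries: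
  assumes "set vs \<subseteq> {..<n}" "mem \<mu> col" "real TP \<le> T"
  shows "answers n es w (length es) T (PROG K D') \<mu> \<omega> vs (fst (run_stream (queries vs (col, l)) \<omega>))"
  using assms(1,2)
proof (induction vs arbitrary: \<mu> \<omega> col l)
  case Nil
  then show ?case by (simp add: answers.Nil)
next
  case (Cons v vs)
  have "runs (PROG K D') ((\<lambda>_. 0)(0 := v), \<mu>, \<omega>) (\<lambda>t s'. \<exists>\<rho>' \<mu>' \<omega>' b col' l'. s' = (\<rho>', \<mu>', \<omega>') \<and> t \<le> TP \<and>
      run_stream (query v (col, l)) \<omega> = ((b, (col', l')), \<omega>') \<and> mem \<mu>' col' \<and> \<rho>' 0 = of_bool b)"
    by (rule runs_PROG[where l = l]) (use Cons.prems in auto)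
  then obtain t \<rho>' \<mu>' \<omega>' b col' l' where
      e: "exec n es w (length es) (PROG K D') ((\<lambda>_. 0)(0 := v), \<mu>, \<omega>) t (\<rho>', \<mu>', \<omega>')" "t \<le> TP"
      "run_stream (query v (col, l)) \<omega> = ((b, (col', l')), \<omega>')" "mem \<mu>' col'" "\<rho>' 0 = of_bool b"
    unfolding runs_def by blast
  have "real t \<le> T" using e(2) assms(3) of_nat_le_iff[of t TP, where ?'a = real] by linarith
  moreover have "answers n es w (length es) T (PROG K D') \<mu>' \<omega>' vs (fst (run_stream (queries vs (col', l')) \<omega>'))"
    by (rule Cons.IH) (use Cons.prems e in auto)
  ultimately have "answers n es w (length es) T (PROG K D') \<mu> \<omega> (v # vs)
      ((\<rho>' 0 \<noteq> 0) # fst (run_stream (queries vs (col', l')) \<omega>'))"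
    using e(1) by (intro answers.Cons)
  moreover have "fst (run_stream (queries (v # vs) (col, l)) \<omega>) = (\<rho>' 0 \<noteq> 0) # fst (run_stream (queries vs (col', l')) \<omega>')"
    by (simp add: run_stream_tbind e(3,5) split: prod.split)
  ultimately show ?case by simp
qed

lemma mem_init: "mem (\<lambda>_. 0) (\<lambda>_. None)"
  by (simp add: mem_def digit_def)

end

section \<open>Success probability\<close>

lemma splice_prefixes:
  assumes "\<exists>k. snd (snd s') = sdrop k (snd (snd s)) \<and>
      (\<forall>\<omega>. stake k \<omega> = stake k (snd (snd s)) \<longrightarrow> P (fst s, fst (snd s), \<omega>) (fst s', fst (snd s'), sdrop k \<omega>))"
    and "\<exists>k. snd (snd s'') = sdrop k (snd (snd s')) \<and>
      (\<forall>\<omega>. stake k \<omega> = stake k (snd (snd s')) \<longrightarrow> P' (fst s', fst (snd s'), \<omega>) (fst s'', fst (snd s''), sdrop k \<omega>))"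
    and R: "\<And>\<omega> \<omega>' \<omega>''. P (fst s, fst (snd s), \<omega>) (fst s', fst (snd s'), \<omega>') \<Longrightarrow>
      P' (fst s', fst (snd s'), \<omega>') (fst s'', fst (snd s''), \<omega>'') \<Longrightarrow>
      R (fst s, fst (snd s), \<omega>) (fst s'', fst (snd s''), \<omega>'')"
  shows "\<exists>k. snd (snd s'') = sdrop k (snd (snd s)) \<and>
      (\<forall>\<omega>. stake k \<omega> = stake k (snd (snd s)) \<longrightarrow> R (fst s, fst (snd s), \<omega>) (fst s'', fst (snd s''), sdrop k \<omega>))"
proof -
  obtain k where k: "snd (snd s') = sdrop k (snd (snd s))"
      "\<And>\<omega>. stake k \<omega> = stake k (snd (snd s)) \<Longrightarrow> P (fst s, fst (snd s), \<omega>) (fst s', fst (snd s'), sdrop k \<omega>)"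
    using assms(1) by blast
  obtain k' where k': "snd (snd s'') = sdrop k' (snd (snd s'))"
      "\<And>\<omega>. stake k' \<omega> = stake k' (snd (snd s')) \<Longrightarrow> P' (fst s', fst (snd s'), \<omega>) (fst s'', fst (snd s''), sdrop k' \<omega>)"
    using assms(2) by blast
  show ?thesis
  proof (rule exI[of _ "k + k'"], safe)
    show "snd (snd s'') = sdrop (k + k') (snd (snd s))" by (simp add: k k')
    fix \<omega> assume "stake (k + k') \<omega> = stake (k + k') (snd (snd s))"
    then have "stake k \<omega> = stake k (snd (snd s))" "stake k' (sdrop k \<omega>) = stake k' (snd (snd s'))"
      by (auto simp: k simp flip: stake_add)
    from R[OF k(2)[OF this(1)] k'(2)[OF this(2)]]
    show "R (fst s, fst (snd s), \<omega>) (fst s'', fst (snd s''), sdrop (k + k') \<omega>)" by simp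
  qed
qed

lemma exec_prefix:
  assumes "exec n es w S c s t s'"
  shows "\<exists>k. snd (snd s') = sdrop k (snd (snd s)) \<and>
    (\<forall>\<omega>. stake k \<omega> = stake k (snd (snd s)) \<longrightarrow>
      exec n es w S c (fst s, fst (snd s), \<omega>) t (fst s', fst (snd s'), sdrop k \<omega>))"
  using assms
proof (induction rule: exec.induct)
  case (Skip s)
  show ?case using exec.Skip[of n es w S] by (intro exI[of _ 0]) auto
next
  case (Set_Const d k \<rho> \<mu> \<omega>)
  show ?case
    by (rule exI[of _ 0], simp only: fst_conv snd_conv sdrop.simps, blast intro: exec.Set_Const)
next
  case (Arith g d a b \<rho> \<mu> \<omega>)
  show ?case
    by (rule exI[of _ 0], simp only: fst_conv snd_conv sdrop.simps, blast intro: exec.Arith)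
next
  case (Input q d a b \<rho> \<mu> \<omega>)
  show ?case
    by (rule exI[of _ 0], simp only: fst_conv snd_conv sdrop.simps, blast intro: exec.Input)
next
  case (Load \<rho> a d \<mu> \<omega>)
  then show ?case
    by (intro exI[of _ 0], simp only: fst_conv snd_conv sdrop.simps, blast intro: exec.Load)
next
  case (Store \<rho> a b \<mu> \<omega>)
  then show ?case
    by (intro exI[of _ 0], simp only: fst_conv snd_conv sdrop.simps, blast intro: exec.Store)
next
  case (Flip d \<rho> \<mu> \<omega>)
  show ?case
  proof (rule exI[of _ 1], safe)
    fix \<omega>' assume "stake 1 \<omega>' = stake 1 (snd (snd (\<rho>, \<mu>, \<omega>)))"
    then have "shd \<omega>' = shd \<omega>" by simp
    then show "exec n es w S (Flip d) (fst (\<rho>, \<mu>, \<omega>), fst (snd (\<rho>, \<mu>, \<omega>)), \<omega>') 1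
        (fst (\<rho>(d := of_bool (shd \<omega>)), \<mu>, stl \<omega>), fst (snd (\<rho>(d := of_bool (shd \<omega>)), \<mu>, stl \<omega>)), sdrop 1 \<omega>')"
      using exec.Flip[of n es w S d \<rho> \<mu> \<omega>'] by simp
  qed simp
next
  case (Seq c1 s t1 s' c2 t2 s'')
  show ?case by (rule splice_prefixes[OF Seq.IH]) (rule exec.Seq)
next
  case (Cond_True s a c1 t s' c2)
  then show ?case by (metis exec.Cond_True fst_conv)
next
  case (Cond_False s a c2 t s' c1)
  then show ?case by (metis exec.Cond_False fst_conv)
next
  case (While_True s a c t1 s' t2 s'')
  show ?case
    by (rule splice_prefixes[OF While_True.IH]) (rule exec.While_True, use While_True.hyps in simp_all)
next
  case (While_False s a c)
  have "exec n es w S (While a c) (fst s, fst (snd s), \<omega>) 1 (fst s, fst (snd s), \<omega>)" for \<omega>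
    by (rule exec.While_False) (use While_False in simp)
  then show ?case by (intro exI[of _ 0]) simp
qed

lemma answers_prefix:
  assumes "answers n es w S T P \<mu> \<omega> vs bs"
  shows "\<exists>k. \<forall>\<omega>'. stake k \<omega>' = stake k \<omega> \<longrightarrow> answers n es w S T P \<mu> \<omega>' vs bs"
  using assms
proof (induction rule: answers.induct)
  case (Nil \<mu> \<omega>)
  then show ?case by (auto intro: answers.Nil)
next
  case (Cons v \<mu> \<omega> t \<rho> \<mu>' \<omega>' vs bs)
  obtain k1 where k1: "\<omega>' = sdrop k1 \<omega>"
      "\<And>\<omega>2. stake k1 \<omega>2 = stake k1 \<omega> \<Longrightarrow> exec n es w S P ((\<lambda>_. 0)(0 := v), \<mu>, \<omega>2) t (\<rho>, \<mu>', sdrop k1 \<omega>2)"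
    using exec_prefix[OF Cons.hyps(1)] by auto
  obtain k2 where k2: "\<And>\<omega>2. stake k2 \<omega>2 = stake k2 \<omega>' \<Longrightarrow> answers n es w S T P \<mu>' \<omega>2 vs bs"
    using Cons.IH by blast
  show ?case
  proof (intro exI[of _ "k1 + k2"] allI impI)
    fix \<omega>2 assume "stake (k1 + k2) \<omega>2 = stake (k1 + k2) \<omega>"
    then have "stake k1 \<omega>2 = stake k1 \<omega>" "stake k2 (sdrop k1 \<omega>2) = stake k2 \<omega>'"
      by (auto simp: k1 simp flip: stake_add)
    from answers.Cons[OF k1(2)[OF this(1)] Cons.hyps(2) k2[OF this(2)]]
    show "answers n es w S T P \<mu> \<omega>2 (v # vs) ((\<rho> 0 \<noteq> 0) # bs)" .
  qed
qed

text \<open>Such a set is a countable union of cylinders. Measurability cannot be skipped: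
  \<open>measure\<close> is 0 on a set that is not measurable, and the success event quantifies over
  colorings and executions.\<close>

lemma prefix_set_measurable:
  assumes "\<And>\<omega>. \<omega> \<in> A \<Longrightarrow> \<exists>k. \<forall>\<omega>'. stake k \<omega>' = stake k \<omega> \<longrightarrow> \<omega>' \<in> A"
  shows "A \<in> sets random_tape"
proof -
  have sp: "space random_tape = UNIV"
    by (simp add: random_tape_def space_stream_space)
  have cyl: "{\<omega>. stake (length l) \<omega> = l} \<in> sets random_tape" for l :: "bool list"
  proof (induction l)
    case Nil
    then show ?case using sets.top[of random_tape] by (simp add: sp)
  next
    case (Cons b l)
    have m: "shd \<in> measurable random_tape (count_space UNIV)" "stl \<in> measurable random_tape random_tape"
      unfolding random_tape_def using measurable_shd[of "measure_pmf (bernoulli_pmf (1/2))"]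
      by (auto intro: measurable_stl)
    have "{\<omega>. stake (length (b # l)) \<omega> = b # l} =
        (shd -` {b} \<inter> space random_tape) \<inter> (stl -` {\<omega>. stake (length l) \<omega> = l} \<inter> space random_tape)"
      by (auto simp: sp)
    then show ?case
      using measurable_sets[OF m(1), of "{b}"] measurable_sets[OF m(2) Cons] by simp
  qed
  have "A = (\<Union>l\<in>{l. {\<omega>. stake (length l) \<omega> = l} \<subseteq> A}. {\<omega>. stake (length l) \<omega> = l})" (is "_ = ?R")
  proof
    show "A \<subseteq> ?R"
    proof
      fix \<omega> assume "\<omega> \<in> A"
      then obtain k where "\<forall>\<omega>'. stake k \<omega>' = stake k \<omega> \<longrightarrow> \<omega>' \<in> A" using assms by blast
      then show "\<omega> \<in> ?R" by (intro UN_I[of "stake k \<omega>"]) auto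
    qed
  qed auto
  moreover have "?R \<in> sets random_tape"
    by (rule sets.countable_UN') (use cyl in auto)
  ultimately show ?thesis by simp
qed

lemma good_tapes_measurable:
  "{\<omega>. \<exists>f. two_coloring E f \<and> answers n es w S T P \<mu> \<omega> vs (map f vs)} \<in> sets random_tape"
  by (rule prefix_set_measurable) (use answers_prefix in fastforce)

section \<open>The error bound\<close>

locale lca_all = lca_table n es L X d Z T vs s + lca_prog n es L X d Z w K D'
  for n es L X d Z T vs s w K D' +
  assumes weight: "\<And>u. (\<Sum>f\<in>{f\<in>{..<length es}. u \<in> T f}. 2 * (1/2) ^ card (T f) * (9/8) ^ card (T f) * (5/4) ^ card (T f)) \<le> (1/4 :: real)"
    and vs_less: "set vs \<subseteq> {..<n}"
begin

text \<open>There are two kinds of failure. A history of size \<open>s\<close> endangers an answer,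
  but only at a queried vertex; with polylogarithmically many queries a small \<open>s\<close>
  suffices. A history of size \<open>X\<close> could leave a ball unquiet or a log too long and is
  excluded at all \<open>n\<close> vertices.\<close>

lemma success:
  assumes "real TP \<le> t" and E: "E = set (map set es)"
  shows "1 - (length vs * ((5/4) / (9/8) ^ s) + n * ((5/4) / (9/8) ^ X)) \<le>
    measure random_tape {\<omega>. \<exists>f. two_coloring E f \<and>
      answers n es w (length es) t (PROG K D') (\<lambda>_. 0) \<omega> vs (map f vs)}"
    (is "1 - ?\<delta> \<le> measure _ ?good")
proof -
  \<comment> \<open>By \<open>length_valid\<close> with \<open>k = X\<close>, valid logs on the good
    event are shorter than this.\<close>
  let ?h = "n * X"
  let ?t = "queries vs (\<lambda>_. None, [])"
  \<comment> \<open>A finite table with all entries that the decision tree or a history of at most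
    \<open>?h\<close> levels can read.\<close>
  let ?A = "(labels ?t \<union> {..<n}) \<times> {..<max ?h (depth ?t)}"
  let ?P = "\<lambda>bs. \<exists>f. two_coloring E f \<and> bs = map f vs"
  let ?B = "(\<Union>v\<in>set vs. {r. bad r ?h s v}) \<union> (\<Union>u<n. {r. bad r ?h X u})"
  have finA: "finite ?A" using finite_labels by auto
  have "\<Union> (T ` {..<m}) \<subseteq> {..<n}" using T_less by auto
  then have A: "\<Union> (T ` {..<m}) \<times> {..<?h} \<subseteq> ?A" by auto
  have bad: "coin_prob ?A {r. bad r ?h s' v} \<le> (5/4) / (9/8) ^ s'" for s' v
    using prob_bad[OF finA A, of "9/8" "5/4" s' v] weight by simp
  have "coin_prob ?A ?B \<le>
      coin_prob ?A (\<Union>v\<in>set vs. {r. bad r ?h s v}) + coin_prob ?A (\<Union>u<n. {r. bad r ?h X u})"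
    by (rule measure_Un_le) auto
  also have "\<dots> \<le> (\<Sum>v\<in>set vs. (5/4) / (9/8) ^ s) + (\<Sum>u<n. (5/4) / (9/8) ^ X)"
    by (intro add_mono order_trans[OF measure_UNION_le] sum_mono bad) auto
  also have "\<dots> \<le> ?\<delta>"
    using card_length[of vs] by (simp add: divide_right_mono)
  finally have B: "coin_prob ?A ?B \<le> ?\<delta>" .
  have "1 - ?\<delta> \<le> 1 - coin_prob ?A ?B" using B by simp
  also have "\<dots> = coin_prob ?A (- ?B)"
    using measure_pmf.prob_compl[of ?B "coins ?A"] by (simp add: Compl_eq_Diff_UNIV)
  also have "\<dots> \<le> coin_prob ?A {r. ?P (fst (run_table r ?t (\<lambda>_. 0)))}"
  proof (rule measure_pmf.finite_measure_mono)
    show "- ?B \<subseteq> {r. ?P (fst (run_table r ?t (\<lambda>_. 0)))}"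
    proof
      fix r assume r: "r \<in> - ?B"
      have "\<exists>f. (\<forall>j<m. \<not> monochromatic f (T j)) \<and> fst (run_table r ?t (\<lambda>_. 0)) = map f vs"
        by (rule table_good[of r ?h]) (use r in auto)
      then obtain f where f: "\<forall>j<m. \<not> monochromatic f (T j)" "fst (run_table r ?t (\<lambda>_. 0)) = map f vs"
        by blast
      have "\<not> monochromatic f (set (es ! j))" if "j < m" for j
        using f(1) T_sub[OF that] that unfolding monochromatic_def by blast
      then have "two_coloring E f"
        unfolding two_coloring_def E by (auto simp: in_set_conv_nth)
      with f(2) show "r \<in> {r. ?P (fst (run_table r ?t (\<lambda>_. 0)))}" by blast
    qed
  qed simp
  also have "\<dots> = measure random_tape {\<omega>. ?P (fst (run_stream ?t \<omega>))}"
    using tprob_stream_table[OF finA, of ?t ?P] by auto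
  also have "\<dots> \<le> measure random_tape ?good"
  proof (rule finite_measure.finite_measure_mono)
    show "finite_measure random_tape"
      unfolding random_tape_def
      by (intro prob_space.finite_measure prob_space.prob_space_stream_space measure_pmf.prob_space_axioms)
    show "?good \<in> sets random_tape" by (rule good_tapes_measurable)
    show "{\<omega>. ?P (fst (run_stream ?t \<omega>))} \<subseteq> ?good"
    proof
      fix \<omega> assume "\<omega> \<in> {\<omega>. ?P (fst (run_stream ?t \<omega>))}"
      then show "\<omega> \<in> ?good"
        using answers_queries[OF vs_less mem_init assms(1), of \<omega> "[]"] by auto
    qed
  qed
  finally show ?thesis .
qed

end


section \<open>Bounds from the hypergraph class\<close>

lemma powr_half: "2 powr (- real i / 2) = (1 / sqrt 2) ^ i"
proof -
  have "2 powr (- real i / 2) = (2 powr (- 1/2)) powr real i"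
    by (simp add: powr_powr)
  also have "2 powr (- 1/2) = 1 / sqrt (2 :: real)"
    by (simp add: powr_minus_divide powr_half_sqrt)
  finally show ?thesis by (simp add: powr_realpow)
qed

locale sparse_hypergraph =
  fixes n :: nat and es :: "nat list list" and \<Delta> :: "nat \<Rightarrow> nat" and D' :: nat
  assumes distinct_es: "j < length es \<Longrightarrow> distinct (es ! j)"
    and es_sub: "j < length es \<Longrightarrow> set (es ! j) \<subseteq> {..<n}"
    and es_size: "j < length es \<Longrightarrow> 3 \<le> length (es ! j)"
    and degree: "u < n \<Longrightarrow> card {j\<in>{..<length es}. u \<in> set (es ! j) \<and> length (es ! j) = i} \<le> \<Delta> i"
    and Delta_le: "\<Delta> i \<le> D'"
    and Delta_sum: "(\<Sum>\<^sub>\<infinity>i\<in>{3..}. real (\<Delta> i) * 2 powr (- real i / 2)) \<le> 1 / (6 * sqrt 2)"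
begin

lemma card_incident:
  assumes "u < n"
  shows "card {j\<in>{..<length es}. u \<in> set (es ! j) \<and> length (es ! j) \<le> N} \<le> D' * N"
proof -
  have "{j\<in>{..<length es}. u \<in> set (es ! j) \<and> length (es ! j) \<le> N} \<subseteq>
      (\<Union>i\<in>{1..N}. {j\<in>{..<length es}. u \<in> set (es ! j) \<and> length (es ! j) = i})"
    using es_size by fastforce
  then have "card {j\<in>{..<length es}. u \<in> set (es ! j) \<and> length (es ! j) \<le> N} \<le>
      card (\<Union>i\<in>{1..N}. {j\<in>{..<length es}. u \<in> set (es ! j) \<and> length (es ! j) = i})"
    by (intro card_mono) auto
  also have "\<dots> \<le> (\<Sum>i\<in>{1..N}. card {j\<in>{..<length es}. u \<in> set (es ! j) \<and> length (es ! j) = i})"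
    by (intro card_UN_le) auto
  also have "\<dots> \<le> (\<Sum>i\<in>{1..N}. D')"
    by (intro sum_mono order_trans[OF degree[OF assms] Delta_le])
  finally show ?thesis by (simp add: mult.commute)
qed

text \<open>Here the order of the incidence lists matters: the edges listed up to \<open>j\<close>
  are no larger than \<open>j\<close>, and the bounds for the single sizes add up to at most
  \<open>D' * length (es ! j)\<close> of them.\<close>

lemma incident_index:
  assumes "j < length es" "u \<in> set (es ! j)"
  shows "\<exists>a<D' * length (es ! j). read_input n es Incident_Edge u a = j"
proof -
  let ?f = "\<lambda>j. length (es ! j)" and ?I = "incidence_list es u"
  have set_I: "set ?I = {j\<in>{..<length es}. u \<in> set (es ! j)}"
    by (auto simp: incidence_list_def)
  have dist: "distinct ?I" by (simp add: incidence_list_def)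
  obtain a where a: "a < length ?I" "?I ! a = j"
    using assms set_I by (metis (no_types, lifting) in_set_conv_nth lessThan_iff mem_Collect_eq)
  have "sorted (map ?f ?I)" by (simp add: incidence_list_def)
  then have le: "?f (?I ! b) \<le> ?f j" if "b \<le> a" for b
    using sorted_nth_mono[of "map ?f ?I" b a] that a by simp
  have "(!) ?I ` {..a} \<subseteq> {k\<in>{..<length es}. u \<in> set (es ! k) \<and> ?f k \<le> ?f j}"
  proof
    fix k assume "k \<in> (!) ?I ` {..a}"
    then obtain b where b: "b \<le> a" "k = ?I ! b" by auto
    then have "k \<in> set ?I" using a by simp
    with le[OF b(1)] b show "k \<in> {k\<in>{..<length es}. u \<in> set (es ! k) \<and> ?f k \<le> ?f j}"
      by (auto simp: set_I)
  qed
  then have "card ((!) ?I ` {..a}) \<le> card {k\<in>{..<length es}. u \<in> set (es ! k) \<and> ?f k \<le> ?f j}"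
    by (intro card_mono) auto
  also have "\<dots> \<le> D' * ?f j" using assms es_sub by (intro card_incident) auto
  also have "card ((!) ?I ` {..a}) = Suc a"
    using a dist by (subst card_image) (auto simp: inj_on_def nth_eq_iff_index_eq)
  finally show ?thesis using a by (intro exI[of _ a]) auto
qed

lemma length_le: "j < length es \<Longrightarrow> length (es ! j) \<le> n"
  using card_mono[OF _ es_sub[of j]] distinct_card[OF distinct_es[of j]] by simp

lemma sum_small:
  assumes "u < n"
  shows "(\<Sum>j\<in>{j\<in>{..<length es}. u \<in> set (es ! j) \<and> length (es ! j) \<le> L}. 2 powr (- real (length (es ! j)) / 2)) \<le> 1 / (6 * sqrt 2)"
proof -
  let ?g = "\<lambda>i. real (\<Delta> i) * 2 powr (- real i / 2)"
  let ?J = "{j\<in>{..<length es}. u \<in> set (es ! j) \<and> length (es ! j) \<le> L}"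
  let ?h = "\<lambda>j. 2 powr (- real (length (es ! j)) / 2)"
  \<comment> \<open>Convergence has to be shown first, since the infinite sum of a family that is
    not summable is 0 and would bound nothing. The degrees are at most \<open>D'\<close>, so a
    geometric series dominates.\<close>
  have "summable (\<lambda>i. real D' * (1 / sqrt 2) ^ i)"
    by (intro summable_mult summable_geometric) simp
  then have "summable ?g"
    by (rule summable_comparison_test') (simp only: powr_half, auto simp: Delta_le intro!: mult_right_mono)
  then have "?g summable_on UNIV"
    by (intro summable_nonneg_imp_summable_on) auto
  then have sg: "?g summable_on {3..}"
    by (rule summable_on_subset_banach) auto
  have "sum ?h ?J = (\<Sum>i\<in>{3..L}. \<Sum>j\<in>{j\<in>?J. length (es ! j) = i}. ?h j)"
    by (rule sum.group[symmetric]) (use es_size in auto)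
  also have "\<dots> \<le> (\<Sum>i\<in>{3..L}. ?g i)"
  proof (rule sum_mono)
    fix i assume "i \<in> {3..L}"
    then have e: "{j\<in>?J. length (es ! j) = i} = {j\<in>{..<length es}. u \<in> set (es ! j) \<and> length (es ! j) = i}" by auto
    have "(\<Sum>j\<in>{j\<in>?J. length (es ! j) = i}. ?h j) =
        (\<Sum>j\<in>{j\<in>{..<length es}. u \<in> set (es ! j) \<and> length (es ! j) = i}. 2 powr (- real i / 2))"
      unfolding e by (rule sum.cong) auto
    also have "\<dots> \<le> ?g i" using degree[OF assms, of i] by (simp add: mult_right_mono)
    finally show "(\<Sum>j\<in>{j\<in>?J. length (es ! j) = i}. ?h j) \<le> ?g i" .
  qed
  also have "\<dots> \<le> (\<Sum>\<^sub>\<infinity>i\<in>{3..}. ?g i)"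
    by (rule finite_sum_le_infsum[OF sg]) auto
  also note Delta_sum
  finally show ?thesis .
qed

text \<open>
  The factor \<open>9/8\<close> is the gain per vertex of a causal history, and \<open>5/4\<close> accounts for the next level: each vertex
  is left alone or spawns an edge, of total weight at most \<open>1/4\<close>. Their product just fits below \<open>sqrt 2\<close>.
\<close>

lemma power_45_64: "(1/2 :: real) ^ c * (9/8) ^ c * (5/4) ^ c \<le> 2 powr (- real c / 2)"
proof -
  have "(45/64 :: real) \<le> 1 / sqrt 2"
  proof -
    have "45/64 * sqrt 2 \<le> (1 :: real)"
      by (rule power2_le_imp_le) (simp_all add: power_mult_distrib power2_eq_square)
    then show ?thesis by (simp add: field_simps)
  qed
  then have "(45/64 :: real) ^ c \<le> (1 / sqrt 2) ^ c" by (intro power_mono) auto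
  then show ?thesis by (simp only: powr_half flip: power_mult_distrib) simp
qed

lemma weight_bound:
  assumes T_small: "\<And>j. j < length es \<Longrightarrow> length (es ! j) \<le> L \<Longrightarrow> T j = set (es ! j)"
    and T_big: "\<And>j. j < length es \<Longrightarrow> L < length (es ! j) \<Longrightarrow> L \<le> card (T j)"
    and T_sub: "\<And>j. j < length es \<Longrightarrow> T j \<subseteq> set (es ! j)"
    and big: "real (D' * n) * 2 powr (- real L / 2) \<le> 1 / 200"
  shows "(\<Sum>f\<in>{f\<in>{..<length es}. u \<in> T f}. 2 * (1/2) ^ card (T f) * (9/8) ^ card (T f) * (5/4) ^ card (T f)) \<le> (1/4 :: real)"
proof (cases "u < n")
  case False
  then have "{f\<in>{..<length es}. u \<in> T f} = {}"
    using T_sub es_sub by fastforce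
  then show ?thesis by (simp only: sum.empty)
next
  case True
  let ?F = "{f\<in>{..<length es}. u \<in> T f}"
  let ?h = "\<lambda>j. 2 powr (- real (length (es ! j)) / 2)"
  let ?S = "{j\<in>{..<length es}. u \<in> set (es ! j) \<and> length (es ! j) \<le> L}"
  let ?B = "{j\<in>{..<length es}. u \<in> set (es ! j) \<and> length (es ! j) \<le> n}"
  have "(\<Sum>f\<in>?F. 2 * (1/2) ^ card (T f) * (9/8) ^ card (T f) * (5/4 :: real) ^ card (T f)) \<le>
      (\<Sum>f\<in>?F. 2 * 2 powr (- real (card (T f)) / 2))"
    using power_45_64 by (intro sum_mono) (simp add: mult.assoc)
  also have "\<dots> = 2 * (\<Sum>f\<in>?F. 2 powr (- real (card (T f)) / 2))" by (simp add: sum_distrib_left)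
  also have "(\<Sum>f\<in>?F. 2 powr (- real (card (T f)) / 2)) \<le>
      (\<Sum>f\<in>?F. (if length (es ! f) \<le> L then ?h f else 2 powr (- real L / 2)))"
  proof (rule sum_mono)
    fix f assume f: "f \<in> ?F"
    show "2 powr (- real (card (T f)) / 2) \<le> (if length (es ! f) \<le> L then ?h f else 2 powr (- real L / 2))"
      using f T_small[of f] T_big[of f] distinct_es[of f] by (auto simp: distinct_card)
  qed
  also have "\<dots> = (\<Sum>f\<in>{f\<in>?F. length (es ! f) \<le> L}. ?h f) + (\<Sum>f\<in>{f\<in>?F. \<not> length (es ! f) \<le> L}. 2 powr (- real L / 2))"
    by (subst sum.If_cases) (auto simp: Int_def)
  also have "\<dots> \<le> sum ?h ?S + (\<Sum>f\<in>?B. 2 powr (- real L / 2))"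
    using T_sub length_le by (intro add_mono sum_mono2) fastforce+
  also have "\<dots> \<le> 1 / (6 * sqrt 2) + real (D' * n) * 2 powr (- real L / 2)"
    using sum_small[OF True, of L] card_incident[OF True, of n]
    by (intro add_mono) (auto intro!: mult_right_mono simp flip: of_nat_mult)
  \<comment> \<open>The 1/200 for large edges fills the remaining gap: 2 * (3/25 + 1/200) = 1/4,
    where the 2 counts the two colors of a monochromatic edge.\<close>
  also have "\<dots> \<le> 1 / (6 * sqrt 2) + 1 / 200" using big by simp
  also have "1 / (6 * sqrt 2) \<le> (3 / 25 :: real)"
  proof -
    have "(25/18 :: real) \<le> sqrt 2" by (rule real_le_rsqrt) (simp add: power2_eq_square)
    then show ?thesis by (simp add: field_simps)
  qed
  finally show ?thesis by simp
qed

text \<open>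
  The edges on which the constraint is enforced: an edge larger than \<open>L\<close> is replaced by at least \<open>L\<close> of its
  vertices, chosen so that the queried ones among them are found by the search for an owner.
\<close>

lemma truncation:
  assumes X: "D' * (L + length vs) \<le> X"
  shows "\<exists>T. \<forall>j<length es. T j \<subseteq> set (es ! j) \<and> (length (es ! j) \<le> L \<longrightarrow> T j = set (es ! j)) \<and>
    (L < length (es ! j) \<longrightarrow> L \<le> card (T j)) \<and>
    (\<forall>u\<in>T j. u \<in> set vs \<or> length (es ! j) \<le> L \<longrightarrow> lca.owner n es L X u \<noteq> None)"
proof -
  have own: "lca.owner n es L X u \<noteq> None"
    if j: "j < length es" and le: "length (es ! j) \<le> L + length vs" and u: "u \<in> set (take L (es ! j))" for j u
  proof -
    obtain p where p: "p < L" "p < length (es ! j)" "es ! j ! p = u"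
      using u by (auto simp: in_set_conv_nth)
    obtain a where a: "a < D' * length (es ! j)" "read_input n es Incident_Edge u a = j"
      using incident_index[OF j, of u] p by auto
    have "D' * length (es ! j) \<le> D' * (L + length vs)" using le by (intro mult_le_mono2)
    then have "a < X" using a X by linarith
    then show ?thesis
      using lca.owner_found[of a X p L n es u] p a j by (simp add: lca.incident_def lca.vertex_def)
  qed
  have "\<exists>S. S \<subseteq> set (es ! j) \<and> (length (es ! j) \<le> L \<longrightarrow> S = set (es ! j)) \<and>
    (L < length (es ! j) \<longrightarrow> L \<le> card S) \<and>
    (\<forall>u\<in>S. u \<in> set vs \<or> length (es ! j) \<le> L \<longrightarrow> lca.owner n es L X u \<noteq> None)" if j: "j < length es" for j
  \<comment> \<open>Up to this size the edge has an index below \<open>D' * (L + length vs)\<close>,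
    hence below \<open>X\<close>, so the search finds the vertices at its first \<open>L\<close>
    positions. A larger edge keeps at least \<open>L\<close> vertices after all queried ones are
    dropped. The choice may depend on \<open>vs\<close>, as \<open>T\<close> occurs in the analysis
    only.\<close>
  proof (cases "length (es ! j) \<le> L + length vs")
    case True
    have "card (set (take L (es ! j))) = min L (length (es ! j))"
      using distinct_es[OF j] by (subst distinct_card) (auto simp: distinct_take)
    then show ?thesis
      using True own[OF j True] set_take_subset[of L "es ! j"]
      by (intro exI[of _ "set (take L (es ! j))"]) auto
  next
    case False
    have "card (set (es ! j)) - card (set vs) \<le> card (set (es ! j) - set vs)"
      by (rule diff_card_le_card_Diff) simp
    then have "L \<le> card (set (es ! j) - set vs)"
      using False distinct_card[OF distinct_es[OF j]] card_length[of vs] by linarith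
    then show ?thesis
      using False by (intro exI[of _ "set (es ! j) - set vs"]) auto
  qed
  then show ?thesis by metis
qed

end


section \<open>Asymptotics\<close>

lemma floorlog_bounds_real:
  assumes "0 < n"
  shows "real n \<le> 2 ^ floorlog 2 n" "2 ^ floorlog 2 n \<le> 2 * real n" "ln (real n) \<le> floorlog 2 n"
    "real (floorlog 2 n) \<le> 2 * ln (real n) + 1"
proof -
  let ?l = "floorlog 2 n"
  have b: "2 ^ (?l - 1) \<le> n" "n < 2 ^ ?l" using floorlog_bounds[of n 2] assms by auto
  have l: "0 < ?l" using assms by (simp add: floorlog_def)
  then have "(2 :: nat) ^ ?l = 2 * 2 ^ (?l - 1)" by (simp flip: power_Suc)
  then have "(2 :: nat) ^ ?l \<le> 2 * n" using b by simp
  then have "real (2 ^ ?l) \<le> real (2 * n)" by (simp only: of_nat_le_iff)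
  then show 2: "2 ^ ?l \<le> 2 * real n" by simp
  have "real n \<le> real (2 ^ ?l)" using b(2) by (simp only: of_nat_le_iff less_imp_le)
  then show 1: "real n \<le> 2 ^ ?l" by simp
  have ln2: "ln 2 \<le> (1 :: real)" "1 / 2 \<le> ln (2 :: real)"
    using ln_le_minus_one[of 2] ln_le_minus_one[of "1/2"] by (simp_all add: ln_div)
  have "ln (real n) \<le> ln (2 ^ ?l)" using 1 assms by simp
  also have "\<dots> = real ?l * ln 2" by (simp add: ln_realpow)
  also have "\<dots> \<le> real ?l * 1" using ln2 by (intro mult_left_mono) auto
  finally show "ln (real n) \<le> ?l" by simp
  have "real (?l - 1) * ln 2 \<le> ln (real n)"
  proof -
    have "real (2 ^ (?l - 1)) \<le> real n" using b(1) by (simp only: of_nat_le_iff)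
    then have "ln (2 ^ (?l - 1)) \<le> ln (real n)" using assms by simp
    then show ?thesis by (simp add: ln_realpow)
  qed
  moreover have "real (?l - 1) * (1 / 2) \<le> real (?l - 1) * ln 2" using ln2 by (intro mult_left_mono) auto
  ultimately show "real ?l \<le> 2 * ln (real n) + 1" using l by (simp add: of_nat_diff)
qed

text \<open>\<open>2 ^ (floorlog 2 n div K)\<close> is the stand-in for the power 1/K of n that
  integer arithmetic can compute.\<close>

lemma power_div_bounds:
  assumes "0 < n" "0 < K"
  shows "real n powr (1 / K) / 2 \<le> 2 ^ (floorlog 2 n div K)"
    "2 ^ (floorlog 2 n div K) \<le> (2 * real n) powr (1 / K)"
proof -
  let ?l = "floorlog 2 n"
  note b = floorlog_bounds_real[OF assms(1)]
  have p: "(2 ^ ?l) powr (1 / K) = 2 powr (real ?l / K)"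
    by (simp add: powr_powr flip: powr_realpow)
  have d: "real (?l div K) \<le> real ?l / K" by (rule of_nat_div_le_of_nat)
  have "2 ^ (?l div K) = 2 powr real (?l div K)" by (simp add: powr_realpow)
  also have "\<dots> \<le> 2 powr (real ?l / K)" using d by (intro powr_mono) auto
  also have "\<dots> \<le> (2 * real n) powr (1 / K)"
    unfolding p[symmetric] using b by (intro powr_mono2) auto
  finally show "2 ^ (?l div K) \<le> (2 * real n) powr (1 / K)" .
  have "?l < K * Suc (?l div K)" using assms(2) dividend_less_times_div[of K ?l] by (simp add: algebra_simps)
  then have "real ?l \<le> real K * (real (?l div K) + 1)"
    by (metis less_imp_le of_nat_Suc of_nat_le_iff of_nat_mult add.commute)
  then have d2: "real ?l / K \<le> real (?l div K) + 1"
    using assms(2) by (simp add: field_simps)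
  have "real n powr (1 / K) \<le> (2 ^ ?l) powr (1 / K)"
    using b by (intro powr_mono2) auto
  also have "\<dots> \<le> 2 powr (real (?l div K) + 1)"
    unfolding p using d2 by (intro powr_mono) auto
  also have "\<dots> = 2 * 2 ^ (?l div K)" by (simp add: powr_add powr_realpow)
  finally show "real n powr (1 / K) / 2 \<le> 2 ^ (?l div K)" by simp
qed

text \<open>An attempt makes at most \<open>2 * L\<close> color accesses, each a search through
  \<open>X * L\<close> slots, and there are \<open>X ^ 3\<close> attempts.\<close>

lemma time_bound:
  fixes X L :: nat
  assumes "1 \<le> X" "2 \<le> L"
  shows "X * X * X * ((2 * L + 2) * (30 * (X * L) + 50 + 10) + 20 + 8 * X + 20 + 1) + (30 * (X * L) + 50) + 10 * L + 80 \<le>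
    300 * X ^ 4 * L ^ 2"
proof -
  have "1 * L \<le> X * L" using assms by (intro mult_le_mono1)
  then have XL: "L \<le> X * L" "2 \<le> X * L" using assms by linarith+
  have XLL: "X * L * 2 \<le> X * L * L" using assms by (intro mult_le_mono2)
  have X4: "X \<le> X ^ 4" using assms by (cases X) (auto intro: self_le_power)
  have "(2 * L + 2) * (30 * (X * L) + 50 + 10) \<le> (3 * L) * (60 * (X * L))"
    using assms XL by (intro mult_le_mono) linarith+
  moreover have "8 * X \<le> 4 * (X * L)" using mult_le_mono2[of 2 L "4 * X"] assms by (simp add: ac_simps)
  ultimately have "(2 * L + 2) * (30 * (X * L) + 50 + 10) + 20 + 8 * X + 20 + 1 \<le> 203 * (X * L * L)"
  proof -
    have "(3 * L) * (60 * (X * L)) = 180 * (X * L * L)" by simp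
    with \<open>_ \<le> (3 * L) * (60 * (X * L))\<close> \<open>8 * X \<le> _\<close> XL XLL show ?thesis by linarith
  qed
  then have "X * X * X * ((2 * L + 2) * (30 * (X * L) + 50 + 10) + 20 + 8 * X + 20 + 1) \<le> X * X * X * (203 * (X * L * L))"
    by (rule mult_le_mono2)
  also have "\<dots> = 203 * X ^ 4 * L ^ 2" by (simp add: power4_eq_xxxx power2_eq_square)
  finally have 1: "X * X * X * ((2 * L + 2) * (30 * (X * L) + 50 + 10) + 20 + 8 * X + 20 + 1) \<le> 203 * X ^ 4 * L ^ 2" .
  have "(30 * (X * L) + 50) + 10 * L + 80 \<le> 70 * (X * L * L)"
    using XL XLL by linarith
  also have "\<dots> \<le> 70 * X ^ 4 * L ^ 2"
    using X4 by (simp add: power2_eq_square mult_le_mono1)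
  finally show ?thesis using 1 by linarith
qed

definition good_params :: "nat \<Rightarrow> nat \<Rightarrow> real \<Rightarrow> real \<Rightarrow> nat \<Rightarrow> nat \<Rightarrow> bool" where
  "good_params D' K \<beta> c n s \<longleftrightarrow> (let l = floorlog 2 n; L = 4 * l; X = 2 ^ (l div K) in
    4 \<le> l \<and> D' < 2 ^ l \<and> K < 2 ^ l \<and> s \<le> L \<and>
    real D' * (real L + ln (real n) powr c) \<le> real X \<and>
    (D' * L * L) ^ s \<le> X \<and>
    real (D' * n) * 2 powr (- real L / 2) \<le> 1 / 200 \<and>
    ln (real n) powr c * ((5/4) / (9/8) ^ s) + real n * ((5/4) / (9/8) ^ X) \<le> ln (real n) powr (- c) \<and>
    300 * real X ^ 4 * real L ^ 2 \<le> real n powr \<beta>)"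

text \<open>\<open>s\<close> must be a large enough multiple of log log n for the error, yet
  \<open>(D' * L * L) ^ s\<close> must stay below \<open>X\<close>, a small power of n. Both hold
  for large n because polylogarithmic to the power log log n is subpolynomial.\<close>

lemma eventually_params:
  fixes D' K :: nat and \<beta> c :: real
  assumes "0 < D'" "0 < \<beta>" "0 < c" "8 / \<beta> \<le> K"
  shows "\<forall>\<^sub>F n in sequentially. \<exists>s. good_params D' K \<beta> c n s"
proof -
  have K: "0 < K" using assms by (cases K) auto
  define a where "a = 1 / real K"
  \<comment> \<open>The running time grows like \<open>X ^ 4\<close>, at most
    \<open>(2 * n) powr (\<beta> / 2)\<close>. The other half of the exponent pays for the constant
    and for \<open>L ^ 2\<close>.\<close>
  have a: "0 < a" "a \<le> \<beta> / 8" using K assms by (auto simp: a_def field_simps)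
  define g where "g = ln (9/8 :: real)"
  have g: "0 < g" by (simp add: g_def)
  \<comment> \<open>This makes \<open>(9/8) ^ s\<close> at least
    \<open>ln n powr (2 * c + 1)\<close>: one \<open>c\<close> for the number of queries, one for
    the error bound, and the 1 absorbs constants.\<close>
  define \<kappa> where "\<kappa> = (2 * c + 1) / g"
  have \<kappa>: "0 < \<kappa>" using g assms by (simp add: \<kappa>_def)
  define D where "D = real D'"
  have D: "0 < D" using assms by (simp add: D_def)
  note [simp del] = of_nat_power of_nat_mult
  have events: "\<forall>\<^sub>F x :: real in at_top. 16 \<le> x"
    "\<forall>\<^sub>F x :: real in at_top. D < x"
    "\<forall>\<^sub>F x :: real in at_top. real K < x"
    "\<forall>\<^sub>F x :: real in at_top. 200 * D \<le> x"
    "\<forall>\<^sub>F x :: real in at_top. 3 \<le> ln x"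
    "\<forall>\<^sub>F x :: real in at_top. \<kappa> * ln (ln x) + 1 \<le> ln x"
    "\<forall>\<^sub>F x :: real in at_top. D * (8 * ln x + 4 + ln x powr c) \<le> x powr a / 2"
    "\<forall>\<^sub>F x :: real in at_top. 1 \<le> D * (8 * ln x + 4) * (8 * ln x + 4)"
    "\<forall>\<^sub>F x :: real in at_top. (D * (8 * ln x + 4) * (8 * ln x + 4)) powr (\<kappa> * ln (ln x) + 1) \<le> x powr a / 2"
    "\<forall>\<^sub>F x :: real in at_top. x * (5/4) * exp (- (g * (x powr a / 2))) \<le> ln x powr (- c) / 2"
    "\<forall>\<^sub>F x :: real in at_top. 300 * (2 * x) powr (\<beta> / 2) * (8 * ln x + 4) ^ 2 \<le> x powr \<beta>"
    using a g \<kappa> D assms by real_asymp+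
  \<comment> \<open>Intersecting with the predicates that hold eventually makes the claim immediate
    for a finite set; \<open>events\<close> shows afterwards that all listed predicates belong to
    it.\<close>
  have "\<forall>\<^sub>F n :: nat in sequentially. \<forall>P \<in> {P. \<forall>\<^sub>F x :: real in at_top. P x} \<inter>
      {\<lambda>x. 16 \<le> x, \<lambda>x. D < x, \<lambda>x. real K < x, \<lambda>x. 200 * D \<le> x, \<lambda>x. 3 \<le> ln x, \<lambda>x. \<kappa> * ln (ln x) + 1 \<le> ln x,
       \<lambda>x. D * (8 * ln x + 4 + ln x powr c) \<le> x powr a / 2,
       \<lambda>x. 1 \<le> D * (8 * ln x + 4) * (8 * ln x + 4),
       \<lambda>x. (D * (8 * ln x + 4) * (8 * ln x + 4)) powr (\<kappa> * ln (ln x) + 1) \<le> x powr a / 2,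
       \<lambda>x. x * (5/4) * exp (- (g * (x powr a / 2))) \<le> ln x powr (- c) / 2,
       \<lambda>x. 300 * (2 * x) powr (\<beta> / 2) * (8 * ln x + 4) ^ 2 \<le> x powr \<beta>}. P (real n)"
    by (intro eventually_ball_finite ballI) (auto intro: eventually_compose_filterlim[OF _ filterlim_real_sequentially])
  then show ?thesis
  proof eventually_elim
    case (elim n)
    define x where "x = real n"
    have h: "16 \<le> x" "D < x" "real K < x" "200 * D \<le> x" "3 \<le> ln x" "\<kappa> * ln (ln x) + 1 \<le> ln x"
      "D * (8 * ln x + 4 + ln x powr c) \<le> x powr a / 2"
      "1 \<le> D * (8 * ln x + 4) * (8 * ln x + 4)"
      "(D * (8 * ln x + 4) * (8 * ln x + 4)) powr (\<kappa> * ln (ln x) + 1) \<le> x powr a / 2"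
      "x * (5/4) * exp (- (g * (x powr a / 2))) \<le> ln x powr (- c) / 2"
      "300 * (2 * x) powr (\<beta> / 2) * (8 * ln x + 4) ^ 2 \<le> x powr \<beta>"
      using elim events by (auto simp: x_def)
    let ?l = "floorlog 2 n"
    define L where "L = 4 * ?l"
    define X where "X = (2 :: nat) ^ (?l div K)"
    have n: "0 < n" using h(1) by (auto simp: x_def intro: gr0I)
    note b = floorlog_bounds_real[OF n, folded x_def]
    have Xb: "x powr a / 2 \<le> real X" "real X \<le> (2 * x) powr a"
      using power_div_bounds[OF n K] by (simp_all add: X_def x_def a_def of_nat_power)
    have Lb: "real L \<le> 8 * ln x + 4" "ln x \<le> real L" using b(3,4) h(5) by (auto simp: L_def of_nat_mult)
    define s where "s = nat \<lceil>\<kappa> * ln (ln x)\<rceil>"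
    have lnln: "0 \<le> \<kappa> * ln (ln x)" using \<kappa> h(5) by simp
    have sb: "\<kappa> * ln (ln x) \<le> real s" "real s \<le> \<kappa> * ln (ln x) + 1"
      unfolding s_def using lnln by linarith+
    have e: "(9/8 :: real) ^ k = exp (g * real k)" for k
      unfolding g_def by (subst mult.commute, subst exp_of_nat_mult) simp
    have "(4 :: real) \<le> ?l"
    proof -
      have "(2::nat) ^ (4 - 1) \<le> n" using h(1) by (simp add: x_def)
      then have "4 \<le> ?l" by (intro floorlog_geI) auto
      then show ?thesis by simp
    qed
    moreover have "D' < 2 ^ ?l" "K < 2 ^ ?l"
    proof -
      have t: "real (2 ^ ?l) = 2 ^ ?l" by (simp add: of_nat_power)
      have "real D' < real (2 ^ ?l)" "real K < real (2 ^ ?l)"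
        unfolding t using h(2,3) b(1) D_def by linarith+
      then show "D' < 2 ^ ?l" "K < 2 ^ ?l" by (simp_all only: of_nat_less_iff)
    qed
    moreover have "s \<le> L"
    proof -
      have "real s \<le> real L" using sb(2) h(6) Lb(2) by linarith
      then show ?thesis by (simp only: of_nat_le_iff)
    qed
    moreover have "real D' * (L + ln n powr c) \<le> X"
    proof -
      have "D * (real L + ln x powr c) \<le> D * (8 * ln x + 4 + ln x powr c)"
        using Lb D by (intro mult_left_mono) auto
      also note h(7) also note Xb(1)
      finally show ?thesis by (simp add: D_def x_def)
    qed
    moreover have "(D' * L * L) ^ s \<le> X"
    proof -
      have "real ((D' * L * L) ^ s) = (D * real L * real L) ^ s" by (simp add: D_def of_nat_power of_nat_mult)
      also have "\<dots> \<le> (D * (8 * ln x + 4) * (8 * ln x + 4)) ^ s"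
        using Lb D by (intro power_mono mult_mono) auto
      also have "\<dots> = (D * (8 * ln x + 4) * (8 * ln x + 4)) powr real s"
        using h(8) by (subst powr_realpow) auto
      also have "\<dots> \<le> (D * (8 * ln x + 4) * (8 * ln x + 4)) powr (\<kappa> * ln (ln x) + 1)"
        using h(8) sb by (intro powr_mono) auto
      also note h(9) also note Xb(1)
      finally show ?thesis by (simp only: of_nat_le_iff)
    qed
    moreover have "real (D' * n) * 2 powr (- real L / 2) \<le> 1 / 200"
    proof -
      have "2 powr (- real L / 2) = 1 / (2 ^ ?l) ^ 2"
      proof -
        have "2 powr (- real L / 2) = 2 powr (- real (?l * 2))" by (simp add: L_def of_nat_mult mult.commute)
        also have "\<dots> = 1 / 2 ^ (?l * 2)" by (subst powr_minus_divide, subst powr_realpow) auto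
        finally show ?thesis by (simp add: power_mult)
      qed
      also have "\<dots> \<le> 1 / x ^ 2"
        using b(1) h(1) by (intro divide_left_mono power_mono) auto
      finally have "real (D' * n) * 2 powr (- real L / 2) \<le> (D * x) * (1 / x ^ 2)"
        using D h(1) by (simp only: of_nat_mult D_def[symmetric] x_def[symmetric]) (intro mult_left_mono, auto)
      also have "\<dots> = D / x" using h(1) by (simp add: power2_eq_square)
      also have "\<dots> \<le> 1 / 200" using h(1,4) by (simp add: field_simps)
      finally show ?thesis .
    qed
    moreover have "ln n powr c * ((5/4) / (9/8) ^ s) + n * ((5/4) / (9/8) ^ X) \<le> ln n powr (- c)"
    proof -
      have "ln x powr (2 * c + 1) = exp (g * (\<kappa> * ln (ln x)))"
        using g h(5) by (simp add: powr_def \<kappa>_def)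
      also have "\<dots> \<le> exp (g * real s)" using g sb by simp
      finally have "ln x powr (2 * c + 1) \<le> (9/8) ^ s" by (simp add: e)
      then have "(5/4) / (9/8) ^ s \<le> (5/4) / ln x powr (2 * c + 1)"
        using h(5) by (intro divide_left_mono) auto
      then have "ln x powr c * ((5/4) / (9/8) ^ s) \<le> ln x powr c * ((5/4) / ln x powr (2 * c + 1))"
        by (intro mult_left_mono) auto
      also have "\<dots> = ln x powr (- c) * ((5/4) / ln x)"
        using h(5) by (simp add: powr_add powr_minus divide_simps) (simp add: powr_add[symmetric])
      also have "\<dots> \<le> ln x powr (- c) * (1 / 2)"
        using h(5) by (intro mult_left_mono) (auto simp: field_simps)
      finally have 1: "ln x powr c * ((5/4) / (9/8) ^ s) \<le> ln x powr (- c) / 2" by simp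
      have "x * ((5/4) / (9/8) ^ X) = x * (5/4) * exp (- (g * real X))"
        unfolding e exp_minus by (simp only: divide_inverse mult.assoc)
      also have "\<dots> \<le> x * (5/4) * exp (- (g * (x powr a / 2)))"
        using g Xb(1) h(1) by (intro mult_left_mono) auto
      also note h(10)
      finally show ?thesis using 1 by (simp add: x_def)
    qed
    moreover have "300 * real X ^ 4 * real L ^ 2 \<le> n powr \<beta>"
    proof -
      have "real X ^ 4 \<le> ((2 * x) powr (\<beta> / 8)) ^ 4"
      proof (intro power_mono)
        have "(2 * x) powr a \<le> (2 * x) powr (\<beta> / 8)" using a h(1) by (intro powr_mono) auto
        then show "real X \<le> (2 * x) powr (\<beta> / 8)" using Xb(2) by linarith
      qed simp
      also have "\<dots> = (2 * x) powr (\<beta> / 2)"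
        using h(1) by (simp add: powr_powr flip: powr_realpow)
      finally have "300 * real X ^ 4 * real L ^ 2 \<le> 300 * (2 * x) powr (\<beta> / 2) * (8 * ln x + 4) ^ 2"
        using Lb by (intro mult_mono power_mono) auto
      also note h(11)
      finally show ?thesis by (simp add: x_def)
    qed
    ultimately show ?case
      unfolding good_params_def Let_def L_def X_def by (intro exI[of _ s]) (simp add: of_nat_power)
  qed
qed

lemma answers_no_edges:
  assumes "10 \<le> T"
  shows "answers n [] w S T (PROG K D') \<mu> \<omega> vs (map (\<lambda>v. v \<noteq> 0) vs)"
proof (induction vs)
  case Nil
  show ?case by (simp add: answers.Nil)
next
  case (Cons v vs)
  have "ram.runs n [] w S (PROG K D') ((\<lambda>_. 0)(0 := v), \<mu>, \<omega>) (\<lambda>t s'. t \<le> 10 \<and> s' = ((\<lambda>_. 0)(0 := v, 9 := 0), \<mu>, \<omega>))"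
    by (simp add: PROG_def ram.runs_simps)
  then obtain t where "exec n [] w S (PROG K D') ((\<lambda>_. 0)(0 := v), \<mu>, \<omega>) t ((\<lambda>_. 0)(0 := v, 9 := 0), \<mu>, \<omega>)" "t \<le> 10"
    unfolding ram.runs_def by blast
  from answers.Cons[OF this(1) _ Cons] this(2) assms show ?case by simp
qed

lemma word_bounds:
  fixes l :: nat
  assumes "4 \<le> l" "D' < 2 ^ l" "1 \<le> K" "2 ^ (8 * l) \<le> W" "X = 2 ^ (l div K)"
  shows "X * (4 * l) < W" "D' * (4 * l) * (4 * l) < W" "X * X * X < W" "4 < W" "4 ^ (4 * l) \<le> W" "2 ^ l < W"
proof -
  define Y :: nat where "Y = 2 ^ l"
  have Y: "16 \<le> Y"
    using power_increasing[OF assms(1), of "2 :: nat"] by (simp add: Y_def)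
  have X: "X \<le> Y" unfolding assms(5) Y_def by (intro power_increasing) auto
  have "l < Y" by (simp add: Y_def)
  then have "4 * l \<le> Y * Y" using Y by (intro mult_le_mono) auto
  then have L: "4 * l \<le> Y ^ 2" by (simp add: power2_eq_square)
  have W: "Y ^ k < W" if "k < 8" for k
  proof -
    have "Y ^ k < Y ^ 8" using Y that by (intro power_strict_increasing) auto
    also have "Y ^ 8 = 2 ^ (8 * l)" by (simp add: Y_def mult.commute flip: power_mult)
    finally show ?thesis using assms(4) by linarith
  qed
  have "X * (4 * l) \<le> Y * Y ^ 2" using X L by (rule mult_le_mono)
  then show "X * (4 * l) < W" using W[of 3] by (simp add: eval_nat_numeral)
  have "D' * (4 * l) * (4 * l) \<le> Y * Y ^ 2 * Y ^ 2"
    using assms(2) L by (intro mult_le_mono) (auto simp: Y_def)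
  also have "\<dots> = Y ^ 5" by (simp add: eval_nat_numeral)
  finally show "D' * (4 * l) * (4 * l) < W" using W[of 5] by simp
  have "X * X * X \<le> Y * Y * Y" using X by (intro mult_le_mono)
  then show "X * X * X < W" using W[of 3] by (simp add: eval_nat_numeral)
  show "4 < W" "2 ^ l < W" using W[of 1] Y by (auto simp: Y_def)
  show "4 ^ (4 * l) \<le> W" using power_mult[of "2 :: nat" 2 "4 * l"] assms(4) by simp
qed

theorem theorem5:
  fixes \<epsilon> D \<beta> c :: real
  assumes "\<epsilon> > 0" and "D > 0" and "0 < \<beta>" and "\<beta> \<le> 1" and "c > 0"
  shows "\<exists>C :: nat.
    has_lca (hypergraph_class \<epsilon> D)
      (\<lambda>n. real n powr \<beta>) (\<lambda>n m. C * m) (\<lambda>n. ln (real n) powr (- c))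
      (\<lambda>n. ln (real n) powr c)"
proof -
  define D' where "D' = nat \<lceil>D\<rceil>"
  define K where "K = nat \<lceil>8 / \<beta>\<rceil>"
  have D': "D \<le> real D'" "0 < D'" using assms(2) by (auto simp: D'_def)
  have K: "8 / \<beta> \<le> real K" "1 \<le> K"
  proof -
    show 1: "8 / \<beta> \<le> real K" by (simp add: K_def real_nat_ceiling_ge)
    have "0 < 8 / \<beta>" using assms by simp
    with 1 show "1 \<le> K" by linarith
  qed
  obtain n\<^sub>0 where n\<^sub>0: "\<And>n. n\<^sub>0 \<le> n \<Longrightarrow> \<exists>s. good_params D' K \<beta> c n s"
    using eventually_params[OF D'(2) assms(3) assms(5) K(1)] unfolding eventually_sequentially by blast
  have "has_lca (hypergraph_class \<epsilon> D) (\<lambda>n. real n powr \<beta>) (\<lambda>n m. 1 * m) (\<lambda>n. ln (real n) powr (- c)) (\<lambda>n. ln (real n) powr c)"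
    unfolding has_lca_def
  \<comment> \<open>The word factor is 8 because a cell holds \<open>L = 4 * floorlog 2 n\<close>
    digits of two bits each.\<close>
  proof (rule exI[of _ "PROG K D'"], rule exI[of _ 8], rule exI[of _ n\<^sub>0], intro conjI allI impI)
    fix n E es vs
    assume n: "n\<^sub>0 \<le> n" and H: "({..<n}, E) \<in> hypergraph_class \<epsilon> D" and es: "lists_edges es E"
      and vs: "set vs \<subseteq> {..<n}" "real (length vs) \<le> ln (real n) powr c"
    define l where "l = floorlog 2 n"
    define L where "L = 4 * l"
    define X :: nat where "X = 2 ^ (l div K)"
    obtain s where p: "4 \<le> l" "D' < 2 ^ l" "K < 2 ^ l" "s \<le> L" "real D' * (L + ln n powr c) \<le> X"
      "(D' * L * L) ^ s \<le> X" "real (D' * n) * 2 powr (- real L / 2) \<le> 1 / 200"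
      "ln n powr c * ((5/4) / (9/8) ^ s) + n * ((5/4) / (9/8) ^ X) \<le> ln n powr (- c)"
      "300 * real X ^ 4 * real L ^ 2 \<le> n powr \<beta>"
      using n\<^sub>0[OF n] unfolding good_params_def Let_def l_def[symmetric] L_def[symmetric] X_def[symmetric] by blast
    have e: "\<forall>e\<in>set es. distinct e" "distinct (map set es)" "E = set (map set es)"
      using es by (auto simp: lists_edges_def)
    have mE: "card E = length es" using e(2,3) distinct_card[of "map set es"] by simp
    have X1: "1 \<le> X" and L2: "2 \<le> L" using p(1) by (auto simp: X_def L_def)
    show "let m = card E; w = 8 * floorlog 2 (n + m); run = answers n es w (1 * m) (real n powr \<beta>) (PROG K D') (\<lambda>_. 0)
      in (\<forall>\<omega>. \<exists>bs. run \<omega> vs bs) \<and>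
         1 - ln (real n) powr (- c) \<le> measure random_tape {\<omega>. \<exists>f. two_coloring E f \<and> run \<omega> vs (map f vs)}"
    proof (cases "es = []")
      case True
      have "real 16 \<le> 300 * real X ^ 4 * real L ^ 2"
      proof -
        have "1 * 1 \<le> real X ^ 4 * real L ^ 2" using X1 L2 by (intro mult_mono one_le_power) auto
        then have "16 \<le> 300 * (real X ^ 4 * real L ^ 2)" by linarith
        then show ?thesis by (simp only: mult.assoc of_nat_numeral)
      qed
      then have T: "10 \<le> real n powr \<beta>" using p(9) by linarith
      have "two_coloring E (\<lambda>v. v \<noteq> 0)" using True e(3) by (simp add: two_coloring_def)
      then have "{\<omega>. \<exists>f. two_coloring E f \<and> answers n es w S (real n powr \<beta>) (PROG K D') (\<lambda>_. 0) \<omega> vs (map f vs)} = UNIV" for w S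
        using answers_no_edges[OF T] True by blast
      moreover have "measure random_tape UNIV = 1"
      proof -
        have "prob_space random_tape"
          unfolding random_tape_def by (intro prob_space.prob_space_stream_space measure_pmf.prob_space_axioms)
        from prob_space.prob_space[OF this] show ?thesis by (simp add: random_tape_def space_stream_space)
      qed
      moreover have "\<exists>bs. answers n es w S (real n powr \<beta>) (PROG K D') (\<lambda>_. 0) \<omega> vs bs" for w S \<omega>
        using answers_no_edges[OF T] True by blast
      ultimately show ?thesis by (simp add: Let_def)
    next
      case False
      have "\<exists>\<Delta> :: nat \<Rightarrow> nat. (\<forall>i. real (\<Delta> i) \<le> D) \<and>
          (\<forall>i. \<forall>v\<in>{..<n}. card {e\<in>E. v \<in> e \<and> card e = i} \<le> \<Delta> i) \<and>
          (\<Sum>\<^sub>\<infinity>i\<in>{3..}. real (\<Delta> i) * 2 powr (- real i / 2)) \<le> (1 - \<epsilon>) / (6 * sqrt 2)"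
        and HE: "\<And>e. e \<in> E \<Longrightarrow> e \<subseteq> {..<n} \<and> 3 \<le> card e"
        using H unfolding hypergraph_class_def hypergraph_def mem_Collect_eq prod.case by blast+
      then obtain \<Delta> :: "nat \<Rightarrow> nat" where \<Delta>: "\<And>i. real (\<Delta> i) \<le> D"
          "\<And>i v. v \<in> {..<n} \<Longrightarrow> card {e\<in>E. v \<in> e \<and> card e = i} \<le> \<Delta> i"
          "(\<Sum>\<^sub>\<infinity>i\<in>{3..}. real (\<Delta> i) * 2 powr (- real i / 2)) \<le> (1 - \<epsilon>) / (6 * sqrt 2)"
        by blast
      have inE: "set (es ! j) \<in> E" "distinct (es ! j)" if "j < length es" for j using e that by auto
      interpret sparse_hypergraph n es \<Delta> D'
      proof
        fix j assume j: "j < length es"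
        show "distinct (es ! j)" "set (es ! j) \<subseteq> {..<n}" "3 \<le> length (es ! j)"
          using inE[OF j] HE[of "set (es ! j)"] distinct_card[of "es ! j"] by auto
      next
        fix u i assume u: "u < n"
        have "card {j\<in>{..<length es}. u \<in> set (es ! j) \<and> length (es ! j) = i} =
            card ((\<lambda>j. set (es ! j)) ` {j\<in>{..<length es}. u \<in> set (es ! j) \<and> length (es ! j) = i})"
        proof (rule card_image[symmetric])
          show "inj_on (\<lambda>j. set (es ! j)) {j\<in>{..<length es}. u \<in> set (es ! j) \<and> length (es ! j) = i}"
            using e(2) by (auto simp: inj_on_def distinct_conv_nth)
        qed
        also have "\<dots> \<le> card {e\<in>E. u \<in> e \<and> card e = i}"
        proof (rule card_mono)
          show "finite {e\<in>E. u \<in> e \<and> card e = i}" using e(3) by simp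
          show "(\<lambda>j. set (es ! j)) ` {j\<in>{..<length es}. u \<in> set (es ! j) \<and> length (es ! j) = i} \<subseteq> {e\<in>E. u \<in> e \<and> card e = i}"
            using inE by (auto simp: distinct_card)
        qed
        also have "\<dots> \<le> \<Delta> i" using \<Delta>(2)[of u i] u by simp
        finally show "card {j\<in>{..<length es}. u \<in> set (es ! j) \<and> length (es ! j) = i} \<le> \<Delta> i" .
      next
        fix i
        have "real (\<Delta> i) \<le> real D'" using \<Delta>(1)[of i] D'(1) by linarith
        then show "\<Delta> i \<le> D'" by simp
      next
        have "(1 - \<epsilon>) / (6 * sqrt 2) \<le> 1 / (6 * sqrt 2)" using assms(1) by (intro divide_right_mono) auto
        then show "(\<Sum>\<^sub>\<infinity>i\<in>{3..}. real (\<Delta> i) * 2 powr (- real i / 2)) \<le> 1 / (6 * sqrt 2)" using \<Delta>(3) by linarith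
      qed
      define w where "w = 8 * floorlog 2 (n + length es)"
      define d where "d = D' * L"
      define Z where "Z = X * X * X"
      have q: "D' * (L + length vs) \<le> X"
      proof -
        have "real D' * (L + length vs) \<le> real D' * (L + ln n powr c)"
          using vs(2) by (intro mult_left_mono) auto
        then have "real (D' * (L + length vs)) \<le> real X" using p(5) by simp
        then show ?thesis by (simp only: of_nat_le_iff)
      qed
      obtain T where T0: "\<forall>j<length es. T j \<subseteq> set (es ! j) \<and> (length (es ! j) \<le> L \<longrightarrow> T j = set (es ! j)) \<and>
          (L < length (es ! j) \<longrightarrow> L \<le> card (T j)) \<and>
          (\<forall>u\<in>T j. u \<in> set vs \<or> length (es ! j) \<le> L \<longrightarrow> lca.owner n es L X u \<noteq> None)"
        using truncation[OF q] by (elim exE)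
      have T: "\<And>j. j < length es \<Longrightarrow> T j \<subseteq> set (es ! j)"
          "\<And>j. j < length es \<Longrightarrow> length (es ! j) \<le> L \<Longrightarrow> T j = set (es ! j)"
          "\<And>j. j < length es \<Longrightarrow> L < length (es ! j) \<Longrightarrow> L \<le> card (T j)"
          "\<And>j u. j < length es \<Longrightarrow> u \<in> T j \<Longrightarrow> u \<in> set vs \<or> length (es ! j) \<le> L \<Longrightarrow> lca.owner n es L X u \<noteq> None"
        using T0 by blast+
      have wl: "2 ^ (8 * l) \<le> (2 :: nat) ^ w"
        unfolding w_def l_def by (intro power_increasing mult_le_mono2 floorlog_mono) auto
      note wb = word_bounds[OF p(1,2) K(2) wl X_def]
      have nm: "n + length es < 2 ^ w"
      proof -
        have "n + length es < 2 ^ floorlog 2 (n + length es)" using floorlog_leD[of 2 "n + length es"] by simp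
        also have "\<dots> \<le> 2 ^ w" unfolding w_def by (intro power_increasing) auto
        finally show ?thesis .
      qed
      have T_ne: "T j \<noteq> {}" if "j < length es" for j
      proof (cases "length (es ! j) \<le> L")
        case True
        then show ?thesis using T(2)[OF that] es_size[OF that] by auto
      next
        case False
        then show ?thesis using T(3)[OF that] L2 by auto
      qed
      interpret lca_all n es L X d Z T vs s w K D'
      proof
        show "finite {..<length es}" by simp
        show "finite (T j)" "T j \<noteq> {}" if "j \<in> {..<length es}" for j
          using T(1)[of j] T_ne[of j] that by (auto intro: finite_subset)
        show "es \<noteq> []" by (fact False)
        show "distinct (es ! j)" "set (es ! j) \<subseteq> {..<n}" "2 \<le> length (es ! j)" "length (es ! j) \<le> n"
          "T j \<subseteq> set (es ! j)" if "j < length es" for j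
          using distinct_es[OF that] es_sub[OF that] es_size[OF that] length_le[OF that] T(1)[OF that] by auto
        show "T j = set (es ! j)" if "j < length es" "length (es ! j) \<le> L" for j using T(2) that .
        show "L \<le> card (T j)" if "j < length es" "L < length (es ! j)" for j using T(3) that .
        show "lca.owner n es L X u \<noteq> None" if "j < length es" "length (es ! j) \<le> L" "u \<in> set (es ! j)" for j u
          using T(2)[OF that(1,2)] T(4)[OF that(1), of u] that by simp
        show "lca.owner n es L X u \<noteq> None" if "j < length es" "u \<in> T j" "u \<in> set vs" for j u
          using T(4)[OF that(1,2)] that by simp
        show "\<exists>a<d. lca.incident n es u a = j" if j: "j < length es" and le: "length (es ! j) \<le> L" and u: "u \<in> set (es ! j)" for j u
        proof -
          obtain a where "a < D' * length (es ! j)" "read_input n es Incident_Edge u a = j"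
            using incident_index[OF j u] by blast
          moreover have "D' * length (es ! j) \<le> d" using le by (simp add: d_def)
          ultimately show ?thesis by (intro exI[of _ a]) (auto simp: lca.incident_def)
        qed
        show "(d * L) ^ s \<le> X" using p(6) by (simp add: d_def)
        show "s \<le> L" by (fact p(4))
        show "2 \<le> L" by (fact L2)
        show "1 \<le> d" using D'(2) L2 by (auto simp: d_def)
        show "Z = X * X * X" by (fact Z_def)
        show "1 \<le> X" by (fact X1)
        show "n < ram.W w" "length es < ram.W w" "X * L < ram.W w" "d * L < ram.W w" "4 ^ L \<le> ram.W w" "Z < ram.W w" "4 < ram.W w"
          using nm wb by (auto simp: ram.W_def L_def d_def Z_def)
        show "L = 4 * floorlog 2 n" "d = D' * L" "X = 2 ^ (floorlog 2 n div K)" by (simp_all add: L_def d_def X_def l_def)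
        show "K < 2 ^ w" "D' < 2 ^ w" using p(2,3) wb(6) by linarith+
        show "(\<Sum>f\<in>{f\<in>{..<length es}. u \<in> T f}. 2 * (1/2) ^ card (T f) * (9/8) ^ card (T f) * (5/4) ^ card (T f)) \<le> (1/4 :: real)" for u
          by (rule weight_bound[OF T(2,3,1) p(7)])
        show "set vs \<subseteq> {..<n}" by (fact vs(1))
      qed
      have TP: "real TP \<le> real n powr \<beta>"
      proof -
        have "TP \<le> 300 * X ^ 4 * L ^ 2"
          using time_bound[OF X1 L2] by (simp only: Z_def)
        then have "real TP \<le> real (300 * X ^ 4 * L ^ 2)" by (simp only: of_nat_le_iff)
        also have "\<dots> = 300 * real X ^ 4 * real L ^ 2" by simp
        also note p(9)
        finally show ?thesis .
      qed
      have "1 - ln (real n) powr (- c) \<le> 1 - (length vs * ((5/4) / (9/8) ^ s) + n * ((5/4) / (9/8) ^ X))"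
      proof -
        have "length vs * ((5/4) / (9/8) ^ s) \<le> ln n powr c * ((5/4) / (9/8) ^ s)"
          using vs(2) by (intro mult_right_mono) auto
        then show ?thesis using p(8) by linarith
      qed
      also note success[OF TP e(3)]
      finally show ?thesis
        using answers_queries[OF vs(1) mem_init TP, of _ "[]"] by (auto simp: Let_def mE w_def)
    qed
  qed simp
  then show ?thesis by blast
qed

end
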